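(* Let $r_\lambda$ be a real resonance point of the line $\gamma=\{H_r=H_0+rV:r\in\mathbb R\}$, $V=F^*JF$, corresponding to a real number $\lambda\in\Lambda(\gamma,F)$. Let $u\in\mathcal K$. The following assertions are equivalent: (1) $u\in\Upsilon_{\lambda+i0}(r_\lambda)$ and for all non-resonant real numbers $s$, $\sqrt{\operatorname{Im}T_{\lambda+i0}(H_s)}\,Ju=0$. (2) $u\in\Upsilon_{\lambda-i0}(r_\lambda)$ and for all non-resonant real numbers $s$, $\sqrt{\operatorname{Im}T_{\lambda+i0}(H_s)}\,Ju=0$. (3) $u\in\Upsilon_{\lambda+i0}(r_\lambda)$ and for all non-resonant real numbers $s$, $A_{\lambda+i0}(s)u=A_{\lambda-i0}(s)u$. (4) $u\in\Upsilon_{\lambda-i0}(r_\lambda)$ and for all non-resonant real numbers $s$, $A_{\lambda+i0}(s)u=A_{\lambda-i0}(s)u$. (5) $u\in\Upsilon_{\lambda+i0}(r_\lambda)$ or $u\in\Upsilon_{\lambda-i0}(r_\lambda)$, and for all $j=0,1,2,\ldots,d-1$, where $d$ is the order of $r_\lambda$, $\mathbf A^j_{\lambda+i0}(r_\lambda)u=\mathbf A^j_{\lambda-i0}(r_\lambda)u$. (6) $u\in\Upsilon_{\lambda+i0}(r_\lambda)$ and there exists a non-resonant real number $r$ such that for all $j=0,1,2,\ldots$, $(A_{\lambda+i0}(r)-A_{\lambda-i0}(r))\mathbf A^j_{\lambda+i0}(r_\lambda)u=0$. (7) $u\in\Upsilon_{\lambda-i0}(r_\lambda)$ and there exists a non-resonant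 real number $r$ such that for all $j=0,1,2,\ldots$, $(A_{\lambda+i0}(r)-A_{\lambda-i0}(r))\mathbf A^j_{\lambda-i0}(r_\lambda)u=0$. (8) $u\in\Upsilon_{\lambda+i0}(r_\lambda)$ and all the coefficients $c_{+j}$ of $u$ are equal to zero. (9) $u\in\Upsilon_{\lambda-i0}(r_\lambda)$ and all the coefficients $c_{-j}$ of $u$ are equal to zero. The set $\Upsilon^{\mathrm I}_{\lambda+i0}(r_\lambda)$ of vectors which satisfy any of these equivalent conditions is a vector subspace of $\Upsilon_{\lambda+i0}(r_\lambda)\cap\Upsilon_{\lambda-i0}(r_\lambda)$, and it is invariant with respect to both $\mathbf A^j_{\lambda+i0}(r_\lambda)$ and $\mathbf A^j_{\lambda-i0}(r_\lambda)$.
   Context: Setting. Scalar products are linear in the second argument. $\mathcal H,\mathcal K$ are complex separable Hilbert spaces. $F:\mathcal H\to\mathcal K$ is a closed densely defined operator with trivial kernel and co-kernel. $\gamma=\{H_r=H_0+rV:r\in\mathbb R\}$ is a line of self-adjoint operators on $\mathcal H$, $V=F^*JF$ self-adjoint with $J$ bounded self-adjoint on $\mathcal K$. Standing assumptions: all $H_r$ have a common dense domain $\mathcal D$, $\mathcal D\subset\operatorname{dom}(F)\cap\operatorname{dom}(V)$, $V$ is relatively compact with respect to each $H_r$, and for non-real $z$ the operator $T_z(H_r):=F(H_r-z)^{-1}F^*$ (densely defined on $\operatorname{dom}F^*$) extends to a compact operator on $\mathcal K$, also denoted $T_z(H_r)$. $\Lambda(H_r,F)$ is the set of real $\lambda$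 for which the norm limits $T_{\lambda\pm i0}(H_r):=\lim_{y\to0^+}T_{\lambda\pm iy}(H_r)$ exist (assumed of full Lebesgue measure), and $\Lambda(\gamma,F)=\bigcup_r\Lambda(H_r,F)$. For $\lambda\in\Lambda(\gamma,F)$ a real $r$ is non-resonant if $\lambda\in\Lambda(H_r,F)$, otherwise it is a real resonance point. $\operatorname{Im}T=(T-T^* )/(2i)$. For $z=\lambda\pm i0$ and non-resonant $s$ put $A_z(s)=T_z(H_s)J$; as a function of $s$ it extends meromorphically to $\mathbb C$, its real poles being the real resonance points. For such a pole $r_\lambda$: $\Upsilon^k_z(r_\lambda)=\{u\in\mathcal K:(1+(r_\lambda-s)A_z(s))^ku=0\}$ (independent of the non-resonant real $s$), $\Upsilon_z(r_\lambda)=\bigcup_k\Upsilon_z^k(r_\lambda)$; the order $d$ of $r_\lambda$ is the smallest $k$ with $\Upsilon^k_z(r_\lambda)=\Upsilon_z(r_\lambda)$ (it is the same for $z=\lambda+i0$ and $z=\lambda-i0$). $P_z(r_\lambda)=\frac1{2\pi i}\oint_{C(r_\lambda)}A_z(s)\,ds$ (an idempotent with range $\Upsilon_z(r_\lambda)$) and $\mathbf A_z(r_\lambda)=\frac1{2\pi i}\oint_{C(r_\lambda)}(s-r_\lambda)A_z(s)\,ds$, where $C(r_\lambda)$ is a small counter-clockwise circle around $r_\lambda$ enclosing no other poles. $\mathbf A^j_z(r_\lambda)$ is the $j$-th power of $\mathbf A_z(r_\lambda)$ for $j\ge1$, with the convention $\mathbf A^0_z(r_\lambda)=P_z(r_\lambda)$.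 For $u\in\Upsilon_{\lambda\pm i0}(r_\lambda)$ with $u\in\Upsilon^k_{\lambda\pm i0}(r_\lambda)$, the coefficients $c_{\pm j}$, $j=2,\ldots,k$, are the real numbers $c_{\pm j}=\operatorname{Im}\langle u,J\mathbf A^{j-1}_{\lambda\pm i0}(r_\lambda)u\rangle$; they are the coefficients in the identity $\langle Ju,\operatorname{Im}T_{\lambda\pm i0}(H_s)Ju\rangle=\sum_{j=2}^kc_{\pm j}(s-r_\lambda)^{-j}$ valid for all non-resonant $s$. *)

theory Defs
  imports "HOL-Complex_Analysis.Complex_Analysis"
begin

section \<open>Complex Hilbert spaces\<close>

text \<open>The inner product is conjugate-linear in the first and linear in the second argument.\<close>

class complex_hilbert = banach +
  fixes scaleC :: "complex \<Rightarrow> 'a \<Rightarrow> 'a" (infixr \<open>*\<^sub>C\<close> 75)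
    and cinner :: "'a \<Rightarrow> 'a \<Rightarrow> complex"
  assumes scaleC_add_right: "c *\<^sub>C (x + y) = c *\<^sub>C x + c *\<^sub>C y"
    and scaleC_add_left: "(b + c) *\<^sub>C x = b *\<^sub>C x + c *\<^sub>C x"
    and scaleC_scaleC: "b *\<^sub>C c *\<^sub>C x = (b * c) *\<^sub>C x"
    and scaleC_of_real: "complex_of_real a *\<^sub>C x = a *\<^sub>R x"
    and cinner_commute: "cinner x y = cnj (cinner y x)"
    and cinner_add_right: "cinner x (y + z) = cinner x y + cinner x z"
    and cinner_scaleC_right: "cinner x (c *\<^sub>C y) = c * cinner x y"
    and cinner_self: "cinner x x = complex_of_real ((norm x)\<^sup>2)"

definition csubspace :: "'a::complex_hilbert set \<Rightarrow> bool" where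
  "csubspace S \<longleftrightarrow> subspace S \<and> (\<forall>c. \<forall>x\<in>S. c *\<^sub>C x \<in> S)"


section \<open>Bounded operators\<close>

text \<open>
  Elements of \<open>'a \<Rightarrow>\<^sub>L 'b\<close> are bounded and a priori only real-linear; complex linearity is
  the separate predicate \<open>clinear_op\<close>. Convergence of operators is convergence in the
  operator norm of \<open>'a \<Rightarrow>\<^sub>L 'b\<close>.
\<close>

definition clinear_op :: "('a::complex_hilbert \<Rightarrow>\<^sub>L 'b::complex_hilbert) \<Rightarrow> bool" where
  "clinear_op T \<longleftrightarrow> (\<forall>c x. T (c *\<^sub>C x) = c *\<^sub>C T x)"

definition scale_op :: "complex \<Rightarrow> ('a::complex_hilbert \<Rightarrow>\<^sub>L 'b::complex_hilbert) \<Rightarrow> 'a \<Rightarrow>\<^sub>L 'b" where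
  "scale_op c T = Blinfun (\<lambda>x. c *\<^sub>C T x)"

lemma norm_scaleC: "norm (c *\<^sub>C x) = cmod c * norm (x :: 'a::complex_hilbert)"
proof -
  have "cinner (c *\<^sub>C x) (c *\<^sub>C x) = c * cnj c * cinner x x"
    by (metis cinner_commute cinner_scaleC_right complex_cnj_mult mult.assoc)
  then have "complex_of_real ((norm (c *\<^sub>C x))\<^sup>2) = complex_of_real ((cmod c * norm x)\<^sup>2)"
    by (simp add: cinner_self complex_norm_square[symmetric] power_mult_distrib del: of_real_power
        flip: of_real_mult)
  then have "(norm (c *\<^sub>C x))\<^sup>2 = (cmod c * norm x)\<^sup>2"
    by (simp only: of_real_eq_iff)
  then show ?thesis
    by (simp add: power2_eq_iff_nonneg)
qed

lemma bounded_linear_scaleC: "bounded_linear (\<lambda>x. c *\<^sub>C (x :: 'a::complex_hilbert))"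
proof (rule bounded_linear_intro[where K = "cmod c"])
  show "c *\<^sub>C (r *\<^sub>R x) = r *\<^sub>R (c *\<^sub>C x)" for r and x :: 'a
    by (simp add: scaleC_of_real[symmetric] scaleC_scaleC mult.commute)
qed (simp_all add: scaleC_add_right norm_scaleC mult.commute)

lemma scale_op_apply: "scale_op c T x = c *\<^sub>C T x"
  unfolding scale_op_def
  using bounded_linear_compose[OF bounded_linear_scaleC blinfun.bounded_linear_right]
  by (rule bounded_linear_Blinfun_apply[THEN fun_cong])

definition compact_op :: "('a::complex_hilbert \<Rightarrow>\<^sub>L 'b::complex_hilbert) \<Rightarrow> bool" where
  "compact_op T \<longleftrightarrow> clinear_op T \<and> compact (closure (T ` cball 0 1))"

definition selfadjoint_op :: "('a::complex_hilbert \<Rightarrow>\<^sub>L 'a) \<Rightarrow> bool" where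
  "selfadjoint_op T \<longleftrightarrow> clinear_op T \<and> (\<forall>x y. cinner (T x) y = cinner x (T y))"

definition adjoint_op :: "('a::complex_hilbert \<Rightarrow>\<^sub>L 'b::complex_hilbert) \<Rightarrow> 'b \<Rightarrow>\<^sub>L 'a" where
  "adjoint_op T = (THE S :: 'b \<Rightarrow>\<^sub>L 'a. \<forall>x y. cinner (S y) x = cinner y (T x))"

definition Im_op :: "('a::complex_hilbert \<Rightarrow>\<^sub>L 'a) \<Rightarrow> 'a \<Rightarrow>\<^sub>L 'a" where
  "Im_op T = scale_op (1 / (2 * \<i>)) (T - adjoint_op T)"

definition positive_op :: "('a::complex_hilbert \<Rightarrow>\<^sub>L 'a) \<Rightarrow> bool" where
  "positive_op T \<longleftrightarrow> clinear_op T \<and> (\<forall>x. cinner x (T x) \<in> \<real> \<and> 0 \<le> Re (cinner x (T x)))"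

text \<open>The (unique) positive square root of a positive operator.\<close>

definition sqrt_op :: "('a::complex_hilbert \<Rightarrow>\<^sub>L 'a) \<Rightarrow> 'a \<Rightarrow>\<^sub>L 'a" where
  "sqrt_op T = (SOME S. positive_op S \<and> S o\<^sub>L S = T)"


section \<open>Operator-valued functions of a complex variable\<close>

definition holomorphic_op_on ::
    "(complex \<Rightarrow> ('a::complex_hilbert \<Rightarrow>\<^sub>L 'b::complex_hilbert)) \<Rightarrow> complex set \<Rightarrow> bool" where
  "holomorphic_op_on g S \<longleftrightarrow>
     (\<forall>s\<in>S. \<exists>D. (g has_derivative (\<lambda>h. scale_op h D)) (at s within S))"

definition meromorphic_op ::
    "(complex \<Rightarrow> ('a::complex_hilbert \<Rightarrow>\<^sub>L 'b::complex_hilbert)) \<Rightarrow> bool" where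
  "meromorphic_op f \<longleftrightarrow>
     (\<forall>s. clinear_op (f s)) \<and>
     (\<forall>a. \<exists>(n::nat) \<epsilon> g. \<epsilon> > 0 \<and> holomorphic_op_on g (ball a \<epsilon>) \<and>
        (\<forall>s\<in>ball a \<epsilon> - {a}. f s = scale_op (1 / (s - a) ^ n) (g s)))"

text \<open>
  The next two definitions follow \<^const>\<open>has_contour_integral\<close> and \<^const>\<open>residue\<close>.
  Thus \<open>residue_op f a\<close> is \<open>1 / (2 \<pi> i)\<close> times the integral of \<open>f\<close> over
  any sufficiently small counter-clockwise circle around \<open>a\<close>.
\<close>

definition has_contour_integral_op ::
    "(complex \<Rightarrow> ('a::complex_hilbert \<Rightarrow>\<^sub>L 'b::complex_hilbert)) \<Rightarrow> ('a \<Rightarrow>\<^sub>L 'b) \<Rightarrow> (real \<Rightarrow> complex) \<Rightarrow> bool"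
  where
  "has_contour_integral_op f I g \<longleftrightarrow>
     ((\<lambda>x. scale_op (vector_derivative g (at x within {0..1})) (f (g x))) has_integral I) {0..1}"

definition residue_op ::
    "(complex \<Rightarrow> ('a::complex_hilbert \<Rightarrow>\<^sub>L 'b::complex_hilbert)) \<Rightarrow> complex \<Rightarrow> 'a \<Rightarrow>\<^sub>L 'b" where
  "residue_op f a = (SOME R. \<exists>e>0. \<forall>\<epsilon>>0. \<epsilon> < e \<longrightarrow>
     has_contour_integral_op f (scale_op (2 * pi * \<i>) R) (circlepath a \<epsilon>))"


section \<open>Unbounded operators\<close>

text \<open>
  An unbounded operator is represented by its graph, so the domain is \<^const>\<open>Domain\<close>, the operator
  is closed iff its graph is a closed set, extension is inclusion of graphs, and \<open>G O K\<close> is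
  ``first \<open>G\<close>, then \<open>K\<close>'' on the natural domain.
\<close>

definition linear_operator :: "('a::complex_hilbert \<times> 'b::complex_hilbert) set \<Rightarrow> bool" where
  "linear_operator G \<longleftrightarrow> subspace G \<and> (\<forall>c x y. (x, y) \<in> G \<longrightarrow> (c *\<^sub>C x, c *\<^sub>C y) \<in> G) \<and> single_valued G"

definition densely_defined :: "('a::complex_hilbert \<times> 'b::complex_hilbert) set \<Rightarrow> bool" where
  "densely_defined G \<longleftrightarrow> closure (Domain G) = UNIV"

definition graph_of :: "('a::complex_hilbert \<Rightarrow>\<^sub>L 'b::complex_hilbert) \<Rightarrow> ('a \<times> 'b) set" where
  "graph_of T = {(x, T x) | x. True}"

definition adj :: "('a::complex_hilbert \<times> 'b::complex_hilbert) set \<Rightarrow> ('b \<times> 'a) set" where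
  "adj G = {(y, w). \<forall>(x, v)\<in>G. cinner y v = cinner w x}"

definition self_adjoint :: "('a::complex_hilbert \<times> 'a) set \<Rightarrow> bool" where
  "self_adjoint G \<longleftrightarrow> linear_operator G \<and> densely_defined G \<and> adj G = G"

definition trivial_kernel :: "('a::complex_hilbert \<times> 'b::complex_hilbert) set \<Rightarrow> bool" where
  "trivial_kernel G \<longleftrightarrow> (\<forall>x. (x, 0) \<in> G \<longrightarrow> x = 0)"

text \<open>The co-kernel is taken in the Hilbert space sense: the orthogonal complement of the range.\<close>

definition trivial_cokernel :: "('a::complex_hilbert \<times> 'b::complex_hilbert) set \<Rightarrow> bool" where
  "trivial_cokernel G \<longleftrightarrow> (\<forall>y. (\<forall>v\<in>Range G. cinner y v = 0) \<longrightarrow> y = 0)"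

text \<open>The operator \<open>(H - z)\<^sup>-\<^sup>1\<close>.\<close>

definition resolvent :: "('a::complex_hilbert \<times> 'a) set \<Rightarrow> complex \<Rightarrow> ('a \<times> 'a) set" where
  "resolvent H z = {(y - z *\<^sub>C x, x) | x y. (x, y) \<in> H}"

text \<open>The operator \<open>V (H - z)\<^sup>-\<^sup>1\<close> is everywhere defined and compact.\<close>

definition relatively_compact :: "('a::complex_hilbert \<times> 'a) set \<Rightarrow> ('a \<times> 'a) set \<Rightarrow> bool" where
  "relatively_compact V H \<longleftrightarrow> Domain H \<subseteq> Domain V \<and>
     (\<forall>z. Im z \<noteq> 0 \<longrightarrow> (\<exists>T. compact_op T \<and> resolvent H z O V = graph_of T))"


section \<open>The line of operators and its sandwiched resolvent\<close>

text \<open>The operators \<open>V = F\<^sup>* J F\<close>, \<open>H\<^sub>0 + r V\<close> and \<open>F (H - z)\<^sup>-\<^sup>1 F\<^sup>*\<close> on their natural domains.\<close>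

definition FJF :: "('h::complex_hilbert \<times> 'k::complex_hilbert) set \<Rightarrow> ('k \<Rightarrow>\<^sub>L 'k) \<Rightarrow> ('h \<times> 'h) set" where
  "FJF F J = F O graph_of J O adj F"

definition line :: "('h::complex_hilbert \<times> 'h) set \<Rightarrow> ('h \<times> 'h) set \<Rightarrow> real \<Rightarrow> ('h \<times> 'h) set" where
  "line H0 V r = {(x, y + r *\<^sub>R v) | x y v. (x, y) \<in> H0 \<and> (x, v) \<in> V}"

definition sandwich ::
    "('h::complex_hilbert \<times> 'k::complex_hilbert) set \<Rightarrow> ('h \<times> 'h) set \<Rightarrow> complex \<Rightarrow> ('k \<times> 'k) set" where
  "sandwich F H z = adj F O resolvent H z O F"

definition compact_extension :: "('a::complex_hilbert \<times> 'b::complex_hilbert) set \<Rightarrow> ('a \<Rightarrow>\<^sub>L 'b) \<Rightarrow> bool" where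
  "compact_extension G T \<longleftrightarrow> compact_op T \<and> G \<subseteq> graph_of T"

text \<open>The compact operator \<open>T\<^sub>z(H)\<close>, for non-real \<open>z\<close>.\<close>

definition Tz ::
    "('h::complex_hilbert \<times> 'k::complex_hilbert) set \<Rightarrow> ('h \<times> 'h) set \<Rightarrow> complex \<Rightarrow> 'k \<Rightarrow>\<^sub>L 'k" where
  "Tz F H z = (THE T. compact_extension (sandwich F H z) T)"

text \<open>\<open>Upper\<close> stands for \<open>\<lambda> + i0\<close> and \<open>Lower\<close> for \<open>\<lambda> - i0\<close>.\<close>

datatype side = Upper | Lower

definition approach :: "side \<Rightarrow> real \<Rightarrow> real \<Rightarrow> complex" where
  "approach \<sigma> lam y = (case \<sigma> of Upper \<Rightarrow> Complex lam y | Lower \<Rightarrow> Complex lam (- y))"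

definition T_bd ::
    "('h::complex_hilbert \<times> 'k::complex_hilbert) set \<Rightarrow> ('h \<times> 'h) set \<Rightarrow> side \<Rightarrow> real \<Rightarrow> 'k \<Rightarrow>\<^sub>L 'k" where
  "T_bd F H \<sigma> lam = Lim (at_right 0) (\<lambda>y. Tz F H (approach \<sigma> lam y))"

definition Lambda :: "('h::complex_hilbert \<times> 'k::complex_hilbert) set \<Rightarrow> ('h \<times> 'h) set \<Rightarrow> real set" where
  "Lambda F H = {lam. \<forall>\<sigma>. \<exists>L. ((\<lambda>y. Tz F H (approach \<sigma> lam y)) \<longlongrightarrow> L) (at_right 0)}"

text \<open>From here on \<open>H :: real \<Rightarrow> _\<close> is the whole line \<open>r \<mapsto> H\<^sub>r\<close>.\<close>

definition Lambda_line ::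
    "('h::complex_hilbert \<times> 'k::complex_hilbert) set \<Rightarrow> (real \<Rightarrow> ('h \<times> 'h) set) \<Rightarrow> real set" where
  "Lambda_line F H = (\<Union>r. Lambda F (H r))"

definition nonresonant ::
    "('h::complex_hilbert \<times> 'k::complex_hilbert) set \<Rightarrow> (real \<Rightarrow> ('h \<times> 'h) set) \<Rightarrow> real \<Rightarrow> real \<Rightarrow> bool" where
  "nonresonant F H lam r \<longleftrightarrow> lam \<in> Lambda F (H r)"

definition resonance_point ::
    "('h::complex_hilbert \<times> 'k::complex_hilbert) set \<Rightarrow> (real \<Rightarrow> ('h \<times> 'h) set) \<Rightarrow> real \<Rightarrow> real \<Rightarrow> bool" where
  "resonance_point F H lam r \<longleftrightarrow> lam \<in> Lambda_line F H \<and> \<not> nonresonant F H lam r"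


section \<open>Resonance vectors\<close>

text \<open>\<open>A_bd\<close> is \<open>A\<^sub>z(s)\<close> at non-resonant real \<open>s\<close>; \<open>A_mer\<close> is its meromorphic extension
  to the complex plane (unique up to its values at the poles).\<close>

definition A_bd ::
    "('h::complex_hilbert \<times> 'k::complex_hilbert) set \<Rightarrow> ('k \<Rightarrow>\<^sub>L 'k) \<Rightarrow> (real \<Rightarrow> ('h \<times> 'h) set) \<Rightarrow>
     side \<Rightarrow> real \<Rightarrow> real \<Rightarrow> 'k \<Rightarrow>\<^sub>L 'k" where
  "A_bd F J H \<sigma> lam s = T_bd F (H s) \<sigma> lam o\<^sub>L J"

definition A_mer ::
    "('h::complex_hilbert \<times> 'k::complex_hilbert) set \<Rightarrow> ('k \<Rightarrow>\<^sub>L 'k) \<Rightarrow> (real \<Rightarrow> ('h \<times> 'h) set) \<Rightarrow>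
     side \<Rightarrow> real \<Rightarrow> complex \<Rightarrow> 'k \<Rightarrow>\<^sub>L 'k" where
  "A_mer F J H \<sigma> lam = (SOME f. meromorphic_op f \<and>
     (\<forall>s::real. nonresonant F H lam s \<longrightarrow> f (of_real s) = A_bd F J H \<sigma> lam s))"

text \<open>For each single non-resonant \<open>s\<close> the condition below describes the same set, so quantifying
  over all of them amounts to choosing any one.\<close>

definition Upsilon_k ::
    "('h::complex_hilbert \<times> 'k::complex_hilbert) set \<Rightarrow> ('k \<Rightarrow>\<^sub>L 'k) \<Rightarrow> (real \<Rightarrow> ('h \<times> 'h) set) \<Rightarrow>
     side \<Rightarrow> real \<Rightarrow> real \<Rightarrow> nat \<Rightarrow> 'k set" where
  "Upsilon_k F J H \<sigma> lam r k = {u. \<forall>s. nonresonant F H lam s \<longrightarrow>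
     ((\<lambda>v. v + (r - s) *\<^sub>R A_bd F J H \<sigma> lam s v) ^^ k) u = 0}"

definition Upsilon ::
    "('h::complex_hilbert \<times> 'k::complex_hilbert) set \<Rightarrow> ('k \<Rightarrow>\<^sub>L 'k) \<Rightarrow> (real \<Rightarrow> ('h \<times> 'h) set) \<Rightarrow>
     side \<Rightarrow> real \<Rightarrow> real \<Rightarrow> 'k set" where
  "Upsilon F J H \<sigma> lam r = (\<Union>k. Upsilon_k F J H \<sigma> lam r k)"

definition res_order ::
    "('h::complex_hilbert \<times> 'k::complex_hilbert) set \<Rightarrow> ('k \<Rightarrow>\<^sub>L 'k) \<Rightarrow> (real \<Rightarrow> ('h \<times> 'h) set) \<Rightarrow>
     side \<Rightarrow> real \<Rightarrow> real \<Rightarrow> nat" where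
  "res_order F J H \<sigma> lam r =
     (LEAST k. Upsilon_k F J H \<sigma> lam r k = Upsilon F J H \<sigma> lam r)"

definition P_res ::
    "('h::complex_hilbert \<times> 'k::complex_hilbert) set \<Rightarrow> ('k \<Rightarrow>\<^sub>L 'k) \<Rightarrow> (real \<Rightarrow> ('h \<times> 'h) set) \<Rightarrow>
     side \<Rightarrow> real \<Rightarrow> real \<Rightarrow> 'k \<Rightarrow>\<^sub>L 'k" where
  "P_res F J H \<sigma> lam r = residue_op (A_mer F J H \<sigma> lam) (of_real r)"

definition A_res ::
    "('h::complex_hilbert \<times> 'k::complex_hilbert) set \<Rightarrow> ('k \<Rightarrow>\<^sub>L 'k) \<Rightarrow> (real \<Rightarrow> ('h \<times> 'h) set) \<Rightarrow>
     side \<Rightarrow> real \<Rightarrow> real \<Rightarrow> 'k \<Rightarrow>\<^sub>L 'k" where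
  "A_res F J H \<sigma> lam r =
     residue_op (\<lambda>s. scale_op (s - of_real r) (A_mer F J H \<sigma> lam s)) (of_real r)"

definition A_res_pow ::
    "('h::complex_hilbert \<times> 'k::complex_hilbert) set \<Rightarrow> ('k \<Rightarrow>\<^sub>L 'k) \<Rightarrow> (real \<Rightarrow> ('h \<times> 'h) set) \<Rightarrow>
     side \<Rightarrow> real \<Rightarrow> real \<Rightarrow> nat \<Rightarrow> 'k \<Rightarrow> 'k" where
  "A_res_pow F J H \<sigma> lam r j =
     (if j = 0 then blinfun_apply (P_res F J H \<sigma> lam r)
      else blinfun_apply (A_res F J H \<sigma> lam r) ^^ j)"

text \<open>The coefficient \<open>c\<^bsub>\<plusminus>j\<^esub>\<close> of \<open>u\<close>, for \<open>j \<ge> 2\<close>.\<close>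

definition coeff_c ::
    "('h::complex_hilbert \<times> 'k::complex_hilbert) set \<Rightarrow> ('k \<Rightarrow>\<^sub>L 'k) \<Rightarrow> (real \<Rightarrow> ('h \<times> 'h) set) \<Rightarrow>
     side \<Rightarrow> real \<Rightarrow> real \<Rightarrow> 'k \<Rightarrow> nat \<Rightarrow> real" where
  "coeff_c F J H \<sigma> lam r u j = Im (cinner u (J (A_res_pow F J H \<sigma> lam r (j - 1) u)))"

end

theory Submission
  imports Defs
begin

text \<open>
  Write \<open>R\<^sub>\<plusminus> j\<close> for the coefficient of \<open>(s - r\<^sub>0)\<^sup>-\<^sup>j\<^sup>-\<^sup>1\<close> in the Laurent expansion of \<open>A\<^sub>\<plusminus>(s)\<close>
  at \<open>r\<^sub>0\<close>; it is the \<open>j\<close>-th power of the nilpotent operator in the statement, and \<open>R\<^sub>\<plusminus> 0\<close> is the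
  projection onto the resonance vectors. The resolvent identity makes \<open>A\<^sub>\<plusminus>(s)\<close> equal to
  \<open>K (1 + (s - s\<^sub>0) K)\<^sup>-\<^sup>1\<close> for the compact operator \<open>K = A\<^sub>\<plusminus>(s\<^sub>0)\<close>, so Riesz theory gives the expansion,
  and on resonance vectors it consists of its principal part only. All nine conditions
  say that \<open>u\<close> is a resonance vector with \<open>R\<^sub>+ j u = R\<^sub>- j u\<close> for all \<open>j\<close>: the square roots are handled by
  \<open>2i Im T\<^sub>+ = T\<^sub>+ - T\<^sub>-\<close> and \<open>Im T\<^sub>+ \<ge> 0\<close>, the coefficients \<open>c\<^sub>j\<close> by the duality
  \<open>(J R\<^sub>+ j)\<^sup>* = J R\<^sub>- j\<close>, which also shows that both orders agree.
\<close>

section \<open>Geometry of complex Hilbert spaces\<close>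

text \<open>The residues in the statement belong to a chosen meromorphic extension that is
  prescribed only at non-resonant real points. They become computable through two facts. The point
  \<open>r\<^sub>0\<close> is an isolated resonance point, since injectivity of 1 + (r - s) A(s) on
  both sides already produces the boundary limits at r. And an identity theorem carries the
  expansion from a real interval into a complex punctured disc. The expansion has no regular part on
  resonance vectors because K is invertible there and turns the family into the resolvent of a
  nilpotent operator. For the coefficients c_j, the vanishing of all of them together with the
  reality of the remaining pairing of u with J u makes the pairing of J u with A(s) u real at every
  s; positivity upgrades this vanishing of a quadratic form to the equality of the two operators at
  u.\<close>

lemma scaleC_one [simp]: "1 *\<^sub>C x = (x :: 'a::complex_hilbert)"
  using scaleC_of_real[of 1 x] by simp

global_interpretation cvec: vector_space "scaleC :: complex \<Rightarrow> 'a::complex_hilbert \<Rightarrow> 'a"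
  by unfold_locales (simp_all add: scaleC_add_right scaleC_add_left scaleC_scaleC)

lemma scaleC_scaleR: "c *\<^sub>C a *\<^sub>R x = a *\<^sub>R c *\<^sub>C (x :: 'a::complex_hilbert)"
  by (simp add: scaleC_of_real[symmetric] scaleC_scaleC mult.commute)

lemma cinner_add_left: "cinner (x + y) z = cinner x z + cinner y (z :: 'a::complex_hilbert)"
  by (metis cinner_add_right cinner_commute complex_cnj_add)

lemma cinner_scaleC_left [simp]: "cinner (c *\<^sub>C x) y = cnj c * cinner x (y :: 'a::complex_hilbert)"
  by (metis cinner_scaleC_right cinner_commute complex_cnj_mult)

declare cinner_scaleC_right [simp]

lemma cinner_scaleR_right [simp]: "cinner x (a *\<^sub>R y) = of_real a * cinner x (y :: 'a::complex_hilbert)"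
  by (simp flip: scaleC_of_real)

lemma cinner_scaleR_left [simp]: "cinner (a *\<^sub>R x) y = of_real a * cinner x (y :: 'a::complex_hilbert)"
  by (simp flip: scaleC_of_real)

lemma cinner_zero_right [simp]: "cinner x 0 = 0"
  using cinner_scaleR_right[of x 0 0] by simp

lemma cinner_zero_left [simp]: "cinner 0 x = 0"
  using cinner_scaleR_left[of 0 0 x] by simp

lemma cinner_minus_right [simp]: "cinner x (- y) = - cinner x (y :: 'a::complex_hilbert)"
  using cinner_scaleR_right[of x "-1" y] by simp

lemma cinner_minus_left [simp]: "cinner (- x) y = - cinner x (y :: 'a::complex_hilbert)"
  using cinner_scaleR_left[of "-1" x y] by simp

lemma cinner_diff_right: "cinner x (y - z) = cinner x y - cinner x (z :: 'a::complex_hilbert)"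
  using cinner_add_right[of x y "- z"] by simp

lemma cinner_diff_left: "cinner (x - y) z = cinner x z - cinner y (z :: 'a::complex_hilbert)"
  using cinner_add_left[of x "- y" z] by simp

lemmas cinner_linear_simps = cinner_add_left cinner_add_right cinner_diff_left cinner_diff_right

lemma Re_cinner_self: "Re (cinner x x) = (norm x)\<^sup>2"
  by (simp add: cinner_self)

lemma cinner_eq_zero_iff: "cinner x x = 0 \<longleftrightarrow> x = (0 :: 'a::complex_hilbert)"
  by (simp add: cinner_self)

lemma cinner_ext: "x = (y :: 'a::complex_hilbert)" if "\<And>z. cinner z x = cinner z y"
  using that[of "x - y"] cinner_eq_zero_iff[of "x - y"] by (simp add: cinner_diff_right)

lemma Re_cinner_commute: "Re (cinner x y) = Re (cinner y (x :: 'a::complex_hilbert))"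
  by (subst cinner_commute) simp

lemma norm_add_sq: "(norm (x + y))\<^sup>2 = (norm x)\<^sup>2 + 2 * Re (cinner x y) + (norm (y :: 'a::complex_hilbert))\<^sup>2"
  unfolding Re_cinner_self[symmetric] by (simp add: cinner_linear_simps Re_cinner_commute[of y x])

lemma norm_diff_sq: "(norm (x - y))\<^sup>2 = (norm x)\<^sup>2 - 2 * Re (cinner x y) + (norm (y :: 'a::complex_hilbert))\<^sup>2"
  using norm_add_sq[of x "- y"] by simp

text \<open>The triangle inequality, squared and expanded, bounds the real part of
  \<open>cinner x y\<close>; multiplying \<open>y\<close> by a scalar that makes the product real
  then reaches the modulus.\<close>

lemma norm_cinner_le: "cmod (cinner x y) \<le> norm x * norm (y :: 'a::complex_hilbert)"
proof -
  have Re_le: "Re (cinner x y) \<le> norm x * norm y" for x y :: 'a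
  proof -
    have "(norm (x + y))\<^sup>2 \<le> (norm x + norm y)\<^sup>2"
      by (simp add: norm_triangle_ineq power_mono)
    then show ?thesis unfolding norm_add_sq by (simp add: power2_sum)
  qed
  define c where "c = cnj (cinner x y)"
  have "c * cinner x y = of_real ((cmod (cinner x y))\<^sup>2)"
    unfolding c_def complex_norm_square by (simp add: mult.commute)
  then have "(cmod (cinner x y))\<^sup>2 = Re (cinner x (c *\<^sub>C y))"
    by simp
  also have "\<dots> \<le> norm x * (cmod c * norm y)"
    using Re_le[of x "c *\<^sub>C y"] by (simp add: norm_scaleC)
  also have "\<dots> = cmod (cinner x y) * (norm x * norm y)"
    by (simp add: c_def)
  finally show ?thesis
    by (cases "cinner x y = 0") (simp_all add: power2_eq_square)
qed

lemma bounded_bilinear_cinner: "bounded_bilinear (cinner :: 'a::complex_hilbert \<Rightarrow> _)"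
proof
  show "cinner (r *\<^sub>R a) b = r *\<^sub>R cinner a b" "cinner a (r *\<^sub>R b) = r *\<^sub>R cinner a b"
    for r and a b :: 'a by (simp_all add: scaleR_conv_of_real)
  show "\<exists>K. \<forall>a b. cmod (cinner a b) \<le> norm (a :: 'a) * norm b * K"
    by (rule exI[of _ 1]) (simp add: norm_cinner_le)
qed (simp_all add: cinner_linear_simps)

lemmas bounded_linear_cinner_right = bounded_bilinear.bounded_linear_right[OF bounded_bilinear_cinner]
lemmas tendsto_cinner = bounded_bilinear.tendsto[OF bounded_bilinear_cinner]

section \<open>Closed complex subspaces and orthogonal projection\<close>

lemma csubspaceD:
  assumes "csubspace M"
  shows "0 \<in> M" "x \<in> M \<Longrightarrow> y \<in> M \<Longrightarrow> x + y \<in> M" "x \<in> M \<Longrightarrow> y \<in> M \<Longrightarrow> x - y \<in> M"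
    "x \<in> M \<Longrightarrow> c *\<^sub>C x \<in> M" "x \<in> M \<Longrightarrow> a *\<^sub>R x \<in> M"
  using assms by (auto simp: csubspace_def subspace_0 subspace_add subspace_diff subspace_scale)

lemma csubspaceI:
  assumes "0 \<in> M" "\<And>x y. x \<in> M \<Longrightarrow> y \<in> M \<Longrightarrow> x + y \<in> M" "\<And>c x. x \<in> M \<Longrightarrow> c *\<^sub>C x \<in> M"
  shows "csubspace M"
  unfolding csubspace_def subspace_def using assms by (auto simp flip: scaleC_of_real)

text \<open>A minimising sequence is Cauchy by the parallelogram law.\<close>

lemma nearest_point:
  fixes M :: "'a::complex_hilbert set"
  assumes M: "csubspace M" and cl: "closed M"
  obtains m where "m \<in> M" "\<And>v. v \<in> M \<Longrightarrow> norm (x - m) \<le> norm (x - v)"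
proof -
  define d where "d = (INF v\<in>M. norm (x - v))"
  have bdd: "bdd_below ((\<lambda>v. norm (x - v)) ` M)"
    by (rule bdd_belowI[of _ 0]) auto
  have ne: "M \<noteq> {}" using csubspaceD(1)[OF M] by auto
  have d_le: "d \<le> norm (x - v)" if "v \<in> M" for v
    unfolding d_def by (rule cINF_lower[OF bdd that])
  have d0: "0 \<le> d" unfolding d_def by (rule cINF_greatest[OF ne]) simp
  have "\<exists>v\<in>M. norm (x - v) < d + 1 / Suc n" for n
    using cINF_less_iff[OF ne bdd, of "d + 1 / Suc n"] unfolding d_def[symmetric] by simp
  then obtain f where f: "\<And>n. f n \<in> M" "\<And>n. norm (x - f n) < d + 1 / Suc n"
    by metis
  have par: "(norm (f i - f j))\<^sup>2 \<le> 4 * ((d + 1 / Suc N)\<^sup>2 - d\<^sup>2)" if "i \<ge> N" "j \<ge> N" for i j N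
  proof -
    have b: "(norm (x - f k))\<^sup>2 \<le> (d + 1 / Suc N)\<^sup>2" if "k \<ge> N" for k
    proof (rule power_mono)
      have "1 / real (Suc k) \<le> 1 / Suc N" using that by (simp add: frac_le)
      then show "norm (x - f k) \<le> d + 1 / Suc N" using f(2)[of k] by linarith
    qed simp
    define p q where "p = x - f i" and "q = x - f j"
    have mid: "(1/2) *\<^sub>R (f i + f j) \<in> M"
      by (intro csubspaceD[OF M] f)
    have "p + q = 2 *\<^sub>R (x - (1/2) *\<^sub>R (f i + f j))"
      by (simp add: p_def q_def scaleR_diff_right scaleR_2)
    then have "norm (p + q) = 2 * norm (x - (1/2) *\<^sub>R (f i + f j))" by simp
    then have "norm (p + q) \<ge> 2 * d" using d_le[OF mid] by linarith
    then have "(norm (p + q))\<^sup>2 \<ge> (2 * d)\<^sup>2" by (rule power_mono) (use d0 in simp)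
    moreover have "(norm (p - q))\<^sup>2 + (norm (p + q))\<^sup>2 = 2 * (norm p)\<^sup>2 + 2 * (norm q)\<^sup>2"
      by (simp add: norm_add_sq norm_diff_sq)
    moreover have "norm (f i - f j) = norm (p - q)"
      by (simp add: p_def q_def norm_minus_commute)
    ultimately show ?thesis using b[OF that(1)] b[OF that(2)]
      unfolding p_def[symmetric] q_def[symmetric] by (simp add: power2_eq_square)
  qed
  have lim: "(\<lambda>N. 4 * ((d + 1 / Suc N)\<^sup>2 - d\<^sup>2)) \<longlonglongrightarrow> 4 * ((d + 0)\<^sup>2 - d\<^sup>2)"
    by (intro tendsto_intros LIMSEQ_inverse_real_of_nat[unfolded inverse_eq_divide])
  have "Cauchy f"
  proof (rule metric_CauchyI)
    fix e :: real assume "e > 0"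
    then have "\<forall>\<^sub>F N in sequentially. 4 * ((d + 1 / Suc N)\<^sup>2 - d\<^sup>2) < e\<^sup>2"
      using lim by (intro order_tendstoD(2)) auto
    then obtain N where N: "4 * ((d + 1 / Suc N)\<^sup>2 - d\<^sup>2) < e\<^sup>2"
      by (auto simp: eventually_sequentially)
    show "\<exists>N. \<forall>i\<ge>N. \<forall>j\<ge>N. dist (f i) (f j) < e"
    proof (intro exI allI impI)
      fix i j assume "i \<ge> N" "j \<ge> N"
      then have "(norm (f i - f j))\<^sup>2 < e\<^sup>2" using par N by fastforce
      then show "dist (f i) (f j) < e"
        unfolding dist_norm using \<open>e > 0\<close> by (meson less_imp_le power2_less_imp_less)
    qed
  qed
  then obtain m where m: "f \<longlonglongrightarrow> m" using Cauchy_convergent_iff convergent_def by blast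
  have mM: "m \<in> M" using closed_sequentially[OF cl] f(1) m by blast
  have "norm (x - m) \<le> d + 0"
  proof (rule LIMSEQ_le)
    show "(\<lambda>n. norm (x - f n)) \<longlonglongrightarrow> norm (x - m)" by (intro tendsto_intros m)
    show "(\<lambda>n. d + 1 / Suc n) \<longlonglongrightarrow> d + 0"
      by (intro tendsto_intros LIMSEQ_inverse_real_of_nat[unfolded inverse_eq_divide])
    show "\<exists>N. \<forall>n\<ge>N. norm (x - f n) \<le> d + 1 / Suc n" using f(2) less_imp_le by blast
  qed
  then have "norm (x - m) \<le> norm (x - v)" if "v \<in> M" for v using d_le[OF that] by simp
  with mM show ?thesis by (rule that)
qed

text \<open>At a nearest point \<open>m\<close>, moving by \<open>c *\<^sub>C v\<close> cannot
  shorten \<open>x - m\<close>. For \<open>c\<close> a small multiple of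
  \<open>cinner v (x - m)\<close> the first-order gain would beat the second-order loss, unless that
  inner product is zero.\<close>

lemma orthogonal_projection:
  fixes M :: "'a::complex_hilbert set"
  assumes M: "csubspace M" and cl: "closed M"
  obtains m where "m \<in> M" "\<And>v. v \<in> M \<Longrightarrow> cinner v (x - m) = 0"
proof -
  obtain m where m: "m \<in> M" "\<And>v. v \<in> M \<Longrightarrow> norm (x - m) \<le> norm (x - v)"
    using nearest_point[OF assms] by blast
  have "cinner v (x - m) = 0" if v: "v \<in> M" for v
  proof -
    define p t where "p = cinner v (x - m)" and "t = 1 / ((norm v)\<^sup>2 + 1)"
    have t: "t > 0" "t * (norm v)\<^sup>2 < 1"
      unfolding t_def by (auto simp: add_pos_nonneg add_nonneg_pos divide_simps power2_eq_square)
    define c where "c = of_real t * p"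
    have "(norm (x - m))\<^sup>2 \<le> (norm ((x - m) - c *\<^sub>C v))\<^sup>2"
      using m(2)[of "m + c *\<^sub>C v"] v m(1) M by (simp add: csubspaceD power_mono diff_diff_eq)
    also have "\<dots> = (norm (x - m))\<^sup>2 - 2 * Re (c * cinner (x - m) v) + (cmod c)\<^sup>2 * (norm v)\<^sup>2"
      by (simp add: norm_diff_sq norm_scaleC power_mult_distrib)
    also have "cinner (x - m) v = cnj p" unfolding p_def by (rule cinner_commute)
    also have "c * cnj p = of_real (t * (cmod p)\<^sup>2)"
      unfolding c_def by (simp only: of_real_mult complex_norm_square mult.assoc)
    also have "(cmod c)\<^sup>2 = t\<^sup>2 * (cmod p)\<^sup>2"
      using t by (simp add: c_def norm_mult power_mult_distrib)
    finally have "t * (cmod p)\<^sup>2 * 2 \<le> t * (cmod p)\<^sup>2 * (t * (norm v)\<^sup>2)"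
      by (simp add: power2_eq_square algebra_simps)
    moreover have "t * (cmod p)\<^sup>2 * (t * (norm v)\<^sup>2) \<le> t * (cmod p)\<^sup>2 * 1"
      using t by (intro mult_left_mono) auto
    ultimately have "t * (cmod p)\<^sup>2 \<le> 0" by linarith
    then have "p = 0" using t by (simp add: mult_le_0_iff)
    then show ?thesis by (simp add: p_def)
  qed
  with m(1) show ?thesis by (rule that)
qed

lemma csubspace_closure:
  fixes M :: "'a::complex_hilbert set"
  assumes "csubspace M" shows "csubspace (closure M)"
proof (rule csubspaceI)
  show "0 \<in> closure M" using csubspaceD(1)[OF assms] closure_subset by blast
next
  fix x y assume "x \<in> closure M" "y \<in> closure M"
  then obtain f g where fg: "\<And>n. f n \<in> M" "f \<longlonglongrightarrow> x" "\<And>n. g n \<in> M" "g \<longlonglongrightarrow> y"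
    unfolding closure_sequential by blast
  have "f n + g n \<in> M" for n using csubspaceD(2)[OF assms] fg by simp
  then show "x + y \<in> closure M"
    unfolding closure_sequential using tendsto_add[OF fg(2,4)] by (intro exI[of _ "\<lambda>n. f n + g n"]) simp
next
  fix c x assume "x \<in> closure M"
  then obtain f where f: "\<And>n. f n \<in> M" "f \<longlonglongrightarrow> x"
    unfolding closure_sequential by blast
  have "c *\<^sub>C f n \<in> M" for n using csubspaceD(4)[OF assms] f by simp
  then show "c *\<^sub>C x \<in> closure M"
    unfolding closure_sequential
    using bounded_linear.tendsto[OF bounded_linear_scaleC[of c] f(2)]
    by (intro exI[of _ "\<lambda>n. c *\<^sub>C f n"]) simp
qed

lemma dense_if_orthogonal_trivial:
  fixes M :: "'a::complex_hilbert set"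
  assumes M: "csubspace M" and triv: "\<And>y. (\<And>v. v \<in> M \<Longrightarrow> cinner v y = 0) \<Longrightarrow> y = 0"
  shows "closure M = UNIV"
proof -
  have "x \<in> closure M" for x
  proof -
    obtain m where m: "m \<in> closure M" "\<And>v. v \<in> closure M \<Longrightarrow> cinner v (x - m) = 0"
      using orthogonal_projection[OF csubspace_closure[OF M] closed_closure] by blast
    have "x - m = 0" by (rule triv) (use m(2) closure_subset in blast)
    with m(1) show ?thesis by simp
  qed
  then show ?thesis by auto
qed

text \<open>Graphs of unbounded operators are subsets of a product, and the projection theorem is
  applied to such a graph when adjoints are shown to be densely defined.\<close>

instantiation prod :: (complex_hilbert, complex_hilbert) complex_hilbert
begin

definition scaleC_prod_def: "c *\<^sub>C x = (c *\<^sub>C fst x, c *\<^sub>C snd x)"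

definition cinner_prod_def: "cinner x y = cinner (fst x) (fst y) + cinner (snd x) (snd y)"

instance
proof
  fix x y :: "'a \<times> 'b"
  show "cinner x y = cnj (cinner y x)"
    unfolding cinner_prod_def by (simp add: cinner_commute[of "fst x"] cinner_commute[of "snd x"])
  show "cinner x x = complex_of_real ((norm x)\<^sup>2)"
    by (simp add: cinner_prod_def cinner_self norm_prod_def)
qed (auto simp: scaleC_prod_def cinner_prod_def cinner_add_right algebra_simps scaleC_of_real
  scaleC_add_right scaleC_add_left scaleC_scaleC prod_eq_iff)

end

section \<open>Bounded operators\<close>

named_theorems clinear_intros

lemma clinear_opD: "clinear_op T \<Longrightarrow> T (c *\<^sub>C x) = c *\<^sub>C T x"
  by (simp add: clinear_op_def)

lemma clinear_op_zero [clinear_intros]: "clinear_op 0"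
  by (simp add: clinear_op_def)

lemma clinear_op_id [clinear_intros]: "clinear_op id_blinfun"
  by (simp add: clinear_op_def)

lemma clinear_op_add [clinear_intros]: "clinear_op S \<Longrightarrow> clinear_op T \<Longrightarrow> clinear_op (S + T)"
  by (simp add: clinear_op_def blinfun.add_left scaleC_add_right)

lemma clinear_op_diff [clinear_intros]: "clinear_op S \<Longrightarrow> clinear_op T \<Longrightarrow> clinear_op (S - T)"
  by (simp add: clinear_op_def blinfun.diff_left cvec.scale_right_diff_distrib)

lemma clinear_op_scaleR [clinear_intros]: "clinear_op T \<Longrightarrow> clinear_op (a *\<^sub>R T)"
  by (simp add: clinear_op_def blinfun.scaleR_left scaleC_scaleR)

lemma clinear_op_scale_op [clinear_intros]: "clinear_op T \<Longrightarrow> clinear_op (scale_op c T)"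
  by (simp add: clinear_op_def scale_op_apply scaleC_scaleC mult.commute)

lemma clinear_op_comp [clinear_intros]: "clinear_op S \<Longrightarrow> clinear_op T \<Longrightarrow> clinear_op (S o\<^sub>L T)"
  by (simp add: clinear_op_def)

lemma clinear_op_limit:
  assumes lim: "(f \<longlongrightarrow> L) F" and F: "F \<noteq> bot" and ev: "\<forall>\<^sub>F y in F. clinear_op (f y)"
  shows "clinear_op L"
  unfolding clinear_op_def
proof (intro allI)
  fix c x
  have "((\<lambda>y. f y (c *\<^sub>C x)) \<longlongrightarrow> L (c *\<^sub>C x)) F" by (intro blinfun.tendsto lim tendsto_const)
  moreover have "((\<lambda>y. c *\<^sub>C f y x) \<longlongrightarrow> c *\<^sub>C L x) F"
    by (intro bounded_linear.tendsto[OF bounded_linear_scaleC] blinfun.tendsto lim tendsto_const)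
  then have "((\<lambda>y. f y (c *\<^sub>C x)) \<longlongrightarrow> c *\<^sub>C L x) F"
    by (rule Lim_transform_eventually) (use ev in eventually_elim, simp add: clinear_opD)
  ultimately show "L (c *\<^sub>C x) = c *\<^sub>C L x" using tendsto_unique F by blast
qed

lemma funpow_additive:
  fixes f :: "'a::complex_hilbert \<Rightarrow> 'a"
  assumes "\<And>x y. f (x + y) = f x + f y" "\<And>c x. f (c *\<^sub>C x) = c *\<^sub>C f x"
  shows "(f ^^ n) (x + y) = (f ^^ n) x + (f ^^ n) y" "(f ^^ n) (c *\<^sub>C x) = c *\<^sub>C (f ^^ n) x"
    "(f ^^ n) 0 = 0" "(f ^^ n) (x - y) = (f ^^ n) x - (f ^^ n) y"
proof -
  show 1: "(f ^^ n) (x + y) = (f ^^ n) x + (f ^^ n) y" for x y by (induction n) (simp_all add: assms)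
  show "(f ^^ n) (c *\<^sub>C x) = c *\<^sub>C (f ^^ n) x" by (induction n) (simp_all add: assms)
  show "(f ^^ n) 0 = 0" using 1[of 0 0] by simp
  show "(f ^^ n) (x - y) = (f ^^ n) x - (f ^^ n) y" using 1[of "x - y" y] by simp
qed

subsection \<open>Adjoints and positive operators\<close>

lemma adjoint_op_eqI:
  fixes T :: "'a::complex_hilbert \<Rightarrow>\<^sub>L 'b::complex_hilbert" and S :: "'b \<Rightarrow>\<^sub>L 'a"
  assumes "\<And>x y. cinner (S y) x = cinner y (T x)"
  shows "adjoint_op T = S"
  unfolding adjoint_op_def
proof (rule the_equality)
  fix S' :: "'b \<Rightarrow>\<^sub>L 'a" assume S': "\<forall>x y. cinner (S' y) x = cinner y (T x)"
  show "S' = S"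
  proof (rule blinfun_eqI, rule cinner_ext)
    fix y z show "cinner z (S' y) = cinner z (S y)"
      using S' assms cinner_commute[of z "S' y"] cinner_commute[of z "S y"] by simp
  qed
qed (use assms in blast)

text \<open>Polarisation over the complex numbers: reality of the form at \<open>x + y\<close>
  relates the imaginary parts of the mixed terms, and at \<open>x + \<i> *\<^sub>C y\<close> the
  real parts.\<close>

lemma positive_op_symmetric:
  assumes "positive_op T"
  shows "cinner (T x) y = cinner x (T y)"
proof -
  have T: "clinear_op T" and im: "Im (cinner u (T u)) = 0" for u
    using assms by (auto simp: positive_op_def complex_is_Real_iff)
  have "Im (cinner x (T y)) = - Im (cinner y (T x))"
    using im[of "x + y"] im[of x] im[of y] by (simp add: cinner_linear_simps blinfun.add_right)
  moreover have "Re (cinner x (T y)) = Re (cinner y (T x))"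
    using im[of "x + \<i> *\<^sub>C y"] im[of x] im[of y]
    by (simp add: cinner_linear_simps blinfun.add_right clinear_opD[OF T])
  ultimately have "cinner x (T y) = cnj (cinner y (T x))" by (simp add: complex_eq_iff)
  then show ?thesis using cinner_commute[of "T x" y] by simp
qed

text \<open>Positivity is tested at \<open>x - t *\<^sub>R T x\<close>; with \<open>t\<close> the
  reciprocal of \<open>norm T\<close> the quadratic term cancels at most half of the linear
  one.\<close>

lemma positive_op_norm_sq_le:
  assumes "positive_op T"
  shows "(norm (T x))\<^sup>2 \<le> norm T * Re (cinner x (T x))"
proof (cases "norm T = 0")
  case False
  define t where "t = 1 / norm T"
  have t: "t > 0" "t * norm T = 1" using False by (simp_all add: t_def)
  have "0 \<le> Re (cinner (x - t *\<^sub>R T x) (T (x - t *\<^sub>R T x)))"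
    using assms by (simp add: positive_op_def)
  also have "\<dots> = Re (cinner x (T x)) - 2 * t * (norm (T x))\<^sup>2 + t\<^sup>2 * Re (cinner (T x) (T (T x)))"
  proof -
    have "Re (cinner x (T (T x))) = (norm (T x))\<^sup>2"
      using positive_op_symmetric[OF assms, of x "T x"] Re_cinner_self[of "T x"] by simp
    then show ?thesis
      by (simp add: cinner_linear_simps blinfun.diff_right blinfun.scaleR_right Re_cinner_self
          power2_eq_square algebra_simps)
  qed
  also have "Re (cinner (T x) (T (T x))) \<le> norm (T x) * (norm T * norm (T x))"
    using norm_cinner_le[of "T x" "T (T x)"] norm_blinfun[of T "T x"] complex_Re_le_cmod[of "cinner (T x) (T (T x))"]
    by (meson mult_left_mono norm_ge_zero order_trans)
  finally have "0 \<le> Re (cinner x (T x)) - 2 * t * (norm (T x))\<^sup>2 + t\<^sup>2 * (norm (T x) * (norm T * norm (T x)))"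
    by (simp add: mult_left_mono)
  also have "t\<^sup>2 * (norm (T x) * (norm T * norm (T x))) = t * (t * norm T) * (norm (T x))\<^sup>2"
    by (simp add: power2_eq_square)
  finally have "t * (norm (T x))\<^sup>2 \<le> Re (cinner x (T x))" using t by simp
  then have "norm T * (t * (norm (T x))\<^sup>2) \<le> norm T * Re (cinner x (T x))"
    by (rule mult_left_mono) simp
  then show ?thesis using t by (simp add: mult.assoc[symmetric] mult.commute)
qed (simp add: positive_op_def)

lemma positive_op_eq_zero:
  assumes "positive_op T" "Re (cinner x (T x)) = 0" shows "T x = 0"
  using positive_op_norm_sq_le[OF assms(1), of x] assms(2) by simp

text \<open>
  For \<open>\<parallel>A\<parallel> \<le> 1\<close> the iteration \<open>B \<mapsto> (A + B\<^sup>2) / 2\<close> is dominated by the scalar iteration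
  \<open>b \<mapsto> (1 + b\<^sup>2) / 2\<close>, which increases to a limit below \<open>1\<close>; its limit satisfies \<open>(1 - B)\<^sup>2 = 1 - A\<close>.
\<close>

primrec root_iter :: "('a::complex_hilbert \<Rightarrow>\<^sub>L 'a) \<Rightarrow> nat \<Rightarrow> 'a \<Rightarrow>\<^sub>L 'a" where
  "root_iter A 0 = 0"
| "root_iter A (Suc n) = (1/2) *\<^sub>R (A + (root_iter A n o\<^sub>L root_iter A n))"

primrec root_iter_bound :: "nat \<Rightarrow> real" where
  "root_iter_bound 0 = 0"
| "root_iter_bound (Suc n) = (1 + (root_iter_bound n)\<^sup>2) / 2"

lemma root_iter_bound_range: "0 \<le> root_iter_bound n" "root_iter_bound n \<le> 1"
  by (induction n) (auto simp: power_le_one)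

lemma root_iter_bound_mono: "incseq root_iter_bound"
proof (rule incseq_SucI)
  fix n
  have "0 \<le> (1 - root_iter_bound n)\<^sup>2" by simp
  then show "root_iter_bound n \<le> root_iter_bound (Suc n)" by (simp add: power2_diff)
qed

lemma norm_root_iter: "norm A \<le> 1 \<Longrightarrow> norm (root_iter A n) \<le> root_iter_bound n"
proof (induction n)
  case (Suc n)
  have "norm (A + (root_iter A n o\<^sub>L root_iter A n)) \<le> norm A + norm (root_iter A n) * norm (root_iter A n)"
    by (intro norm_triangle_le add_left_mono norm_blinfun_compose)
  also have "\<dots> \<le> 1 + root_iter_bound n * root_iter_bound n"
    using Suc root_iter_bound_range by (intro add_mono mult_mono) auto
  finally show ?case by (simp add: power2_eq_square)
qed simp

text \<open>The difference of the squares of \<open>B\<close> and \<open>C\<close> splits as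
  \<open>B (B - C) + (B - C) C\<close>, also without commutation. The scalar iteration satisfies the
  same recursion with equality, so its increments dominate at every stage.\<close>

lemma norm_root_iter_step:
  assumes "norm A \<le> 1"
  shows "norm (root_iter A (Suc n) - root_iter A n) \<le> root_iter_bound (Suc n) - root_iter_bound n"
proof (induction n)
  case (Suc n)
  define B C b c where "B = root_iter A (Suc n)" and "C = root_iter A n"
    and "b = root_iter_bound (Suc n)" and "c = root_iter_bound n"
  note defs = B_def[symmetric] C_def[symmetric] b_def[symmetric] c_def[symmetric]
  have bounds: "norm B \<le> b" "norm C \<le> c" "norm (B - C) \<le> b - c"
    unfolding B_def C_def b_def c_def using norm_root_iter[OF assms] Suc by blast+
  have "root_iter A (Suc (Suc n)) = (1/2) *\<^sub>R (A + (B o\<^sub>L B))" "B = (1/2) *\<^sub>R (A + (C o\<^sub>L C))"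
    by (simp_all add: B_def C_def)
  then have "root_iter A (Suc (Suc n)) - B = (1/2) *\<^sub>R ((B o\<^sub>L B) - (C o\<^sub>L C))"
    by (metis add_diff_cancel_left scaleR_diff_right)
  also have "(B o\<^sub>L B) - (C o\<^sub>L C) = (B o\<^sub>L (B - C)) + ((B - C) o\<^sub>L C)"
    by (rule blinfun_eqI) (simp add: blinfun.bilinear_simps)
  finally have "root_iter A (Suc (Suc n)) - B = (1/2) *\<^sub>R ((B o\<^sub>L (B - C)) + ((B - C) o\<^sub>L C))" .
  then have "norm (root_iter A (Suc (Suc n)) - B) = (1/2) * norm ((B o\<^sub>L (B - C)) + ((B - C) o\<^sub>L C))"
    by simp
  also have "norm ((B o\<^sub>L (B - C)) + ((B - C) o\<^sub>L C)) \<le> norm B * norm (B - C) + norm (B - C) * norm C"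
    by (intro norm_triangle_le add_mono norm_blinfun_compose)
  also have "\<dots> \<le> b * (b - c) + (b - c) * c"
    using bounds norm_ge_zero[of B] norm_ge_zero[of C] norm_ge_zero[of "B - C"]
    by (intro add_mono mult_mono) linarith+
  also have "(1/2) * (b * (b - c) + (b - c) * c) = root_iter_bound (Suc (Suc n)) - b"
    unfolding b_def c_def by (simp add: power2_eq_square algebra_simps)
  finally show ?case unfolding defs by simp
qed (use assms in simp)

lemma Cauchy_root_iter:
  assumes "norm A \<le> 1" shows "Cauchy (root_iter A)"
proof -
  have le: "norm (root_iter A (m + k) - root_iter A m) \<le> root_iter_bound (m + k) - root_iter_bound m" for m k
  proof (induction k)
    case (Suc k)
    have "norm (root_iter A (m + Suc k) - root_iter A m)
      \<le> norm (root_iter A (Suc (m + k)) - root_iter A (m + k)) + norm (root_iter A (m + k) - root_iter A m)"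
      using norm_triangle_ineq[of "root_iter A (Suc (m + k)) - root_iter A (m + k)" "root_iter A (m + k) - root_iter A m"]
      by simp
    then show ?case using Suc norm_root_iter_step[OF assms, of "m + k"] by simp
  qed simp
  have "Cauchy root_iter_bound"
    using incseq_convergent[OF root_iter_bound_mono] root_iter_bound_range(2)
    by (meson LIMSEQ_imp_Cauchy)
  show ?thesis
  proof (rule CauchyI')
    fix e :: real assume "e > 0"
    then obtain M where M: "\<forall>m\<ge>M. \<forall>n\<ge>M. dist (root_iter_bound m) (root_iter_bound n) < e"
      using metric_CauchyD[OF \<open>Cauchy root_iter_bound\<close>] by blast
    have "norm (root_iter A m - root_iter A n) < e" if "m \<ge> M" "n > m" for m n
    proof -
      have "norm (root_iter A n - root_iter A m) \<le> root_iter_bound n - root_iter_bound m"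
        using le[of m "n - m"] that by simp
      moreover have "dist (root_iter_bound m) (root_iter_bound n) < e" using M that by simp
      ultimately show ?thesis by (simp add: dist_real_def norm_minus_commute)
    qed
    then show "\<exists>M. \<forall>m\<ge>M. \<forall>n>m. dist (root_iter A m) (root_iter A n) < e"
      unfolding dist_norm by blast
  qed
qed

lemma root_iter_clinear: "clinear_op A \<Longrightarrow> clinear_op (root_iter A n)"
  by (induction n) (simp_all add: clinear_intros)

lemma root_iter_symmetric:
  fixes A :: "'a::complex_hilbert \<Rightarrow>\<^sub>L 'a"
  assumes "\<And>x y. cinner (A x) y = cinner x (A y)"
  shows "cinner (root_iter A n x) y = cinner x (root_iter A n y)"
  by (induction n arbitrary: x y) (simp_all add: assms blinfun.bilinear_simps cinner_linear_simps)

text \<open>Up to scaling, \<open>T\<close> is 1 - A with \<open>norm A \<le> 1\<close>. The limit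
  \<open>B\<close> of the iteration satisfies (1 - B)^2 = 1 - A; its symmetry and the bound
  \<open>norm B \<le> 1\<close> make 1 - B positive.\<close>

lemma positive_sqrt_exists:
  assumes T: "positive_op T"
  shows "\<exists>S. positive_op S \<and> S o\<^sub>L S = T"
proof -
  define t where "t = 1 / (norm T + 1)"
  have t: "t > 0" "t * norm T \<le> 1"
    by (simp_all add: t_def add_nonneg_pos divide_simps)
  define A where "A = id_blinfun - t *\<^sub>R T"
  have A: "clinear_op A" using T by (auto simp: A_def positive_op_def intro: clinear_intros)
  have Asym: "cinner (A x) y = cinner x (A y)" for x y
    using positive_op_symmetric[OF T] by (simp add: A_def blinfun.bilinear_simps cinner_linear_simps)
  have "norm A \<le> 1"
  proof (rule norm_blinfun_bound)
    fix x
    define p where "p = Re (cinner x (T x))"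
    have "p \<ge> 0" using T by (simp add: p_def positive_op_def)
    have "(norm (A x))\<^sup>2 = (norm x)\<^sup>2 - 2 * t * p + t\<^sup>2 * (norm (T x))\<^sup>2"
      by (simp add: A_def p_def blinfun.bilinear_simps norm_diff_sq power_mult_distrib)
    moreover have "t\<^sup>2 * (norm (T x))\<^sup>2 \<le> t\<^sup>2 * (norm T * p)"
      using positive_op_norm_sq_le[OF T] by (intro mult_left_mono) (auto simp: p_def)
    moreover have "t\<^sup>2 * (norm T * p) = (t * norm T) * (t * p)" by (simp add: power2_eq_square)
    moreover have "(t * norm T) * (t * p) \<le> 1 * (t * p)" using t \<open>p \<ge> 0\<close> by (intro mult_right_mono) auto
    ultimately have "(norm (A x))\<^sup>2 \<le> (norm x)\<^sup>2" using t \<open>p \<ge> 0\<close> mult_nonneg_nonneg[of t p] by linarith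
    then show "norm (A x) \<le> 1 * norm x" using power2_le_imp_le[of "norm (A x)" "norm x"] by simp
  qed simp
  then obtain B where B: "root_iter A \<longlonglongrightarrow> B"
    using Cauchy_root_iter Cauchy_convergent unfolding convergent_def by blast
  have "norm B \<le> 1"
    using norm_root_iter[OF \<open>norm A \<le> 1\<close>] root_iter_bound_range(2)
    by (intro LIMSEQ_le_const2[OF tendsto_norm[OF B]]) (auto intro: order_trans)
  have Bcl: "clinear_op B"
    by (rule clinear_op_limit[OF B]) (simp_all add: root_iter_clinear A)
  have "(\<lambda>n. cinner (root_iter A n x) y) \<longlonglongrightarrow> cinner (B x) y" for x y
    by (intro tendsto_cinner blinfun.tendsto B tendsto_const)
  moreover have "(\<lambda>n. cinner x (root_iter A n y)) \<longlonglongrightarrow> cinner x (B y)" for x y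
    by (intro tendsto_cinner blinfun.tendsto B tendsto_const)
  ultimately have Bsym: "cinner (B x) y = cinner x (B y)" for x y
    unfolding root_iter_symmetric[OF Asym] by (rule LIMSEQ_unique)
  have fix_eq: "B = (1/2) *\<^sub>R (A + (B o\<^sub>L B))"
  proof (rule LIMSEQ_unique)
    show "(\<lambda>n. root_iter A (Suc n)) \<longlonglongrightarrow> B" by (rule LIMSEQ_Suc[OF B])
    show "(\<lambda>n. root_iter A (Suc n)) \<longlonglongrightarrow> (1/2) *\<^sub>R (A + (B o\<^sub>L B))"
      by (simp, intro tendsto_intros bounded_bilinear.tendsto[OF bounded_bilinear_blinfun_compose] B)
  qed
  have B2: "B (B x) = 2 *\<^sub>R B x - A x" for x
  proof -
    have "2 *\<^sub>R B x = A x + B (B x)"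
      by (subst fix_eq) (simp add: blinfun.bilinear_simps)
    then show ?thesis by (simp add: algebra_simps)
  qed
  define a where "a = 1 / sqrt t"
  have a: "a > 0" "a * a * t = 1" using t by (simp_all add: a_def)
  define S where "S = a *\<^sub>R (id_blinfun - B)"
  have "S o\<^sub>L S = T"
  proof (rule blinfun_eqI)
    fix x
    have "(S o\<^sub>L S) x = (a * a) *\<^sub>R (x - 2 *\<^sub>R B x + B (B x))"
      by (simp add: S_def blinfun.bilinear_simps algebra_simps scaleR_2)
    also have "\<dots> = (a * a * t) *\<^sub>R T x" by (simp add: B2 A_def blinfun.bilinear_simps)
    finally show "(S o\<^sub>L S) x = T x" by (simp add: a)
  qed
  moreover have "positive_op S"
    unfolding positive_op_def
  proof (intro conjI allI)
    show "clinear_op S" by (auto simp: S_def intro: clinear_intros Bcl)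
    fix x
    have "cnj (cinner x (B x)) = cinner x (B x)" using Bsym[of x x] cinner_commute[of "B x" x] by simp
    then have real: "cinner x (B x) \<in> \<real>" by (simp add: Reals_cnj_iff)
    then show "cinner x (S x) \<in> \<real>"
      by (simp add: S_def blinfun.bilinear_simps cinner_linear_simps cinner_self)
    have "cmod (cinner x (B x)) \<le> norm x * (norm B * norm x)"
      using norm_cinner_le[of x "B x"] norm_blinfun[of B x] by (meson mult_left_mono norm_ge_zero order_trans)
    also have "\<dots> \<le> norm x * (1 * norm x)"
      using \<open>norm B \<le> 1\<close> by (intro mult_left_mono mult_right_mono) auto
    finally have "Re (cinner x (B x)) \<le> (norm x)\<^sup>2"
      using complex_Re_le_cmod[of "cinner x (B x)"] by (simp add: power2_eq_square)
    then show "0 \<le> Re (cinner x (S x))"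
      using a by (simp add: S_def blinfun.bilinear_simps cinner_linear_simps Re_cinner_self)
  qed
  ultimately show ?thesis by blast
qed

text \<open>Every positive root \<open>S\<close> satisfies
  \<open>cinner (S x) (S x) = cinner x (T x)\<close>, so the equivalence holds for whichever root
  the choice operator returns.\<close>

lemma sqrt_op_apply_eq_zero_iff:
  assumes "positive_op T"
  shows "sqrt_op T x = 0 \<longleftrightarrow> T x = 0"
proof -
  have S: "positive_op (sqrt_op T)" "sqrt_op T o\<^sub>L sqrt_op T = T"
    unfolding sqrt_op_def using someI_ex[OF positive_sqrt_exists[OF assms]] by auto
  then have TS: "T x = sqrt_op T (sqrt_op T x)" using blinfun_apply_blinfun_compose[of "sqrt_op T" "sqrt_op T" x] by simp
  show ?thesis
  proof
    assume "T x = 0"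
    then have "cinner (sqrt_op T x) (sqrt_op T x) = 0"
      using positive_op_symmetric[OF S(1), of x "sqrt_op T x"] TS by simp
    then show "sqrt_op T x = 0" by (simp add: cinner_eq_zero_iff)
  qed (simp add: TS)
qed

section \<open>Riesz theory of compact operators\<close>

lemma compact_op_clinear: "compact_op T \<Longrightarrow> clinear_op T"
  by (simp add: compact_op_def)

lemma compact_closure_subset:
  fixes A C :: "'a::metric_space set"
  assumes "compact C" "A \<subseteq> C" shows "compact (closure A)"
proof -
  have "closure A \<subseteq> C" using assms by (simp add: closure_minimal compact_imp_closed)
  then have "closure A = C \<inter> closure A" by blast
  then show ?thesis using compact_Int_closed[OF assms(1) closed_closure[of A]] by simp
qed

lemma compact_op_comp_right:
  assumes T: "compact_op T" and J: "clinear_op J"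
  shows "compact_op (T o\<^sub>L J)"
  unfolding compact_op_def
proof
  show "clinear_op (T o\<^sub>L J)" by (intro clinear_op_comp compact_op_clinear T J)
  define b where "b = norm J + 1"
  have b: "b > 0" by (simp add: b_def add_nonneg_pos)
  have "compact ((\<lambda>v. b *\<^sub>R v) ` closure (T ` cball 0 1))"
    using T by (intro compact_scaling) (simp add: compact_op_def)
  moreover have "(T o\<^sub>L J) ` cball 0 1 \<subseteq> (\<lambda>v. b *\<^sub>R v) ` closure (T ` cball 0 1)"
  proof
    fix w assume "w \<in> (T o\<^sub>L J) ` cball 0 1"
    then obtain x where x: "norm x \<le> 1" "w = T (J x)" by auto
    define y where "y = (1 / b) *\<^sub>R J x"
    have "norm (J x) \<le> norm J * 1"
      using x norm_blinfun[of J x] mult_left_mono[of "norm x" 1 "norm J"] by simp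
    then have "norm y \<le> 1" using b by (simp add: y_def b_def divide_simps)
    then have "T y \<in> closure (T ` cball 0 1)" using closure_subset by fastforce
    moreover have "w = b *\<^sub>R T y" using b by (simp add: x y_def blinfun.scaleR_right)
    ultimately show "w \<in> (\<lambda>v. b *\<^sub>R v) ` closure (T ` cball 0 1)" by blast
  qed
  ultimately show "compact (closure ((T o\<^sub>L J) ` cball 0 1))" by (rule compact_closure_subset)
qed

lemma compact_op_limit:
  fixes f :: "'i \<Rightarrow> 'a::complex_hilbert \<Rightarrow>\<^sub>L 'b::complex_hilbert"
  assumes lim: "(f \<longlongrightarrow> L) F" and F: "F \<noteq> bot" and ev: "\<forall>\<^sub>F y in F. compact_op (f y)"
  shows "compact_op L"
  unfolding compact_op_def
proof
  show "clinear_op L"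
    by (rule clinear_op_limit[OF lim F]) (use ev in eventually_elim, simp add: compact_op_clinear)
  have "\<exists>k. finite k \<and> closure (L ` cball 0 1) \<subseteq> (\<Union>x\<in>k. ball x e)" if e: "e > 0" for e
  proof -
    have "\<forall>\<^sub>F y in F. compact_op (f y) \<and> dist (f y) L < e / 4"
      using ev tendstoD[OF lim, of "e / 4"] e by (simp add: eventually_conj)
    then obtain T where T: "compact_op T" "dist T L < e / 4"
      using F eventually_happens'[OF F] by blast
    then obtain k where k: "finite k" "closure (T ` cball 0 1) \<subseteq> (\<Union>x\<in>k. ball x (e / 4))"
      using e unfolding compact_op_def compact_eq_totally_bounded by (meson divide_pos_pos zero_less_numeral)
    have "L ` cball 0 1 \<subseteq> (\<Union>x\<in>k. cball x (e / 2))"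
    proof
      fix w assume "w \<in> L ` cball 0 1"
      then obtain v where v: "norm v \<le> 1" "w = L v" by auto
      then have "T v \<in> closure (T ` cball 0 1)" using closure_subset by fastforce
      then obtain x where x: "x \<in> k" "dist x (T v) < e / 4" using k by auto
      have "dist (T v) w \<le> norm (T - L) * norm v"
        using norm_blinfun[of "T - L" v] by (simp add: dist_norm v blinfun.diff_left)
      also have "\<dots> \<le> e / 4 * 1" using T v e by (intro mult_mono) (auto simp: dist_norm)
      finally have "dist x w \<le> e / 2" using x dist_triangle[of x w "T v"] by linarith
      then show "w \<in> (\<Union>x\<in>k. cball x (e / 2))" using x by auto
    qed
    then have "closure (L ` cball 0 1) \<subseteq> (\<Union>x\<in>k. cball x (e / 2))"
      using k(1) by (intro closure_minimal closed_UN) auto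
    also have "\<dots> \<subseteq> (\<Union>x\<in>k. ball x e)" using e by (intro UN_mono) auto
    finally show ?thesis using k(1) by blast
  qed
  then show "compact (closure (L ` cball 0 1))"
    unfolding compact_eq_totally_bounded complete_eq_closed by simp
qed

lemma compact_op_subseq:
  assumes T: "compact_op T" and x: "\<And>n::nat. norm (x n) \<le> 1"
  obtains l r where "strict_mono r" "(\<lambda>n. T (x (r n))) \<longlonglongrightarrow> l"
proof -
  have "seq_compact (closure (T ` cball 0 1))"
    using T by (simp add: compact_op_def compact_imp_seq_compact)
  moreover have "T (x n) \<in> closure (T ` cball 0 1)" for n
    using x[of n] closure_subset by fastforce
  ultimately obtain l r where "strict_mono r" "((\<lambda>n. T (x n)) \<circ> r) \<longlonglongrightarrow> l"
    unfolding seq_compact_def by metis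
  then show ?thesis using that by (simp add: o_def)
qed

lemma compact_op_not_separated:
  assumes T: "compact_op T" and x: "\<And>n::nat. norm (x n) \<le> 1" and e: "e > 0"
  obtains m n where "m < n" "norm (T (x m) - T (x n)) < e"
proof -
  obtain l r where r: "strict_mono r" "(\<lambda>n. T (x (r n))) \<longlonglongrightarrow> l"
    by (rule compact_op_subseq[OF T x])
  have "Cauchy (\<lambda>n. T (x (r n)))" by (rule LIMSEQ_imp_Cauchy[OF r(2)])
  then obtain M where M: "\<forall>m\<ge>M. \<forall>n\<ge>M. dist (T (x (r m))) (T (x (r n))) < e"
    using metric_CauchyD[OF _ e] by blast
  have "r M < r (Suc M)" using r(1) by (simp add: strict_mono_def)
  with M show ?thesis using that[of "r M" "r (Suc M)"] by (simp add: dist_norm)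
qed

text \<open>In a Hilbert space the nearly orthogonal vector of Riesz's lemma can be taken exactly
  orthogonal, hence the constant 1 in the distance.\<close>

lemma unit_orthogonal_vector:
  fixes M M' :: "'a::complex_hilbert set"
  assumes "csubspace M" "closed M" "csubspace M'" "M \<subset> M'"
  obtains x where "x \<in> M'" "norm x = 1" "\<And>w. w \<in> M \<Longrightarrow> norm (w - x) \<ge> 1"
proof -
  obtain z where z: "z \<in> M'" "z \<notin> M" using assms(4) by blast
  obtain m where m: "m \<in> M" "\<And>v. v \<in> M \<Longrightarrow> cinner v (z - m) = 0"
    using orthogonal_projection[OF assms(1,2)] by blast
  have "z - m \<noteq> 0" using z m by auto
  define x where "x = (1 / norm (z - m)) *\<^sub>R (z - m)"
  have "x \<in> M'" unfolding x_def using z m assms by (intro csubspaceD[OF assms(3)]) auto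
  moreover have nx: "norm x = 1" using \<open>z - m \<noteq> 0\<close> by (simp add: x_def)
  moreover have "norm (w - x) \<ge> 1" if "w \<in> M" for w
  proof -
    have "(norm (w - x))\<^sup>2 = (norm w)\<^sup>2 + 1"
      using m(2)[OF that] nx by (simp add: norm_diff_sq x_def)
    then have "1\<^sup>2 \<le> (norm (w - x))\<^sup>2" by simp
    then show ?thesis using power2_le_imp_le[of 1 "norm (w - x)"] by simp
  qed
  ultimately show ?thesis by (rule that)
qed

section \<open>Riesz-Schauder theory of the operator 1 + c K\<close>

locale compact_perturbation =
  fixes K T :: "'a::complex_hilbert \<Rightarrow>\<^sub>L 'a" and c :: complex
  assumes compact: "compact_op K" and T_apply: "\<And>x. T x = x + c *\<^sub>C K x"
begin

lemma T_clinear: "clinear_op T"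
  using compact_op_clinear[OF compact]
  by (simp add: clinear_op_def T_apply scaleC_add_right scaleC_scaleC mult.commute)

lemma not_separated:
  assumes x: "\<And>n::nat. norm (x n) = 1"
  shows "\<exists>m n. m < n \<and> norm ((T (x m) - x m) - (T (x n) - x n)) < 1"
proof -
  obtain m n where mn: "m < n" "norm (K (x m) - K (x n)) < 1 / (cmod c + 1)"
    using compact_op_not_separated[OF compact, of x "1 / (cmod c + 1)"] x by (auto simp: add_nonneg_pos)
  have "(T (x m) - x m) - (T (x n) - x n) = c *\<^sub>C (K (x m) - K (x n))"
    by (simp add: T_apply cvec.scale_right_diff_distrib)
  then have "norm ((T (x m) - x m) - (T (x n) - x n)) = cmod c * norm (K (x m) - K (x n))"
    by (simp add: norm_scaleC)
  also have "\<dots> \<le> cmod c * (1 / (cmod c + 1))" using mn by (intro mult_left_mono) auto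
  also have "\<dots> < 1" by (simp add: divide_simps add_nonneg_pos)
  finally show ?thesis using mn by blast
qed

text \<open>A strict chain yields unit vectors \<open>x k\<close> at distance at least 1 from
  \<open>M k\<close>. For \<open>m < n\<close>, everything in the difference of the values of T - 1
  at \<open>x n\<close> and \<open>x m\<close> except \<open>- x n\<close> lies in
  \<open>M n\<close>. So these values stay at distance 1 or more, although T - 1 is compact.\<close>

lemma ascending_chain_stabilizes:
  assumes M: "\<And>k. csubspace (M k)" "\<And>k. closed (M k)" "\<And>k. M k \<subseteq> M (Suc k)"
    and TM: "\<And>k x. x \<in> M (Suc k) \<Longrightarrow> T x \<in> M k"
  shows "\<exists>n. M (Suc n) = M n"
proof (rule ccontr)
  assume "\<nexists>n. M (Suc n) = M n"
  then have "M k \<subset> M (Suc k)" for k using M(3) by blast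
  then have "\<exists>x. x \<in> M (Suc k) \<and> norm x = 1 \<and> (\<forall>w\<in>M k. norm (w - x) \<ge> 1)" for k
    using unit_orthogonal_vector[OF M(1,2) M(1)] by metis
  then obtain x where x: "\<And>k. x k \<in> M (Suc k)" "\<And>k. norm (x k) = 1"
    "\<And>k w. w \<in> M k \<Longrightarrow> norm (w - x k) \<ge> 1" by metis
  obtain m n where mn: "m < n" "norm ((T (x m) - x m) - (T (x n) - x n)) < 1"
    using not_separated[of x, OF x(2)] by blast
  have mono: "M i \<subseteq> M j" if "i \<le> j" for i j using lift_Suc_mono_le[of M] M(3) that by blast
  have "T (x n) \<in> M n" "T (x m) \<in> M n" "x m \<in> M n"
    using TM[OF x(1)] x(1)[of m] mono[of m n] mono[of "Suc m" n] mn(1) by auto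
  then have "T (x n) - (T (x m) - x m) \<in> M n" using M(1) by (simp add: csubspaceD)
  from x(3)[OF this] have "1 \<le> norm ((T (x n) - x n) - (T (x m) - x m))"
    by (simp add: algebra_simps)
  with mn(2) show False by (simp add: norm_minus_commute)
qed

text \<open>The argument for ascending chains with the two indices exchanged: here the vector with
  the smaller index sticks out.\<close>

lemma descending_chain_stabilizes:
  assumes M: "\<And>k. csubspace (M k)" "\<And>k. closed (M k)" "\<And>k. M (Suc k) \<subseteq> M k"
    and TM: "\<And>k x. x \<in> M k \<Longrightarrow> T x \<in> M (Suc k)"
  shows "\<exists>n. M (Suc n) = M n"
proof (rule ccontr)
  assume "\<nexists>n. M (Suc n) = M n"
  then have "M (Suc k) \<subset> M k" for k using M(3) by blast
  then have "\<exists>x. x \<in> M k \<and> norm x = 1 \<and> (\<forall>w\<in>M (Suc k). norm (w - x) \<ge> 1)" for k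
    using unit_orthogonal_vector[OF M(1,2) M(1)] by metis
  then obtain x where x: "\<And>k. x k \<in> M k" "\<And>k. norm (x k) = 1"
    "\<And>k w. w \<in> M (Suc k) \<Longrightarrow> norm (w - x k) \<ge> 1" by metis
  obtain m n where mn: "m < n" "norm ((T (x m) - x m) - (T (x n) - x n)) < 1"
    using not_separated[of x, OF x(2)] by blast
  have mono: "M j \<subseteq> M i" if "i \<le> j" for i j using lift_Suc_antimono_le[of M] M(3) that by blast
  have "T (x m) \<in> M (Suc m)" "T (x n) \<in> M (Suc m)" "x n \<in> M (Suc m)"
    using TM[OF x(1)] x(1)[of n] mono[of "Suc m" n] mono[of "Suc m" "Suc n"] mn(1) by auto
  then have "T (x m) - (T (x n) - x n) \<in> M (Suc m)" using M(1) by (simp add: csubspaceD)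
  from x(3)[OF this] have "1 \<le> norm ((T (x m) - x m) - (T (x n) - x n))"
    by (simp add: algebra_simps)
  with mn(2) show False by simp
qed

text \<open>Otherwise unit vectors of \<open>M\<close> have images under \<open>T\<close> tending to
  0. Compactness of \<open>K\<close> gives a subsequence with convergent images under
  \<open>K\<close>, and x = T x - c K x makes the vectors themselves converge, to a unit vector in
  the kernel.\<close>

lemma bounded_below:
  assumes M: "csubspace M" "closed M" and inj: "\<And>x. x \<in> M \<Longrightarrow> T x = 0 \<Longrightarrow> x = 0"
  obtains \<delta> where "\<delta> > 0" "\<And>x. x \<in> M \<Longrightarrow> \<delta> * norm x \<le> norm (T x)"
proof (rule ccontr)
  assume "\<not> thesis"
  have "\<exists>x. x \<in> M \<and> norm x = 1 \<and> norm (T x) < 1 / real (Suc n)" for n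
  proof (rule ccontr)
    assume neg: "\<nexists>x. x \<in> M \<and> norm x = 1 \<and> norm (T x) < 1 / real (Suc n)"
    have "1 / real (Suc n) * norm x \<le> norm (T x)" if "x \<in> M" for x
    proof (cases "x = 0")
      case False
      have "(1 / norm x) *\<^sub>R x \<in> M" using that M by (simp add: csubspaceD)
      with neg False have "1 / real (Suc n) \<le> norm (T ((1 / norm x) *\<^sub>R x))" by force
      then show ?thesis using False by (simp add: blinfun.scaleR_right divide_simps mult.commute)
    qed simp
    then show False using that[of "1 / real (Suc n)"] \<open>\<not> thesis\<close> by simp
  qed
  then obtain x where x: "\<And>n. x n \<in> M" "\<And>n. norm (x n) = 1" "\<And>n. norm (T (x n)) < 1 / real (Suc n)"
    by metis
  obtain l r where r: "strict_mono r" "(\<lambda>n. K (x (r n))) \<longlonglongrightarrow> l"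
    by (rule compact_op_subseq[OF compact, of x]) (simp_all add: x)
  have "(\<lambda>n. T (x n)) \<longlonglongrightarrow> 0"
    using x(3) by (intro Lim_null_comparison[OF _ LIMSEQ_inverse_real_of_nat])
      (auto intro!: always_eventually less_imp_le simp: inverse_eq_divide)
  then have "(\<lambda>n. T (x (r n))) \<longlonglongrightarrow> 0"
    using LIMSEQ_subseq_LIMSEQ[OF _ r(1)] by (simp add: o_def)
  then have "(\<lambda>n. T (x (r n)) - c *\<^sub>C K (x (r n))) \<longlonglongrightarrow> 0 - c *\<^sub>C l"
    by (intro tendsto_diff bounded_linear.tendsto[OF bounded_linear_scaleC] r(2))
  then have lim: "(\<lambda>n. x (r n)) \<longlonglongrightarrow> - c *\<^sub>C l" by (simp add: T_apply)
  have "- c *\<^sub>C l \<in> M" by (rule closed_sequentially[OF M(2) _ lim]) (rule x)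
  moreover have "T (- c *\<^sub>C l) = 0"
    by (rule LIMSEQ_unique[OF blinfun.tendsto[OF tendsto_const lim]]) fact
  ultimately have "- c *\<^sub>C l = 0" by (rule inj)
  moreover have "norm (- c *\<^sub>C l) = 1"
    by (rule LIMSEQ_unique[OF tendsto_norm[OF lim]]) (simp add: x)
  ultimately show False by (metis norm_zero zero_neq_one)
qed

text \<open>\<open>T\<close> is bounded below on the part \<open>M'\<close> of \<open>M\<close>
  orthogonal to its kernel in \<open>M\<close>, and \<open>M'\<close> has the same image as
  \<open>M\<close>; completeness passes from \<open>M'\<close> to this image.\<close>

lemma closed_image:
  assumes M: "csubspace M" "closed M"
  shows "csubspace (T ` M)" "closed (T ` M)"
proof -
  show "csubspace (T ` M)"
  proof (rule csubspaceI)
    show "0 \<in> T ` M" using csubspaceD(1)[OF M(1)] by (force simp: image_iff)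
    show "x + y \<in> T ` M" if "x \<in> T ` M" "y \<in> T ` M" for x y
      using that csubspaceD(2)[OF M(1)] by (auto simp flip: blinfun.add_right)
    show "a *\<^sub>C x \<in> T ` M" if "x \<in> T ` M" for a x
      using that csubspaceD(4)[OF M(1)] by (auto simp flip: clinear_opD[OF T_clinear])
  qed
  define N where "N = M \<inter> {x. T x = 0}"
  have N: "csubspace N" "closed N"
  proof -
    show "csubspace N"
      unfolding N_def
      by (rule csubspaceI)
        (auto simp: csubspaceD[OF M(1)] blinfun.add_right clinear_opD[OF T_clinear])
    show "closed N" unfolding N_def
      by (intro closed_Int M(2) closed_Collect_eq continuous_intros)
  qed
  define M' where "M' = M \<inter> (\<Inter>v\<in>N. {x. cinner v x = 0})"
  have M': "csubspace M'" "closed M'"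
  proof -
    show "csubspace M'"
      using csubspaceD[OF M(1)] unfolding M'_def by (intro csubspaceI) (auto simp: cinner_linear_simps)
    show "closed M'" unfolding M'_def
      by (intro closed_Int M(2) closed_INT ballI closed_Collect_eq continuous_intros
          linear_continuous_on[OF bounded_linear_cinner_right])
  qed
  have "x = 0" if "x \<in> M'" "T x = 0" for x
  proof -
    have "x \<in> N" using that by (simp add: N_def M'_def)
    then have "cinner x x = 0" using that by (auto simp: M'_def)
    then show ?thesis by (simp add: cinner_eq_zero_iff)
  qed
  then obtain \<delta> where \<delta>: "\<delta> > 0" "\<And>x. x \<in> M' \<Longrightarrow> \<delta> * norm x \<le> norm (T x)"
    using bounded_below[OF M'] by blast
  have "complete (T ` M')"
  proof (rule complete_isometric_image[OF \<delta>(1)])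
    show "subspace M'" using M'(1) by (simp add: csubspace_def)
    show "complete M'" using M'(2) by (simp add: complete_eq_closed)
  qed (use \<delta> blinfun.bounded_linear_right in \<open>auto simp: mult.commute\<close>)
  moreover have "T ` M = T ` M'"
  proof
    show "T ` M \<subseteq> T ` M'"
    proof
      fix y assume "y \<in> T ` M"
      then obtain x where x: "x \<in> M" "y = T x" by blast
      obtain m where m: "m \<in> N" "\<And>v. v \<in> N \<Longrightarrow> cinner v (x - m) = 0"
        using orthogonal_projection[OF N] by blast
      have "x - m \<in> M'" using m x M(1) unfolding M'_def by (auto simp: N_def csubspaceD)
      moreover have "T (x - m) = y" using m x by (simp add: N_def blinfun.diff_right)
      ultimately show "y \<in> T ` M'" by blast
    qed
  qed (auto simp: M'_def)
  ultimately show "closed (T ` M)" by (simp add: complete_eq_closed)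
qed

lemma funpow_simps:
  "(blinfun_apply T ^^ n) (x + y) = (blinfun_apply T ^^ n) x + (blinfun_apply T ^^ n) y" "(blinfun_apply T ^^ n) (a *\<^sub>C x) = a *\<^sub>C (blinfun_apply T ^^ n) x"
  "(blinfun_apply T ^^ n) 0 = 0" "(blinfun_apply T ^^ n) (x - y) = (blinfun_apply T ^^ n) x - (blinfun_apply T ^^ n) y"
  using funpow_additive[of "blinfun_apply T"] by (simp_all add: blinfun.add_right clinear_opD[OF T_clinear])

text \<open>\<open>T\<close> maps the kernel of each power into the previous kernel and the range of
  each power onto the next range, so both chains stabilise; the ranges are closed by repeated use of
  \<open>closed_image\<close>.\<close>

lemma stable_exponent:
  obtains q where "q > 0" "\<And>x. (blinfun_apply T ^^ (q + q)) x = 0 \<Longrightarrow> (blinfun_apply T ^^ q) x = 0"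
    "range (blinfun_apply T ^^ Suc q) = range (blinfun_apply T ^^ q)" "range (blinfun_apply T ^^ (q + q)) = range (blinfun_apply T ^^ q)"
    "csubspace (range (blinfun_apply T ^^ q))" "closed (range (blinfun_apply T ^^ q))"
proof -
  have cont: "continuous_on UNIV (blinfun_apply T ^^ k)" for k
    by (induction k) (auto intro!: continuous_intros)
  have "\<exists>n. {x. (blinfun_apply T ^^ Suc n) x = 0} = {x. (blinfun_apply T ^^ n) x = 0}"
  proof (rule ascending_chain_stabilizes[of "\<lambda>n. {x. (blinfun_apply T ^^ n) x = 0}"])
    show "csubspace {x. (blinfun_apply T ^^ k) x = 0}" for k by (rule csubspaceI) (simp_all add: funpow_simps)
    show "closed {x. (blinfun_apply T ^^ k) x = 0}" for k by (intro closed_Collect_eq cont continuous_on_const)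
    show "{x. (blinfun_apply T ^^ k) x = 0} \<subseteq> {x. (blinfun_apply T ^^ Suc k) x = 0}" for k by auto
    show "T x \<in> {x. (blinfun_apply T ^^ k) x = 0}" if "x \<in> {x. (blinfun_apply T ^^ Suc k) x = 0}" for k x
      using that by (simp add: funpow_swap1)
  qed
  then obtain n where n: "{x. (blinfun_apply T ^^ Suc n) x = 0} = {x. (blinfun_apply T ^^ n) x = 0}" by blast
  have R: "csubspace (range (blinfun_apply T ^^ k)) \<and> closed (range (blinfun_apply T ^^ k))" for k
  proof (induction k)
    case 0 show ?case by (auto intro!: csubspaceI)
  next
    case (Suc k)
    then show ?case using closed_image[of "range (blinfun_apply T ^^ k)"] by (simp add: image_comp)
  qed
  have "\<exists>p. range (blinfun_apply T ^^ Suc p) = range (blinfun_apply T ^^ p)"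
  proof (rule descending_chain_stabilizes[of "\<lambda>n. range (blinfun_apply T ^^ n)"])
    show "range (blinfun_apply T ^^ Suc k) \<subseteq> range (blinfun_apply T ^^ k)" for k by (auto simp: funpow_swap1)
    show "T x \<in> range (blinfun_apply T ^^ Suc k)" if "x \<in> range (blinfun_apply T ^^ k)" for k x using that by auto
  qed (use R in auto)
  then obtain p where p: "range (blinfun_apply T ^^ Suc p) = range (blinfun_apply T ^^ p)" by blast
  have ker: "(blinfun_apply T ^^ (n + j)) x = 0 \<Longrightarrow> (blinfun_apply T ^^ n) x = 0" for j x
  proof (induction j arbitrary: x)
    case (Suc j)
    then have "(blinfun_apply T ^^ (n + j)) (T x) = 0" by (simp add: funpow_swap1)
    then have "(blinfun_apply T ^^ n) (T x) = 0" by (rule Suc.IH)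
    then have "(blinfun_apply T ^^ Suc n) x = 0" by (simp add: funpow_swap1)
    then show ?case using n by blast
  qed simp
  have ran: "range (blinfun_apply T ^^ (p + j)) = range (blinfun_apply T ^^ p)" for j
  proof (induction j)
    case (Suc j)
    have "range (blinfun_apply T ^^ (p + Suc j)) = T ` range (blinfun_apply T ^^ (p + j))" by (simp add: image_comp)
    also have "\<dots> = range (blinfun_apply T ^^ Suc p)" unfolding Suc by (simp add: image_comp)
    finally show ?case using p by simp
  qed simp
  define q where "q = Suc (n + p)"
  show ?thesis
  proof
    show "q > 0" by (simp add: q_def)
    fix x assume "(blinfun_apply T ^^ (q + q)) x = 0"
    then have "(blinfun_apply T ^^ n) x = 0" using ker[of "Suc p + q" x] by (simp add: q_def add_ac)
    moreover have "(blinfun_apply T ^^ q) x = (blinfun_apply T ^^ Suc p) ((blinfun_apply T ^^ n) x)"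
      unfolding q_def using funpow_add[of "Suc p" n "blinfun_apply T"] by (simp add: add_ac)
    ultimately show "(blinfun_apply T ^^ q) x = 0" by (simp only: funpow_simps)
  next
    have *: "range (blinfun_apply T ^^ (q + j)) = range (blinfun_apply T ^^ p)" for j
      using ran[of "Suc n + j"] by (simp add: q_def add_ac)
    show "range (blinfun_apply T ^^ Suc q) = range (blinfun_apply T ^^ q)" using *[of 1] *[of 0] by simp
    show "range (blinfun_apply T ^^ (q + q)) = range (blinfun_apply T ^^ q)" using *[of q] *[of 0] by simp
  qed (use R in auto)
qed

text \<open>
  The kernel projection \<open>P\<close> along the stable range of the powers of \<open>T\<close>, together with the
  inverse \<open>S\<close> of \<open>T\<close> on that range.
\<close>

lemma riesz_decomposition:
  obtains P S :: "'a \<Rightarrow>\<^sub>L 'a" and n where "clinear_op P" "clinear_op S"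
    "\<And>x. P (P x) = P x" "\<And>x. (blinfun_apply T ^^ n) (P x) = 0" "\<And>x. T (S x) = x - P x"
    "\<And>x. S (T x) = x - P x" "\<And>x. S (P x) = 0"
proof -
  obtain q where q: "q > 0" "\<And>x. (blinfun_apply T ^^ (q + q)) x = 0 \<Longrightarrow> (blinfun_apply T ^^ q) x = 0"
    "range (blinfun_apply T ^^ Suc q) = range (blinfun_apply T ^^ q)" "range (blinfun_apply T ^^ (q + q)) = range (blinfun_apply T ^^ q)"
    "csubspace (range (blinfun_apply T ^^ q))" "closed (range (blinfun_apply T ^^ q))"
    using stable_exponent by blast
  define R where "R = range (blinfun_apply T ^^ q)"
  have R: "csubspace R" "closed R" using q by (simp_all add: R_def)
  have inj: "x = 0" if "x \<in> R" "T x = 0" for x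
  proof -
    obtain y where y: "x = (blinfun_apply T ^^ q) y" using \<open>x \<in> R\<close> R_def by blast
    have "(blinfun_apply T ^^ q) x = (blinfun_apply T ^^ (q - 1)) (T x)"
      using q(1) by (cases q) (simp_all add: funpow_swap1)
    then have "(blinfun_apply T ^^ q) x = 0" using \<open>T x = 0\<close> by (simp add: funpow_simps)
    then show ?thesis using q(2)[of y] by (simp add: y funpow_add)
  qed
  obtain \<delta> where \<delta>: "\<delta> > 0" "\<And>x. x \<in> R \<Longrightarrow> \<delta> * norm x \<le> norm (T x)"
    using bounded_below[OF R inj] by blast
  have TR: "T ` R = R" using q(3) by (simp add: R_def image_comp)
  have "\<exists>x. x \<in> R \<and> T x = y" if "y \<in> R" for y
  proof -
    have "y \<in> T ` R" using that TR by simp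
    then show ?thesis by (auto simp: image_iff)
  qed
  then obtain G where G: "\<And>y. y \<in> R \<Longrightarrow> G y \<in> R" "\<And>y. y \<in> R \<Longrightarrow> T (G y) = y" by metis
  have eqI: "x = y" if "x \<in> R" "y \<in> R" "T x = T y" for x y
    using inj[of "x - y"] that R(1) by (simp add: csubspaceD blinfun.diff_right)
  have TinR: "T x \<in> R" if "x \<in> R" for x using that TR by blast
  have GT: "G (T x) = x" if "x \<in> R" for x by (rule eqI) (simp_all add: that G TinR)
  have Gadd: "G (x + y) = G x + G y" if "x \<in> R" "y \<in> R" for x y
    by (rule eqI) (simp_all add: that G csubspaceD[OF R(1)] blinfun.add_right)
  have Gscale: "G (a *\<^sub>C x) = a *\<^sub>C G x" if "x \<in> R" for a x
    by (rule eqI) (simp_all add: that G csubspaceD[OF R(1)] clinear_opD[OF T_clinear])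
  have Gnorm: "norm (G x) \<le> norm x / \<delta>" if "x \<in> R" for x
    using \<delta>(1) \<delta>(2)[OF G(1)[OF that]] G(2)[OF that] by (simp add: field_simps)
  have GnR: "(G ^^ k) x \<in> R" if "x \<in> R" for k x by (induction k) (auto simp: that G)
  have Gnadd: "(G ^^ k) (x + y) = (G ^^ k) x + (G ^^ k) y" if "x \<in> R" "y \<in> R" for k x y
    by (induction k) (auto simp: that Gadd GnR)
  have Gnscale: "(G ^^ k) (a *\<^sub>C x) = a *\<^sub>C (G ^^ k) x" if "x \<in> R" for k a x
    by (induction k) (auto simp: that Gscale GnR)
  have Gnnorm: "norm ((G ^^ k) x) \<le> (1 / \<delta>) ^ k * norm x" if "x \<in> R" for k x
  proof (induction k)
    case (Suc k)
    have "norm ((G ^^ Suc k) x) \<le> norm ((G ^^ k) x) / \<delta>" using Gnorm[OF GnR[OF that]] by simp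
    also have "\<dots> \<le> ((1 / \<delta>) ^ k * norm x) / \<delta>" using Suc \<delta>(1) by (simp add: divide_right_mono)
    finally show ?case by (simp add: field_simps)
  qed simp
  have Tn: "(blinfun_apply T ^^ k) x \<in> R \<and> (blinfun_apply T ^^ k) ((G ^^ k) x) = x \<and> (G ^^ k) ((blinfun_apply T ^^ k) x) = x" if "x \<in> R" for k x
    using that
  proof (induction k arbitrary: x)
    case (Suc k)
    have "(blinfun_apply T ^^ Suc k) ((G ^^ Suc k) x) = (blinfun_apply T ^^ k) (T (G ((G ^^ k) x)))" by (simp add: funpow_swap1)
    moreover have "(G ^^ Suc k) ((blinfun_apply T ^^ Suc k) x) = (G ^^ k) (G (T ((blinfun_apply T ^^ k) x)))" by (simp add: funpow_swap1)
    ultimately show ?case using Suc GnR G GT TinR by simp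
  qed simp
  have TqR: "(blinfun_apply T ^^ q) x \<in> R" for x by (simp add: R_def)
  define Tq where "Tq = ((o\<^sub>L) T ^^ q) id_blinfun"
  have Tq: "Tq x = (blinfun_apply T ^^ q) x" for x
  proof -
    have "(((o\<^sub>L) T ^^ k) id_blinfun) x = (blinfun_apply T ^^ k) x" for k by (induction k) auto
    then show ?thesis by (simp add: Tq_def)
  qed
  \<comment> \<open>\<open>G\<close> inverts \<open>T\<close> only on \<open>R\<close>, but preceded
    by the power \<open>q\<close> of \<open>T\<close> its powers are bounded operators on the whole
    space.\<close>
  have bl: "bounded_linear (\<lambda>x. (G ^^ k) ((blinfun_apply T ^^ q) x))" for k
  proof (rule bounded_linear_intro)
    show "(G ^^ k) ((blinfun_apply T ^^ q) (x + y)) = (G ^^ k) ((blinfun_apply T ^^ q) x) + (G ^^ k) ((blinfun_apply T ^^ q) y)" for x y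
      by (simp add: funpow_simps Gnadd TqR)
    show "(G ^^ k) ((blinfun_apply T ^^ q) (r *\<^sub>R x)) = r *\<^sub>R (G ^^ k) ((blinfun_apply T ^^ q) x)" for r x
      by (simp add: funpow_simps Gnscale TqR flip: scaleC_of_real)
    show "norm ((G ^^ k) ((blinfun_apply T ^^ q) x)) \<le> norm x * ((1 / \<delta>) ^ k * norm Tq)" for x
    proof -
      have "norm ((G ^^ k) ((blinfun_apply T ^^ q) x)) \<le> (1 / \<delta>) ^ k * norm (Tq x)" unfolding Tq by (rule Gnnorm[OF TqR])
      also have "\<dots> \<le> (1 / \<delta>) ^ k * (norm Tq * norm x)"
        using \<delta>(1) by (intro mult_left_mono norm_blinfun) auto
      finally show ?thesis by (simp add: mult_ac)
    qed
  qed
  \<comment> \<open>\<open>Q\<close> projects onto \<open>R\<close> along the kernel of the power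
    \<open>q\<close> of \<open>T\<close>. One more factor \<open>G\<close> makes \<open>S\<close>
    the composition of \<open>G\<close> with \<open>Q\<close>.\<close>
  define Q where "Q = Blinfun (\<lambda>x. (G ^^ q) ((blinfun_apply T ^^ q) x))"
  define S where "S = Blinfun (\<lambda>x. (G ^^ Suc q) ((blinfun_apply T ^^ q) x))"
  define P where "P = id_blinfun - Q"
  have Q: "Q x = (G ^^ q) ((blinfun_apply T ^^ q) x)" for x unfolding Q_def by (simp only: bounded_linear_Blinfun_apply[OF bl])
  have S: "S x = G ((G ^^ q) ((blinfun_apply T ^^ q) x))" for x
    using bounded_linear_Blinfun_apply[OF bl[of "Suc q"]] by (simp add: S_def)
  have P: "P x = x - Q x" for x by (simp add: P_def blinfun.diff_left)
  have QR: "Q x \<in> R" for x by (simp add: Q GnR TqR)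
  have TqQ: "(blinfun_apply T ^^ q) (Q x) = (blinfun_apply T ^^ q) x" for x using Tn[OF TqR] by (simp add: Q)
  have TqP: "(blinfun_apply T ^^ q) (P x) = 0" for x by (simp add: P funpow_simps TqQ)
  have QQ: "Q (Q x) = Q x" for x using Tn[OF QR] by (simp add: Q[of "Q x"])
  have G0: "G 0 = 0" using GT[OF csubspaceD(1)[OF R(1)]] by simp
  show ?thesis
  proof (rule that[of P S q])
    show "clinear_op S" unfolding clinear_op_def
      by (auto simp: S funpow_simps Gnscale Gscale TqR GnR)
    show "clinear_op P" unfolding clinear_op_def
      by (auto simp: P Q funpow_simps Gnscale TqR cvec.scale_right_diff_distrib)
    show "P (P x) = P x" for x by (simp add: P blinfun.diff_right QQ)
    show "(blinfun_apply T ^^ q) (P x) = 0" for x by (rule TqP)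
    show "T (S x) = x - P x" for x using G(2)[OF QR] by (simp add: S P Q)
    show "S (T x) = x - P x" for x
    proof -
      have "S (T x) = G ((G ^^ q) (T ((blinfun_apply T ^^ q) x)))" by (simp add: S funpow_swap1)
      also have "\<dots> = (G ^^ q) (G (T ((blinfun_apply T ^^ q) x)))" by (simp add: funpow_swap1)
      also have "\<dots> = Q x" by (simp add: GT TqR Q)
      finally show ?thesis by (simp add: P)
    qed
    show "S (P x) = 0" for x using Gnscale[OF csubspaceD(1)[OF R(1)], of q 0] by (simp add: S TqP G0)
  qed
qed

lemma fredholm_alternative:
  assumes inj: "\<And>x. T x = 0 \<Longrightarrow> x = 0"
  obtains S :: "'a \<Rightarrow>\<^sub>L 'a" where "clinear_op S" "\<And>x. T (S x) = x" "\<And>x. S (T x) = x"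
proof -
  obtain P S :: "'a \<Rightarrow>\<^sub>L 'a" and n where PS: "clinear_op S"
    "\<And>x. (blinfun_apply T ^^ n) (P x) = 0" "\<And>x. T (S x) = x - P x" "\<And>x. S (T x) = x - P x"
    using riesz_decomposition by metis
  have "(blinfun_apply T ^^ k) x = 0 \<Longrightarrow> x = 0" for k x by (induction k) (auto dest: inj)
  then have "P x = 0" for x using PS(2) by blast
  then show ?thesis using PS by (intro that) auto
qed

end

section \<open>Operator-valued holomorphic functions\<close>

lemma norm_scale_op_le: "norm (scale_op c T) \<le> cmod c * norm T"
proof (rule norm_blinfun_bound)
  show "norm (scale_op c T x) \<le> cmod c * norm T * norm x" for x
    using mult_left_mono[OF norm_blinfun[of T x], of "cmod c"] by (simp add: scale_op_apply norm_scaleC mult.assoc)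
qed simp

lemma bounded_bilinear_scale_op: "bounded_bilinear scale_op"
proof
  show "scale_op (a + b) T = scale_op a T + scale_op b T" for a b and T :: "'a \<Rightarrow>\<^sub>L 'b"
    by (rule blinfun_eqI) (simp add: scale_op_apply blinfun.add_left scaleC_add_left)
  show "scale_op a (S + T) = scale_op a S + scale_op a T" for a and S T :: "'a \<Rightarrow>\<^sub>L 'b"
    by (rule blinfun_eqI) (simp add: scale_op_apply blinfun.add_left scaleC_add_right)
  show "scale_op (r *\<^sub>R a) T = r *\<^sub>R scale_op a T" for r a and T :: "'a \<Rightarrow>\<^sub>L 'b"
    by (rule blinfun_eqI)
      (simp add: scale_op_apply blinfun.scaleR_left scaleR_conv_of_real scaleC_scaleC flip: scaleC_of_real)
  show "scale_op a (r *\<^sub>R T) = r *\<^sub>R scale_op a T" for r a and T :: "'a \<Rightarrow>\<^sub>L 'b"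
    by (rule blinfun_eqI) (simp add: scale_op_apply blinfun.scaleR_left scaleC_scaleR)
  show "\<exists>K. \<forall>a (T :: 'a \<Rightarrow>\<^sub>L 'b). norm (scale_op a T) \<le> norm a * norm T * K"
    by (rule exI[of _ 1]) (simp add: norm_scale_op_le)
qed

lemma scale_op_scale_op [simp]: "scale_op a (scale_op b T) = scale_op (a * b) T"
  by (rule blinfun_eqI) (simp add: scale_op_apply scaleC_scaleC)

lemma scale_op_1 [simp]: "scale_op 1 T = T"
  by (rule blinfun_eqI) (simp add: scale_op_apply)

lemma scale_op_0 [simp]: "scale_op 0 T = 0" "scale_op a 0 = 0"
  by (rule blinfun_eqI, simp add: scale_op_apply)+

lemmas scale_op_add_right = bounded_bilinear.add_right[OF bounded_bilinear_scale_op]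
lemmas scale_op_sum_right = bounded_bilinear.sum_right[OF bounded_bilinear_scale_op]

lemma holomorphic_op_onI:
  "(\<And>s. s \<in> S \<Longrightarrow> (g has_derivative (\<lambda>h. scale_op h (D s))) (at s within S)) \<Longrightarrow> holomorphic_op_on g S"
  unfolding holomorphic_op_on_def by blast

lemma holomorphic_op_on_const: "holomorphic_op_on (\<lambda>s. T) S"
  by (rule holomorphic_op_onI[of _ _ "\<lambda>_. 0"]) simp

lemma holomorphic_op_on_subset: "holomorphic_op_on g S \<Longrightarrow> S' \<subseteq> S \<Longrightarrow> holomorphic_op_on g S'"
  unfolding holomorphic_op_on_def by (meson has_derivative_subset subsetD)

lemma holomorphic_op_on_add:
  assumes "holomorphic_op_on f S" "holomorphic_op_on g S"
  shows "holomorphic_op_on (\<lambda>s. f s + g s) S"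
proof -
  obtain D where "\<And>s. s \<in> S \<Longrightarrow> (f has_derivative (\<lambda>h. scale_op h (D s))) (at s within S)"
    using assms(1) unfolding holomorphic_op_on_def by metis
  moreover obtain E where "\<And>s. s \<in> S \<Longrightarrow> (g has_derivative (\<lambda>h. scale_op h (E s))) (at s within S)"
    using assms(2) unfolding holomorphic_op_on_def by metis
  ultimately show ?thesis
    by (intro holomorphic_op_onI[of _ _ "\<lambda>s. D s + E s"]) (simp add: scale_op_add_right has_derivative_add)
qed

lemma holomorphic_op_on_sum:
  "(\<And>i. i \<in> I \<Longrightarrow> holomorphic_op_on (f i) S) \<Longrightarrow> holomorphic_op_on (\<lambda>s. \<Sum>i\<in>I. f i s) S"
  by (induction I rule: infinite_finite_induct)
    (auto intro: holomorphic_op_on_const holomorphic_op_on_add)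

lemma holomorphic_op_on_scale:
  assumes "f holomorphic_on S" "holomorphic_op_on g S"
  shows "holomorphic_op_on (\<lambda>s. scale_op (f s) (g s)) S"
proof -
  obtain f' where f': "\<And>s. s \<in> S \<Longrightarrow> (f has_derivative (\<lambda>h. f' s * h)) (at s within S)"
    using assms(1) unfolding holomorphic_on_def field_differentiable_def has_field_derivative_def by metis
  obtain D where D: "\<And>s. s \<in> S \<Longrightarrow> (g has_derivative (\<lambda>h. scale_op h (D s))) (at s within S)"
    using assms(2) unfolding holomorphic_op_on_def by metis
  show ?thesis
  proof (rule holomorphic_op_onI)
    fix s assume s: "s \<in> S"
    show "((\<lambda>s. scale_op (f s) (g s)) has_derivative
        (\<lambda>h. scale_op h (scale_op (f s) (D s) + scale_op (f' s) (g s)))) (at s within S)"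
      using bounded_bilinear.FDERIV[OF bounded_bilinear_scale_op f'[OF s] D[OF s]]
      by (simp add: scale_op_add_right mult.commute)
  qed
qed

lemma bounded_linear_matrix_element: "bounded_linear (\<lambda>T :: 'a::complex_hilbert \<Rightarrow>\<^sub>L 'b::complex_hilbert. cinner y (T x))"
  using bounded_linear_compose[OF bounded_linear_cinner_right blinfun.bounded_linear_left] .

lemma holomorphic_matrix_element:
  assumes "holomorphic_op_on g S"
  shows "(\<lambda>s. cinner y (g s x)) holomorphic_on S"
  unfolding holomorphic_on_def field_differentiable_def has_field_derivative_def
proof
  fix s assume "s \<in> S"
  then obtain D where "(g has_derivative (\<lambda>h. scale_op h D)) (at s within S)"
    using assms unfolding holomorphic_op_on_def by blast
  from bounded_linear.has_derivative[OF bounded_linear_matrix_element this, of y x]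
  show "\<exists>f'. ((\<lambda>s. cinner y (g s x)) has_derivative (*) f') (at s within S)"
    by (intro exI[of _ "cinner y (D x)"]) (simp add: scale_op_apply mult.commute[of _ "cinner y (D x)"])
qed

lemma holomorphic_op_on_continuous: "holomorphic_op_on g S \<Longrightarrow> continuous_on S g"
  unfolding holomorphic_op_on_def continuous_on_eq_continuous_within
  by (meson has_derivative_continuous)

text \<open>The first resolvent identity makes a locally bounded family complex differentiable.\<close>

lemma pseudo_resolvent_holomorphic:
  fixes f :: "complex \<Rightarrow> 'a::complex_hilbert \<Rightarrow>\<^sub>L 'a"
  assumes id: "\<And>v w x. v \<in> U \<Longrightarrow> w \<in> U \<Longrightarrow> f v x - f w x = (w - v) *\<^sub>C f v (f w x)"
    and bd: "\<And>w. w \<in> U \<Longrightarrow> norm (f w) \<le> C" and lin: "\<And>w. w \<in> U \<Longrightarrow> clinear_op (f w)"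
  shows "holomorphic_op_on f U"
proof (rule holomorphic_op_onI)
  fix s assume s: "s \<in> U"
  have C: "C \<ge> 0" using bd[OF s] norm_ge_zero[of "f s"] by linarith
  show "(f has_derivative (\<lambda>h. scale_op h (- (f s o\<^sub>L f s)))) (at s within U)"
  proof (rule has_derivativeI_sandwich[of 1])
    show "bounded_linear (\<lambda>h. scale_op h (- (f s o\<^sub>L f s)))"
      by (rule bounded_bilinear.bounded_linear_left[OF bounded_bilinear_scale_op])
    show "((\<lambda>y. norm (y - s) * (C * C * C)) \<longlongrightarrow> 0) (at s within U)"
      by (rule tendsto_eq_intros | simp)+
    fix y assume y: "y \<in> U" "y \<noteq> s"
    \<comment> \<open>Two uses of the identity give the remainder exactly: it is of second order in
      \<open>y - s\<close>, with a coefficient bounded by \<open>C * C * C\<close>.\<close>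
    have "f y - f s - scale_op (y - s) (- (f s o\<^sub>L f s)) = scale_op ((y - s) * (y - s)) (f y o\<^sub>L (f s o\<^sub>L f s))"
    proof (rule blinfun_eqI)
      fix x
      have a: "f y x = f s x + (s - y) *\<^sub>C f y (f s x)" using id[OF y(1) s, of x] by (simp add: algebra_simps)
      have b: "f y (f s x) = f s (f s x) + (s - y) *\<^sub>C f y (f s (f s x))"
        using id[OF y(1) s, of "f s x"] by (simp add: algebra_simps)
      have "(f y - f s - scale_op (y - s) (- (f s o\<^sub>L f s))) x
          = (s - y) *\<^sub>C f y (f s x) + (y - s) *\<^sub>C f s (f s x)"
        by (simp add: blinfun.bilinear_simps scale_op_apply a)
      also have "\<dots> = (s - y) *\<^sub>C (s - y) *\<^sub>C f y (f s (f s x))"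
        by (subst b) (simp add: cvec.scale_right_distrib cvec.scale_left_diff_distrib)
      finally show "(f y - f s - scale_op (y - s) (- (f s o\<^sub>L f s))) x
          = scale_op ((y - s) * (y - s)) (f y o\<^sub>L (f s o\<^sub>L f s)) x"
        by (simp add: scale_op_apply minus_mult_minus[of "y - s" "y - s", symmetric])
    qed
    then have "norm (f y - f s - scale_op (y - s) (- (f s o\<^sub>L f s)))
        \<le> cmod ((y - s) * (y - s)) * norm (f y o\<^sub>L (f s o\<^sub>L f s))"
      using norm_scale_op_le by metis
    also have "norm (f y o\<^sub>L (f s o\<^sub>L f s)) \<le> C * (C * C)"
      using bd[OF s] bd[OF y(1)] C
      by (intro order_trans[OF norm_blinfun_compose] mult_mono) auto
    finally have "norm (f y - f s - scale_op (y - s) (- (f s o\<^sub>L f s)))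
        \<le> norm (y - s) * (norm (y - s) * (C * C * C))"
      by (simp add: norm_mult mult_left_mono mult.assoc)
    then show "norm (f y - f s - scale_op (y - s) (- (f s o\<^sub>L f s))) / norm (y - s) \<le> norm (y - s) * (C * C * C)"
      using y by (simp add: divide_simps mult_ac)
  qed simp
qed

subsection \<open>Residues\<close>

lemma has_contour_integral_op_scale:
  assumes "(f has_contour_integral i) g"
  shows "has_contour_integral_op (\<lambda>s. scale_op (f s) C) (scale_op i C) g"
  unfolding has_contour_integral_op_def
  using has_integral_linear[OF assms[unfolded has_contour_integral_def]
      bounded_bilinear.bounded_linear_left[OF bounded_bilinear_scale_op, of C]]
  by (simp add: o_def mult.commute)

lemma has_contour_integral_op_add:
  "has_contour_integral_op f I g \<Longrightarrow> has_contour_integral_op h J g \<Longrightarrow>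
    has_contour_integral_op (\<lambda>s. f s + h s) (I + J) g"
  unfolding has_contour_integral_op_def by (simp add: scale_op_add_right has_integral_add)

lemma has_contour_integral_op_0: "has_contour_integral_op (\<lambda>s. 0) 0 g"
  unfolding has_contour_integral_op_def by simp

lemma has_contour_integral_op_sum:
  "(\<And>j. j \<in> J \<Longrightarrow> has_contour_integral_op (f j) (I j) g) \<Longrightarrow>
    has_contour_integral_op (\<lambda>s. \<Sum>j\<in>J. f j s) (\<Sum>j\<in>J. I j) g"
  by (induction J rule: infinite_finite_induct)
    (auto intro: has_contour_integral_op_add has_contour_integral_op_0)

lemma has_contour_integral_op_cong:
  assumes "\<And>s. s \<in> path_image g \<Longrightarrow> f s = h s" "has_contour_integral_op f I g"
  shows "has_contour_integral_op h I g"
  using assms(2) unfolding has_contour_integral_op_def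
  by (rule has_integral_eq[rotated]) (use assms(1) in \<open>auto simp: path_image_def\<close>)

lemma has_contour_integral_op_unique:
  "has_contour_integral_op f I g \<Longrightarrow> has_contour_integral_op f J g \<Longrightarrow> I = J"
  unfolding has_contour_integral_op_def by (rule has_integral_unique)

text \<open>Continuity makes the integral exist in operator norm; each of its matrix elements is a
  scalar integral along a circle in a disc of holomorphy and is zero.\<close>

lemma cauchy_theorem_op:
  assumes h: "holomorphic_op_on h (ball a e)" and r: "0 < r" "r < e"
  shows "has_contour_integral_op h 0 (circlepath a r)"
proof -
  let ?g = "circlepath a r"
  let ?f = "\<lambda>x. scale_op (vector_derivative ?g (at x within {0..1})) (h (?g x))"
  have img: "path_image ?g \<subseteq> ball a e" using r by auto
  have "continuous_on {0..1} (\<lambda>x. scale_op (2 * pi * \<i> * r * exp (2 * pi * \<i> * x)) (h (?g x)))"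
  proof (intro bounded_bilinear.continuous_on[OF bounded_bilinear_scale_op] continuous_intros)
    show "continuous_on {0..1} (\<lambda>x. h (?g x))"
    proof (rule continuous_on_compose2[OF holomorphic_op_on_continuous[OF h]])
      show "continuous_on {0..1} ?g" using path_circlepath unfolding path_def by blast
      show "?g ` {0..1} \<subseteq> ball a e" using img by (simp add: path_image_def)
    qed
  qed
  then have "(\<lambda>x. scale_op (2 * pi * \<i> * r * exp (2 * pi * \<i> * x)) (h (?g x))) integrable_on {0..1}"
    by (rule integrable_continuous_real)
  then have "?f integrable_on {0..1}"
    by (rule integrable_eq) (simp add: vector_derivative_circlepath01)
  then obtain I where I: "(?f has_integral I) {0..1}" by (auto simp: integrable_on_def)
  have "cinner y (I x) = 0" for x y
  proof -
    have "((\<lambda>s. cinner y (h s x)) has_contour_integral 0) ?g"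
      by (rule Cauchy_theorem_disc_simple[OF holomorphic_matrix_element[OF h]]) (use img in auto)
    then have 1: "((\<lambda>t. cinner y (?f t x)) has_integral 0) {0..1}"
      by (simp add: has_contour_integral_def scale_op_apply mult.commute)
    have 2: "((\<lambda>t. cinner y (?f t x)) has_integral cinner y (I x)) {0..1}"
      using has_integral_linear[OF I bounded_linear_matrix_element[of y x]] by (simp add: o_def)
    show ?thesis by (rule has_integral_unique[OF 2 1])
  qed
  then have "I = 0" by (intro blinfun_eqI cinner_ext) simp
  with I show ?thesis by (simp add: has_contour_integral_op_def)
qed

text \<open>The shift in the exponent makes \<open>c 0\<close> the residue; for the families below,
  \<open>c j\<close> is then the \<open>j\<close>-th power of a nilpotent operator.\<close>

definition laurent_sum :: "complex \<Rightarrow> (nat \<Rightarrow> 'a::complex_hilbert \<Rightarrow>\<^sub>L 'b::complex_hilbert) \<Rightarrow> nat \<Rightarrow> complex \<Rightarrow> 'a \<Rightarrow>\<^sub>L 'b"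
  where "laurent_sum a c n w = (\<Sum>j<n. scale_op (1 / (w - a) ^ Suc j) (c j))"

text \<open>Only the simple pole contributes to the integral. The operator chosen by
  \<open>residue_op\<close> is \<open>c 0\<close> because both represent the integral over a common
  small circle.\<close>

lemma residue_op_laurent:
  assumes e: "e > 0" and h: "holomorphic_op_on h (ball a e)"
    and f: "\<And>w. w \<in> ball a e - {a} \<Longrightarrow> f w = laurent_sum a c (Suc n) w + h w"
  shows "residue_op f a = c 0"
proof -
  have int: "has_contour_integral_op f (scale_op (2 * pi * \<i>) (c 0)) (circlepath a r)"
    if r: "0 < r" "r < e" for r
  proof -
    \<comment> \<open>This is Cauchy's formula for the \<open>j\<close>-th derivative of the
      constant function 1.\<close>
    have "((\<lambda>w. 1 / (w - a) ^ Suc j) has_contour_integral (if j = 0 then 2 * pi * \<i> else 0)) (circlepath a r)" for j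
      using Cauchy_has_contour_integral_higher_derivative_circlepath[of a r "\<lambda>_. 1" a j] r
      by (cases j) (auto simp: higher_deriv_const)
    then have "has_contour_integral_op (\<lambda>w. laurent_sum a c (Suc n) w + h w)
        ((\<Sum>j<Suc n. scale_op (if j = 0 then 2 * pi * \<i> else 0) (c j)) + 0) (circlepath a r)"
      unfolding laurent_sum_def
      by (intro has_contour_integral_op_add has_contour_integral_op_sum has_contour_integral_op_scale
          cauchy_theorem_op[OF h r])
    then have "has_contour_integral_op (\<lambda>w. laurent_sum a c (Suc n) w + h w)
        (scale_op (2 * pi * \<i>) (c 0)) (circlepath a r)"
      by (simp add: sum.lessThan_Suc_shift del: sum.lessThan_Suc)
    then show ?thesis
      by (rule has_contour_integral_op_cong[rotated]) (use r f in \<open>auto simp: dist_norm norm_minus_commute\<close>)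
  qed
  show ?thesis
    unfolding residue_op_def
  proof (rule some_equality)
    show "\<exists>e>0. \<forall>\<epsilon>>0. \<epsilon> < e \<longrightarrow> has_contour_integral_op f (scale_op (2 * pi * \<i>) (c 0)) (circlepath a \<epsilon>)"
      using e int by blast
    fix R assume "\<exists>e>0. \<forall>\<epsilon>>0. \<epsilon> < e \<longrightarrow> has_contour_integral_op f (scale_op (2 * pi * \<i>) R) (circlepath a \<epsilon>)"
    then obtain e' where e': "e' > 0" "\<forall>\<epsilon>>0. \<epsilon> < e' \<longrightarrow> has_contour_integral_op f (scale_op (2 * pi * \<i>) R) (circlepath a \<epsilon>)"
      by blast
    define r where "r = min e e' / 2"
    have "scale_op (2 * pi * \<i>) R = scale_op (2 * pi * \<i>) (c 0)"
      by (rule has_contour_integral_op_unique[of f _ "circlepath a r"])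
        (use e e' int in \<open>auto simp: r_def\<close>)
    then have "scale_op (1 / (2 * pi * \<i>)) (scale_op (2 * pi * \<i>) R)
        = scale_op (1 / (2 * pi * \<i>)) (scale_op (2 * pi * \<i>) (c 0))" by simp
    then show "R = c 0" by (simp del: of_real_mult)
  qed
qed

lemma residue_op_laurent_1:
  assumes e: "e > 0" and h: "holomorphic_op_on h (ball a e)"
    and f: "\<And>w. w \<in> ball a e - {a} \<Longrightarrow> f w = laurent_sum a c (Suc (Suc n)) w + h w"
  shows "residue_op (\<lambda>s. scale_op (s - a) (f s)) a = c 1"
proof -
  define h' where "h' w = c 0 + scale_op (w - a) (h w)" for w
  have "holomorphic_op_on h' (ball a e)" unfolding h'_def
    by (intro holomorphic_op_on_add holomorphic_op_on_const holomorphic_op_on_scale h holomorphic_intros)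
  moreover have "scale_op (w - a) (f w) = laurent_sum a (\<lambda>j. c (Suc j)) (Suc n) w + h' w"
    if w: "w \<in> ball a e - {a}" for w
  proof -
    have "scale_op (w - a) (laurent_sum a c (Suc (Suc n)) w) = c 0 + laurent_sum a (\<lambda>j. c (Suc j)) (Suc n) w"
      using w unfolding laurent_sum_def sum.lessThan_Suc_shift[of _ "Suc n"]
      by (simp add: scale_op_add_right scale_op_sum_right del: sum.lessThan_Suc)
    then show ?thesis unfolding f[OF w] by (simp add: scale_op_add_right h'_def)
  qed
  ultimately show ?thesis using residue_op_laurent[OF e, of h' a _ "\<lambda>j. c (Suc j)" n] by simp
qed

lemma laurent_meromorphic_form:
  assumes h: "holomorphic_op_on h (ball a e)"
  obtains g where "holomorphic_op_on g (ball a e)"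
    "\<And>w. w \<in> ball a e - {a} \<Longrightarrow> laurent_sum a c n w + h w = scale_op (1 / (w - a) ^ n) (g w)"
proof
  let ?g = "\<lambda>w. (\<Sum>j<n. scale_op ((w - a) ^ (n - Suc j)) (c j)) + scale_op ((w - a) ^ n) (h w)"
  show "holomorphic_op_on ?g (ball a e)"
    by (intro holomorphic_op_on_add holomorphic_op_on_sum holomorphic_op_on_const holomorphic_op_on_scale h
        holomorphic_intros)
  fix w assume w: "w \<in> ball a e - {a}"
  have "1 / (w - a) ^ n * (w - a) ^ (n - Suc j) = 1 / (w - a) ^ Suc j" if "j < n" for j
  proof -
    have "(w - a) ^ n = (w - a) ^ (n - Suc j) * (w - a) ^ Suc j"
      using that by (simp flip: power_add power_Suc)
    then show ?thesis using w by simp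
  qed
  then show "laurent_sum a c n w + h w = scale_op (1 / (w - a) ^ n) (?g w)"
    using w by (simp add: laurent_sum_def scale_op_add_right scale_op_sum_right)
qed

text \<open>For the application \<open>f\<close> is prescribed only at real points. Its own local
  form at \<open>r\<close> and the given one agree on a real interval accumulating at
  \<open>r\<close>, so the identity theorem, applied to matrix elements, transports the given form
  to a complex punctured disc.\<close>

lemma meromorphic_op_identity:
  assumes f: "meromorphic_op f"
    and e: "e > 0" and g: "holomorphic_op_on g (ball (of_real r) e)"
    and eq: "\<And>t::real. t \<noteq> r \<Longrightarrow> \<bar>t - r\<bar> < e \<Longrightarrow> f (of_real t) = scale_op (1 / (of_real t - of_real r) ^ n) (g (of_real t))"
  obtains e' where "e' > 0" "e' \<le> e"
    "\<And>w. w \<in> ball (of_real r) e' - {of_real r} \<Longrightarrow> f w = scale_op (1 / (w - of_real r) ^ n) (g w)"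
proof -
  let ?a = "complex_of_real r"
  obtain m e1 g1 where g1: "e1 > 0" "holomorphic_op_on g1 (ball ?a e1)"
    "\<And>s. s \<in> ball ?a e1 - {?a} \<Longrightarrow> f s = scale_op (1 / (s - ?a) ^ m) (g1 s)"
    using f unfolding meromorphic_op_def by metis
  define e' where "e' = min e e1"
  have e': "e' > 0" "e' \<le> e" "e' \<le> e1" using e g1 by (auto simp: e'_def)
  define B where "B = ball ?a e'"
  have hol: "holomorphic_op_on g B" "holomorphic_op_on g1 B"
    using e' by (auto simp: B_def intro!: holomorphic_op_on_subset[OF g] holomorphic_op_on_subset[OF g1(2)])
  \<comment> \<open>Cross-multiplication by the two powers clears the denominators, so that
    \<open>d\<close> is holomorphic at the centre as well.\<close>
  define d where "d x y w = (w - ?a) ^ n * cinner y (g1 w x) - (w - ?a) ^ m * cinner y (g w x)" for x y w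
  have d0: "d x y w = 0" if w: "w \<in> B" for x y w
  proof (rule analytic_continuation[of "d x y" B "of_real ` {r<..<r+e'}" ?a])
    show "d x y holomorphic_on B" unfolding d_def
      by (intro holomorphic_intros holomorphic_matrix_element hol)
    show "of_real ` {r<..<r+e'} \<subseteq> B" "?a \<in> B" using e' by (auto simp: B_def dist_of_real dist_real_def)
    show "?a islimpt of_real ` {r<..<r+e'}"
      unfolding islimpt_approachable
    proof (intro allI impI)
      fix \<epsilon> :: real assume "\<epsilon> > 0"
      define t where "t = r + min \<epsilon> e' / 2"
      have t: "t \<in> {r<..<r+e'}" "\<bar>t - r\<bar> < \<epsilon>" using \<open>\<epsilon> > 0\<close> e' by (auto simp: t_def)
      then have "dist (complex_of_real t) ?a < \<epsilon>" by (simp add: dist_of_real dist_real_def)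
      with t show "\<exists>x'\<in>of_real ` {r<..<r+e'}. x' \<noteq> ?a \<and> dist x' ?a < \<epsilon>"
        by (intro bexI[of _ "of_real t"]) auto
    qed
    fix z assume "z \<in> complex_of_real ` {r<..<r+e'}"
    then obtain t where t: "z = of_real t" "r < t" "t < r + e'" by auto
    then have z: "z \<in> ball ?a e1 - {?a}" using e' by (auto simp: dist_of_real dist_real_def)
    have "scale_op (1 / (z - ?a) ^ m) (g1 z) = scale_op (1 / (z - ?a) ^ n) (g z)"
      using g1(3)[OF z] eq[of t] t e' by simp
    then have "scale_op ((z - ?a) ^ m * (z - ?a) ^ n) (scale_op (1 / (z - ?a) ^ m) (g1 z))
      = scale_op ((z - ?a) ^ m * (z - ?a) ^ n) (scale_op (1 / (z - ?a) ^ n) (g z))" by simp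
    then have "scale_op ((z - ?a) ^ n) (g1 z) = scale_op ((z - ?a) ^ m) (g z)"
      using z by simp
    then have "cinner y (scale_op ((z - ?a) ^ n) (g1 z) x) = cinner y (scale_op ((z - ?a) ^ m) (g z) x)" by simp
    then show "d x y z = 0" by (simp add: d_def scale_op_apply)
  qed (use w in \<open>auto simp: B_def\<close>)
  show ?thesis
  proof (rule that[OF e'(1,2)])
    fix w assume w: "w \<in> ball ?a e' - {?a}"
    have "scale_op ((w - ?a) ^ n) (g1 w) = scale_op ((w - ?a) ^ m) (g w)"
    proof (intro blinfun_eqI cinner_ext)
      fix x y
      show "cinner y (scale_op ((w - ?a) ^ n) (g1 w) x) = cinner y (scale_op ((w - ?a) ^ m) (g w) x)"
        using d0[of w x y] w by (simp add: d_def scale_op_apply B_def)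
    qed
    then have "scale_op (1 / ((w - ?a) ^ m * (w - ?a) ^ n)) (scale_op ((w - ?a) ^ n) (g1 w))
      = scale_op (1 / ((w - ?a) ^ m * (w - ?a) ^ n)) (scale_op ((w - ?a) ^ m) (g w))" by simp
    then have "scale_op (1 / (w - ?a) ^ m) (g1 w) = scale_op (1 / (w - ?a) ^ n) (g w)"
      using w by simp
    then show "f w = scale_op (1 / (w - ?a) ^ n) (g w)" using g1(3)[of w] w e' by simp
  qed
qed

section \<open>Laurent expansion of the resolvent family of a compact operator\<close>

text \<open>\<open>K (1 + c K)\<^sup>-\<^sup>1\<close>, with value \<open>0\<close> where \<open>1 + c K\<close> is not invertible.\<close>

definition is_resolvent_op :: "('a::complex_hilbert \<Rightarrow>\<^sub>L 'a) \<Rightarrow> complex \<Rightarrow> ('a \<Rightarrow>\<^sub>L 'a) \<Rightarrow> bool" where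
  "is_resolvent_op K c B \<longleftrightarrow> clinear_op B \<and>
     (\<forall>x. B (x + c *\<^sub>C K x) = K x) \<and> (\<forall>x. B x + c *\<^sub>C K (B x) = K x)"

definition resolvent_op :: "('a::complex_hilbert \<Rightarrow>\<^sub>L 'a) \<Rightarrow> complex \<Rightarrow> 'a \<Rightarrow>\<^sub>L 'a" where
  "resolvent_op K c = (if \<exists>B. is_resolvent_op K c B then (SOME B. is_resolvent_op K c B) else 0)"

lemma is_resolvent_opD:
  assumes "is_resolvent_op K c B"
  shows "clinear_op B" "B (x + c *\<^sub>C K x) = K x" "B x + c *\<^sub>C K (B x) = K x"
  using assms by (auto simp: is_resolvent_op_def)

text \<open>\<open>B\<close> encodes the inverse of 1 + c K as 1 - c B: the vector
  \<open>x - c *\<^sub>C B x\<close> is the preimage of \<open>x\<close>.\<close>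

lemma is_resolvent_op_surj:
  assumes K: "clinear_op K" and B: "is_resolvent_op K c B"
  shows "x = (x - c *\<^sub>C B x) + c *\<^sub>C K (x - c *\<^sub>C B x)" "K (x - c *\<^sub>C B x) = B x"
proof -
  have *: "c *\<^sub>C K (B x) = K x - B x" using is_resolvent_opD(3)[OF B, of x] by (simp add: algebra_simps)
  show 1: "K (x - c *\<^sub>C B x) = B x" by (simp add: blinfun.diff_right clinear_opD[OF K] *)
  show "x = (x - c *\<^sub>C B x) + c *\<^sub>C K (x - c *\<^sub>C B x)" unfolding 1 by simp
qed

lemma is_resolvent_op_unique:
  assumes K: "clinear_op K" and B: "is_resolvent_op K c B" and B': "is_resolvent_op K c B'"
  shows "B = B'"
proof (rule blinfun_eqI)
  fix x
  show "B x = B' x"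
    using is_resolvent_opD(2)[OF B, of "x - c *\<^sub>C B' x"] is_resolvent_op_surj[OF K B', of x] by simp
qed

lemma resolvent_op_eq:
  assumes K: "clinear_op K" and B: "is_resolvent_op K c B"
  shows "resolvent_op K c = B"
proof -
  have "is_resolvent_op K c (SOME B. is_resolvent_op K c B)" using B by (rule someI)
  then have "(SOME B. is_resolvent_op K c B) = B" by (rule is_resolvent_op_unique[OF K _ B])
  moreover have "\<exists>B. is_resolvent_op K c B" using B by blast
  ultimately show ?thesis by (simp add: resolvent_op_def)
qed

lemma clinear_resolvent_op: "clinear_op (resolvent_op K c)"
proof (cases "\<exists>B. is_resolvent_op K c B")
  case True
  then have "is_resolvent_op K c (SOME B. is_resolvent_op K c B)" by (rule someI_ex)
  then show ?thesis
    unfolding resolvent_op_def if_P[OF True] by (rule is_resolvent_opD(1))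
qed (simp add: resolvent_op_def clinear_op_zero)

lemma is_resolvent_op_commute:
  assumes K: "clinear_op K" and B: "is_resolvent_op K c B"
    and C: "clinear_op C" "\<And>x. C (K x) = K (C x)"
  shows "C (B x) = B (C x)"
proof -
  define u where "u = x - c *\<^sub>C B x"
  have u: "x = u + c *\<^sub>C K u" "K u = B x" using is_resolvent_op_surj[OF K B, of x] by (simp_all add: u_def)
  have "B (C x) = B (C u + c *\<^sub>C K (C u))"
    by (subst u(1)) (simp add: blinfun.add_right clinear_opD[OF C(1)] C(2))
  also have "\<dots> = C (K u)" by (simp add: is_resolvent_opD(2)[OF B] C(2))
  finally show ?thesis by (simp add: u(2))
qed

lemma is_resolvent_op_exists:
  assumes K: "compact_op K" and inj: "\<And>x. x + c *\<^sub>C K x = 0 \<Longrightarrow> x = 0"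
  shows "\<exists>B. is_resolvent_op K c B"
proof -
  define T where "T = id_blinfun + scale_op c K"
  have T: "T x = x + c *\<^sub>C K x" for x by (simp add: T_def blinfun.add_left scale_op_apply)
  interpret compact_perturbation K T c by standard (use K T in auto)
  obtain S :: "'a \<Rightarrow>\<^sub>L 'a" where S: "clinear_op S" "\<And>x. T (S x) = x" "\<And>x. S (T x) = x"
    using fredholm_alternative inj by (metis T)
  have "is_resolvent_op K c (K o\<^sub>L S)"
    unfolding is_resolvent_op_def
  proof (intro conjI allI)
    show "clinear_op (K o\<^sub>L S)" by (intro clinear_op_comp S compact_op_clinear K)
    show "(K o\<^sub>L S) (x + c *\<^sub>C K x) = K x" for x using S(3)[of x] by (simp add: T)
    show "(K o\<^sub>L S) x + c *\<^sub>C K ((K o\<^sub>L S) x) = K x" for x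
    proof -
      have "(K o\<^sub>L S) x + c *\<^sub>C K ((K o\<^sub>L S) x) = K (T (S x))"
        by (simp add: T blinfun.add_right clinear_opD[OF compact_op_clinear[OF K]])
      then show ?thesis by (simp add: S)
    qed
  qed
  then show ?thesis by blast
qed

lemma is_resolvent_op_resolvent_op:
  assumes "compact_op K" "\<And>x. x + c *\<^sub>C K x = 0 \<Longrightarrow> x = 0"
  shows "is_resolvent_op K c (resolvent_op K c)"
  unfolding resolvent_op_def using is_resolvent_op_exists[OF assms] by (simp add: someI_ex)

text \<open>The Riesz decomposition at one point \<open>a\<close> of the parameter plane, for the
  family K (1 + (w - s0) K)^-1: \<open>T\<close> is the factor to be inverted at
  \<open>w = a\<close>, \<open>P\<close> projects onto its generalised kernel, and \<open>S\<close>
  inverts \<open>T\<close> on the kernel of \<open>P\<close> and vanishes on the range of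
  \<open>P\<close>.\<close>

locale riesz_point = compact_perturbation K T "a - s\<^sub>0"
  for K T :: "'a::complex_hilbert \<Rightarrow>\<^sub>L 'a" and a s\<^sub>0 :: complex +
  fixes P S :: "'a \<Rightarrow>\<^sub>L 'a" and n :: nat
  assumes P_clinear: "clinear_op P" and S_clinear: "clinear_op S"
    and PP [simp]: "P (P x) = P x" and TnP: "(blinfun_apply T ^^ n) (P x) = 0"
    and TS: "T (S x) = x - P x" and ST: "S (T x) = x - P x" and SP: "S (P x) = 0"
begin

lemma K_clinear: "clinear_op K"
  by (rule compact_op_clinear[OF compact])

lemmas lin_simps = blinfun.add_right blinfun.diff_right blinfun.zero_right
  clinear_opD[OF K_clinear] clinear_opD[OF T_clinear] clinear_opD[OF P_clinear] clinear_opD[OF S_clinear]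

lemma PS: "P (S x) = 0"
proof -
  have "S (T (S x)) = S x" by (simp add: TS lin_simps SP)
  then show ?thesis by (simp add: ST)
qed

text \<open>Evaluating \<open>T (S (T x))\<close> through \<open>TS\<close> and through
  \<open>ST\<close> gives \<open>T x - P (T x)\<close> and \<open>T x - T (P x)\<close>.\<close>

lemma TP: "T (P x) = P (T x)"
proof -
  have "T (T (S x)) = T x - T (P x)" by (simp add: TS lin_simps)
  moreover have "T (S (T x)) = T x - P (T x)" by (rule TS)
  moreover have "T (T (S x)) = T x - T (P x)" "T (S (T x)) = T x - T (P x)"
    by (simp_all add: TS ST lin_simps)
  ultimately show ?thesis by (simp add: ST lin_simps)
qed

lemma K_T: "(s\<^sub>0 - a) *\<^sub>C K x = x - T x"
  by (simp add: T_apply cvec.scale_left_diff_distrib)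

lemma P_eq_0_if_base: "a = s\<^sub>0 \<Longrightarrow> P x = 0"
proof -
  assume "a = s\<^sub>0"
  then have "T y = y" for y by (simp add: T_apply)
  then have "(blinfun_apply T ^^ k) y = y" for k y by (induction k) auto
  with TnP show "P x = 0" by metis
qed

text \<open>Away from the base point \<open>K\<close> is a multiple of 1 - T; at the base point
  \<open>T\<close> is the identity, which forces \<open>P\<close> to be zero.\<close>

lemma KP: "K (P x) = P (K x)"
proof (cases "a = s\<^sub>0")
  case False
  have "(s\<^sub>0 - a) *\<^sub>C K (P x) = (s\<^sub>0 - a) *\<^sub>C P (K x)"
    unfolding K_T by (simp add: TP lin_simps flip: clinear_opD[OF P_clinear] K_T)
      (simp add: K_T lin_simps TP)
  then show ?thesis using False by simp
qed (simp add: P_eq_0_if_base blinfun.zero_right)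

lemma KT: "K (T x) = T (K x)"
  by (simp add: T_apply lin_simps)

lemma Tpow_commute:
  assumes "clinear_op C" "\<And>x. C (T x) = T (C x)"
  shows "C ((blinfun_apply T ^^ k) x) = (blinfun_apply T ^^ k) (C x)"
  by (induction k) (simp_all add: assms)

definition Tpow :: "nat \<Rightarrow> 'a \<Rightarrow>\<^sub>L 'a" where
  "Tpow k = ((o\<^sub>L) T ^^ k) id_blinfun"

lemma Tpow_apply: "Tpow k x = (blinfun_apply T ^^ k) x"
  unfolding Tpow_def by (induction k) auto

text \<open>The inverse of \<open>K\<close> on the range of \<open>P\<close>, from the geometric series for \<open>1 - (1 - T) = T\<close>.\<close>

definition KinvP :: "'a \<Rightarrow>\<^sub>L 'a" where
  "KinvP = scale_op (s\<^sub>0 - a) (\<Sum>j<n. Tpow j o\<^sub>L P)"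

lemma KinvP_apply: "KinvP x = (s\<^sub>0 - a) *\<^sub>C (\<Sum>j<n. (blinfun_apply T ^^ j) (P x))"
  by (simp add: KinvP_def scale_op_apply blinfun.sum_left Tpow_apply)

lemma KinvP_clinear: "clinear_op KinvP"
  by (simp add: clinear_op_def KinvP_apply lin_simps funpow_simps cvec.scale_sum_right mult.commute)

lemma K_KinvP: "K (KinvP x) = P x"
proof -
  have "K (KinvP x) = (s\<^sub>0 - a) *\<^sub>C K (\<Sum>j<n. (blinfun_apply T ^^ j) (P x))"
    by (simp add: KinvP_apply lin_simps)
  also have "\<dots> = (\<Sum>j<n. (blinfun_apply T ^^ j) (P x) - (blinfun_apply T ^^ Suc j) (P x))"
    unfolding K_T by (simp add: blinfun.sum_right sum_subtractf)
  also have "\<dots> = (blinfun_apply T ^^ 0) (P x) - (blinfun_apply T ^^ n) (P x)"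
    by (rule sum_lessThan_telescope')
  finally show ?thesis by (simp add: TnP)
qed

lemma KinvP_commute:
  assumes "clinear_op C" "\<And>x. C (T x) = T (C x)" "\<And>x. C (P x) = P (C x)"
  shows "C (KinvP x) = KinvP (C x)"
  by (simp add: KinvP_apply clinear_opD[OF assms(1)] blinfun.sum_right Tpow_commute[OF assms(1,2)] assms(3))

lemma KinvP_K: "KinvP (K x) = P x"
  using KinvP_commute[OF K_clinear KT KP] K_KinvP by simp

lemma KinvP_P: "KinvP (P x) = KinvP x"
  by (simp add: KinvP_apply)

lemma P_KinvP: "P (KinvP x) = KinvP x"
  using KinvP_commute[OF P_clinear TP[symmetric]] KinvP_P by simp

text \<open>On the range of \<open>P\<close>, where \<open>K\<close> is invertible, K (1 + (w - s0)
  K)^-1 is the inverse of K^-1 + (w - s0), that is, of (w - a) - A. This dictates the formula;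
  \<open>A\<close> turns out to be nilpotent.\<close>

definition A :: "'a \<Rightarrow>\<^sub>L 'a" where
  "A = scale_op (s\<^sub>0 - a) P - KinvP"

lemma A_apply: "A x = (s\<^sub>0 - a) *\<^sub>C P x - KinvP x"
  by (simp add: A_def blinfun.diff_left scale_op_apply)

lemma A_clinear: "clinear_op A"
  unfolding A_def by (intro clinear_intros P_clinear KinvP_clinear)

lemma AP: "A (P x) = A x" and PA: "P (A x) = A x"
  by (simp_all add: A_apply lin_simps KinvP_P P_KinvP)

lemma KA: "K (A x) = A (K x)"
  by (simp add: A_apply lin_simps KP K_KinvP KinvP_K)

lemma KA_eq: "K (A x) = - T (P x)"
  by (simp add: A_apply lin_simps K_KinvP K_T)

lemma K_inj_on_P: "P x = x \<Longrightarrow> K x = 0 \<Longrightarrow> x = 0"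
  using KinvP_K[of x] by (simp add: blinfun.zero_right)

text \<open>On the range of \<open>P\<close>, \<open>T\<close> equals - K A, where \<open>K\<close>
  is injective and commutes with \<open>A\<close>; so a vector is annihilated by the same powers of
  both operators.\<close>

lemma T_funpow_eq_0_iff: "P x = x \<Longrightarrow> (blinfun_apply T ^^ k) x = 0 \<longleftrightarrow> (blinfun_apply A ^^ k) x = 0"
proof (induction k arbitrary: x)
  case (Suc k)
  have PTx: "P (T x) = T x" using Suc.prems TP[of x] by simp
  have TA: "T (A y) = A (T y)" for y by (simp add: T_apply A_clinear[THEN clinear_opD] blinfun.add_right KA)
  have "(blinfun_apply T ^^ Suc k) x = 0 \<longleftrightarrow> (blinfun_apply A ^^ k) (T x) = 0"
    using Suc.IH[OF PTx] by (simp add: funpow_swap1)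
  also have "T x = - K (A x)" using KA_eq[of x] Suc.prems by simp
  also have "(blinfun_apply A ^^ k) (- K (A x)) = - K ((blinfun_apply A ^^ k) (A x))"
    by (induction k) (simp_all add: blinfun.minus_right KA)
  also have "- K ((blinfun_apply A ^^ k) (A x)) = 0 \<longleftrightarrow> (blinfun_apply A ^^ k) (A x) = 0"
  proof -
    have "P ((blinfun_apply A ^^ k) (A x)) = (blinfun_apply A ^^ k) (A x)" for k
      by (cases k) (simp_all add: PA)
    then show ?thesis using K_inj_on_P by (auto simp: blinfun.zero_right)
  qed
  finally show ?case by (simp add: funpow_swap1)
qed simp

text \<open>Each application of \<open>S\<close> strips one factor \<open>T\<close>, since
  \<open>S (T x)\<close> is \<open>x - P x\<close> and \<open>S\<close> annihilates the range of
  \<open>P\<close>.\<close>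

lemma P_fixed_if_T_funpow_eq_0:
  assumes "(blinfun_apply T ^^ k) x = 0" shows "P x = x"
proof -
  have "(blinfun_apply T ^^ k) x = 0 \<Longrightarrow> x - P x = 0" for x
  proof (induction k arbitrary: x)
    case (Suc k)
    have "(blinfun_apply T ^^ k) (T x) = 0" using Suc.prems by (simp add: funpow_swap1)
    then have "T x - P (T x) = 0" by (rule Suc.IH)
    then have "S (T x) = S (P (T x))" by simp
    then show ?case by (simp add: ST SP)
  qed (simp add: blinfun.zero_right)
  with assms show ?thesis by simp
qed

text \<open>Starting from \<open>P\<close> instead of the identity implements the convention that
  the zeroth power is the projection.\<close>

definition Apow :: "nat \<Rightarrow> 'a \<Rightarrow>\<^sub>L 'a" where
  "Apow k = ((o\<^sub>L) A ^^ k) P"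

lemma Apow_simps [simp]: "Apow 0 = P" "Apow (Suc k) = A o\<^sub>L Apow k"
  by (simp_all add: Apow_def)

lemma Apow_apply: "Apow k x = (blinfun_apply A ^^ k) (P x)"
  by (induction k) simp_all

lemma Apow_clinear: "clinear_op (Apow k)"
  by (induction k) (simp_all add: P_clinear A_clinear clinear_intros)

lemma P_Apow: "P (Apow k x) = Apow k x"
  by (cases k) (simp_all add: PA)

lemma T_funpow_eq_0_iff_Apow: "(blinfun_apply T ^^ k) x = 0 \<longleftrightarrow> P x = x \<and> Apow k x = 0"
  using P_fixed_if_T_funpow_eq_0 T_funpow_eq_0_iff by (metis Apow_apply)

lemma Apow_eq_0: "n \<le> k \<Longrightarrow> Apow k = 0"
proof (induction k rule: dec_induct)
  case base
  show ?case using T_funpow_eq_0_iff_Apow[of n "P x" for x] by (intro blinfun_eqI) (simp add: TnP Apow_apply)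
qed (simp add: blinfun_eqI blinfun.zero_right)

text \<open>The family on the range of \<open>P\<close> is the inverse of t - A with
  \<open>t = w - a\<close>. Since \<open>A\<close> is nilpotent, its Neumann series is finite and
  leaves no regular remainder.\<close>

lemma resolvent_on_P:
  assumes B: "is_resolvent_op K (w - s\<^sub>0) B" and w: "w \<noteq> a"
  shows "B (P x) = laurent_sum a Apow n w x"
proof -
  define t where "t = w - a"
  have t: "t \<noteq> 0" using w by (simp add: t_def)
  have key: "B (t *\<^sub>C P y - A y) = P y" for y
  proof -
    have "t *\<^sub>C P y - A y = KinvP y + (w - s\<^sub>0) *\<^sub>C K (KinvP y)"
      by (simp add: t_def A_apply K_KinvP cvec.scale_left_diff_distrib)
    then show ?thesis using is_resolvent_opD(2)[OF B, of "KinvP y"] by (simp add: K_KinvP)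
  qed
  define g where "g j = (1 / t ^ j) *\<^sub>C Apow j x" for j
  define y where "y = (\<Sum>j<n. (1 / t ^ Suc j) *\<^sub>C Apow j x)"
  have Py: "P y = y" by (simp add: y_def blinfun.sum_right lin_simps P_Apow)
  have "t *\<^sub>C P y - A y = (\<Sum>j<n. g j - g (Suc j))"
    unfolding Py sum_subtractf using t
    by (simp add: y_def g_def cvec.scale_sum_right blinfun.sum_right clinear_opD[OF A_clinear])
  also have "\<dots> = g 0 - g n" by (rule sum_lessThan_telescope')
  also have "\<dots> = P x" by (simp add: g_def Apow_eq_0)
  finally have "B (P x) = y" using key[of y] by (simp add: Py)
  then show ?thesis
    by (simp add: y_def laurent_sum_def t_def blinfun.sum_left scale_op_apply)
qed

text \<open>
  The resolvent family on the kernel of \<open>P\<close>; its singularity at \<open>a\<close> is removed by inserting the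
  inverse \<open>S\<close> of \<open>T\<close> there.
\<close>

definition regular_part :: "complex \<Rightarrow> 'a \<Rightarrow>\<^sub>L 'a" where
  "regular_part w = (if w = a then K o\<^sub>L S else resolvent_op K (w - s\<^sub>0) o\<^sub>L (id_blinfun - P))"

lemma regular_part_clinear: "clinear_op (regular_part w)"
  unfolding regular_part_def
  by (auto intro!: clinear_intros clinear_resolvent_op P_clinear K_clinear S_clinear)

text \<open>The same identities hold at the centre, through \<open>S\<close>, and away from it,
  through the resolvent. They describe the resolvent family of \<open>K\<close> on the kernel of
  \<open>P\<close>, so that \<open>w = a\<close> can be treated like its neighbours.\<close>

lemma regular_part_props:
  assumes "w = a \<or> is_resolvent_op K (w - s\<^sub>0) (resolvent_op K (w - s\<^sub>0))"
  shows "regular_part w (x + (w - s\<^sub>0) *\<^sub>C K x) = K (x - P x)"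
    and "regular_part w x + (w - s\<^sub>0) *\<^sub>C K (regular_part w x) = K (x - P x)"
    and "regular_part w (P x) = 0" and "P (regular_part w x) = 0"
proof -
  have "regular_part w (x + (w - s\<^sub>0) *\<^sub>C K x) = K (x - P x) \<and>
    regular_part w x + (w - s\<^sub>0) *\<^sub>C K (regular_part w x) = K (x - P x) \<and>
    regular_part w (P x) = 0 \<and> P (regular_part w x) = 0"
  proof (cases "w = a")
    case True
    have "K (S x) + (a - s\<^sub>0) *\<^sub>C K (K (S x)) = K (T (S x))"
      by (simp add: T_apply lin_simps)
    then show ?thesis using True
      by (simp add: regular_part_def TS ST SP PS lin_simps flip: T_apply KP)
  next
    case False
    define B where "B = resolvent_op K (w - s\<^sub>0)"
    have B: "is_resolvent_op K (w - s\<^sub>0) B" using assms False by (simp add: B_def)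
    have Bw: "regular_part w y = B (y - P y)" for y
      using False by (simp add: regular_part_def B_def blinfun.diff_left)
    have PB: "P (B y) = B (P y)" for y
      by (rule is_resolvent_op_commute[OF K_clinear B P_clinear]) (simp add: KP)
    have "x + (w - s\<^sub>0) *\<^sub>C K x - P (x + (w - s\<^sub>0) *\<^sub>C K x) = (x - P x) + (w - s\<^sub>0) *\<^sub>C K (x - P x)"
      by (simp add: lin_simps KP cvec.scale_right_diff_distrib)
    then show ?thesis
      using is_resolvent_opD(2,3)[OF B, of "x - P x"] by (simp add: Bw PB lin_simps)
  qed
  then show "regular_part w (x + (w - s\<^sub>0) *\<^sub>C K x) = K (x - P x)"
    and "regular_part w x + (w - s\<^sub>0) *\<^sub>C K (regular_part w x) = K (x - P x)"
    and "regular_part w (P x) = 0" and "P (regular_part w x) = 0" by blast+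
qed

lemma regular_part_pseudo_resolvent:
  assumes v: "v = a \<or> is_resolvent_op K (v - s\<^sub>0) (resolvent_op K (v - s\<^sub>0))"
    and w: "w = a \<or> is_resolvent_op K (w - s\<^sub>0) (resolvent_op K (w - s\<^sub>0))"
  shows "regular_part v x - regular_part w x = (w - v) *\<^sub>C regular_part v (regular_part w x)"
proof -
  note hv = regular_part_props[OF v] and hw = regular_part_props[OF w]
  note h_lin = blinfun.add_right blinfun.diff_right clinear_opD[OF regular_part_clinear]
  \<comment> \<open>Preimage of \<open>x - P x\<close> under 1 + (w - s0) K; evaluating the regular
    part at \<open>v\<close> on \<open>x - P x\<close> in this form relates the two
    parameters.\<close>
  define u where "u = (x - P x) - (w - s\<^sub>0) *\<^sub>C regular_part w x"
  have Ku: "K u = regular_part w x"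
    using hw(2)[of x] by (simp add: u_def lin_simps algebra_simps)
  then have uK: "x - P x = u + (w - s\<^sub>0) *\<^sub>C K u" by (simp add: u_def)
  have "P u = 0" by (simp add: u_def lin_simps hw(4))
  have hvu: "regular_part v (u + (v - s\<^sub>0) *\<^sub>C K u) = K u"
    using hv(1)[of u] \<open>P u = 0\<close> by simp
  have arg: "u + (w - s\<^sub>0) *\<^sub>C K u = (u + (v - s\<^sub>0) *\<^sub>C K u) + (w - v) *\<^sub>C K u"
    by (simp add: cvec.scale_left_diff_distrib)
  have "regular_part v x = regular_part v (x - P x)" by (simp add: h_lin hv(3))
  also have "\<dots> = regular_part v ((u + (v - s\<^sub>0) *\<^sub>C K u) + (w - v) *\<^sub>C K u)"
    unfolding uK by (subst arg) (rule refl)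
  also have "\<dots> = K u + (w - v) *\<^sub>C regular_part v (K u)"
    by (subst blinfun.add_right) (simp only: hvu clinear_opD[OF regular_part_clinear])
  finally show ?thesis by (simp add: Ku)
qed

text \<open>Injectivity near \<open>a\<close> is checked on two pieces: on the kernel of
  \<open>P\<close>, applying \<open>S\<close> leaves only a small perturbation, and on the range of
  \<open>P\<close> a kernel vector would be an eigenvector of the nilpotent \<open>A\<close>. The
  resolvent identity then bounds the regular part by its value at the centre and makes it
  holomorphic.\<close>

lemma laurent_expansion:
  obtains e M where "e > 0" "holomorphic_op_on regular_part (ball a e)"
    "\<And>w. w \<in> ball a e \<Longrightarrow> norm (regular_part w) \<le> M"
    "\<And>w. w \<in> ball a e - {a} \<Longrightarrow> is_resolvent_op K (w - s\<^sub>0) (resolvent_op K (w - s\<^sub>0))"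
    "\<And>w. w \<in> ball a e - {a} \<Longrightarrow> resolvent_op K (w - s\<^sub>0) = laurent_sum a Apow n w + regular_part w"
proof -
  \<comment> \<open>Within radius \<open>1 / M\<close> the factor \<open>cmod (w - a)\<close> brings
    the norm of \<open>K o\<^sub>L S\<close> down to at most 1/2, for the norm bound by absorption,
    and that of \<open>S o\<^sub>L K\<close> below 1, for injectivity. The summand 1 keeps
    \<open>M\<close> positive.\<close>
  define M where "M = 2 * norm (K o\<^sub>L S) + 2 * norm (S o\<^sub>L K) + 1"
  define e where "e = 1 / M"
  have M: "M > 0" "2 * norm (K o\<^sub>L S) \<le> M" "2 * norm (S o\<^sub>L K) < M"
    using norm_ge_zero[of "K o\<^sub>L S"] norm_ge_zero[of "S o\<^sub>L K"] unfolding M_def by linarith+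
  have e: "e > 0" using M by (simp add: e_def)
  have small: "cmod (w - a) * norm (K o\<^sub>L S) \<le> 1 / 2" "cmod (w - a) * norm (S o\<^sub>L K) < 1"
    if "w \<in> ball a e" for w
  proof -
    have w: "cmod (w - a) \<le> e" using that by (simp add: dist_norm norm_minus_commute)
    have "cmod (w - a) * norm (K o\<^sub>L S) \<le> e * norm (K o\<^sub>L S)" using w by (intro mult_right_mono) auto
    also have "\<dots> \<le> 1 / 2" using M by (simp add: e_def divide_simps)
    finally show "cmod (w - a) * norm (K o\<^sub>L S) \<le> 1 / 2" .
    have "cmod (w - a) * norm (S o\<^sub>L K) \<le> e * norm (S o\<^sub>L K)" using w by (intro mult_right_mono) auto
    also have "\<dots> < 1" 
    proof -
      have "norm (S o\<^sub>L K) < M" using M(3) norm_ge_zero[of "S o\<^sub>L K"] by linarith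
      then show ?thesis using M(1) by (simp add: e_def)
    qed
    finally show "cmod (w - a) * norm (S o\<^sub>L K) < 1" .
  qed
  have res: "is_resolvent_op K (w - s\<^sub>0) (resolvent_op K (w - s\<^sub>0))" if w: "w \<in> ball a e - {a}" for w
  proof (rule is_resolvent_op_resolvent_op[OF compact])
    fix x assume x: "x + (w - s\<^sub>0) *\<^sub>C K x = 0"
    have "T x + (w - a) *\<^sub>C K x = x + (w - s\<^sub>0) *\<^sub>C K x"
      by (simp add: T_apply cvec.scale_left_diff_distrib)
    then have Tx: "T x + (w - a) *\<^sub>C K x = 0" using x by simp
    then have "S (T x) + (w - a) *\<^sub>C S (K x) = 0" by (metis lin_simps(1,3,7))
    then have 1: "x - P x = - ((w - a) *\<^sub>C (S o\<^sub>L K) (x - P x))"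
      by (simp add: ST lin_simps KP SP eq_neg_iff_add_eq_0)
    have "norm (x - P x) = cmod (w - a) * norm ((S o\<^sub>L K) (x - P x))"
      by (subst 1) (simp add: norm_scaleC)
    also have "\<dots> \<le> cmod (w - a) * (norm (S o\<^sub>L K) * norm (x - P x))"
      by (intro mult_left_mono norm_blinfun) simp
    finally have "norm (x - P x) \<le> (cmod (w - a) * norm (S o\<^sub>L K)) * norm (x - P x)" by (simp add: mult.assoc)
    then have "norm (x - P x) = 0"
      using small(2)[of w] w mult_strict_right_mono[of "cmod (w - a) * norm (S o\<^sub>L K)" 1 "norm (x - P x)"]
      by (cases "norm (x - P x) = 0") (auto simp: not_le)
    then have Px: "P x = x" by simp
    have "KinvP (x + (w - s\<^sub>0) *\<^sub>C K x) = KinvP x + (w - s\<^sub>0) *\<^sub>C P x"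
      by (simp add: blinfun.add_right clinear_opD[OF KinvP_clinear] KinvP_K)
    then have "KinvP x + (w - s\<^sub>0) *\<^sub>C P x = 0" unfolding x by (simp add: blinfun.zero_right)
    \<comment> \<open>Now \<open>x\<close> lies in the range of \<open>P\<close>; unless zero, it is
      an eigenvector of \<open>A\<close> for the nonzero number \<open>w - a\<close>.\<close>
    then have Ax: "A x = (w - a) *\<^sub>C x"
      by (simp add: A_apply Px cvec.scale_left_diff_distrib eq_neg_iff_add_eq_0[symmetric] algebra_simps)
    have "(blinfun_apply A ^^ k) x = (w - a) ^ k *\<^sub>C x" for k
      by (induction k) (simp_all add: clinear_opD[OF A_clinear] Ax mult.commute)
    moreover have "(blinfun_apply A ^^ n) x = 0" using Apow_eq_0[of n] Apow_apply[of n x] Px by simp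
    ultimately have "(w - a) ^ n *\<^sub>C x = 0" by metis
    then show "x = 0" using w by simp
  qed
  then have ok: "w = a \<or> is_resolvent_op K (w - s\<^sub>0) (resolvent_op K (w - s\<^sub>0))" if "w \<in> ball a e" for w
    using that by blast
  have bound: "norm (regular_part w) \<le> 2 * norm (K o\<^sub>L S)" if w: "w \<in> ball a e" for w
  proof -
    have ra: "regular_part a = K o\<^sub>L S" by (simp add: regular_part_def)
    have "regular_part w = regular_part a + scale_op (a - w) (regular_part w o\<^sub>L regular_part a)"
    proof (rule blinfun_eqI)
      fix x
      show "regular_part w x = (regular_part a + scale_op (a - w) (regular_part w o\<^sub>L regular_part a)) x"
        using regular_part_pseudo_resolvent[OF ok[OF w], of a x]
        by (simp add: blinfun.add_left scale_op_apply diff_eq_eq add.commute)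
    qed
    then have "norm (regular_part w) \<le> norm (K o\<^sub>L S) + norm (scale_op (a - w) (regular_part w o\<^sub>L (K o\<^sub>L S)))"
      using norm_triangle_ineq ra by metis
    also have "norm (scale_op (a - w) (regular_part w o\<^sub>L (K o\<^sub>L S)))
        \<le> cmod (a - w) * norm (regular_part w o\<^sub>L (K o\<^sub>L S))" by (rule norm_scale_op_le)
    also have "\<dots> \<le> cmod (a - w) * (norm (regular_part w) * norm (K o\<^sub>L S))"
      by (intro mult_left_mono norm_blinfun_compose) simp
    also have "\<dots> = (cmod (w - a) * norm (K o\<^sub>L S)) * norm (regular_part w)" by (simp add: norm_minus_commute)
    also have "\<dots> \<le> 1 / 2 * norm (regular_part w)" using small(1)[OF w] by (intro mult_right_mono) auto
    finally show ?thesis by simp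
  qed
  have "holomorphic_op_on regular_part (ball a e)"
  proof (rule pseudo_resolvent_holomorphic[where C = "2 * norm (K o\<^sub>L S)"])
    show "regular_part v x - regular_part w x = (w - v) *\<^sub>C regular_part v (regular_part w x)"
      if "v \<in> ball a e" "w \<in> ball a e" for v w x
      using regular_part_pseudo_resolvent ok that by blast
  qed (use bound regular_part_clinear in auto)
  moreover have "resolvent_op K (w - s\<^sub>0) = laurent_sum a Apow n w + regular_part w" if w: "w \<in> ball a e - {a}" for w
  proof (rule blinfun_eqI)
    fix x
    have "resolvent_op K (w - s\<^sub>0) x = resolvent_op K (w - s\<^sub>0) (P x) + regular_part w x"
      using w by (simp add: regular_part_def blinfun.diff_left blinfun.diff_right)
    then show "resolvent_op K (w - s\<^sub>0) x = (laurent_sum a Apow n w + regular_part w) x"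
      using resolvent_on_P[OF res[OF w]] w by (simp add: blinfun.add_left)
  qed
  ultimately show ?thesis using e bound res by (intro that)
qed

end

lemma riesz_point_exists:
  assumes "compact_op K"
  obtains P S n where "riesz_point K (id_blinfun + scale_op (a - s\<^sub>0) K) a s\<^sub>0 P S n"
proof -
  interpret compact_perturbation K "id_blinfun + scale_op (a - s\<^sub>0) K" "a - s\<^sub>0"
    by standard (simp_all add: assms blinfun.add_left scale_op_apply)
  obtain P S :: "'a \<Rightarrow>\<^sub>L 'a" and n where "clinear_op P" "clinear_op S"
    "\<And>x. P (P x) = P x" "\<And>x. (blinfun_apply (id_blinfun + scale_op (a - s\<^sub>0) K) ^^ n) (P x) = 0"
    "\<And>x. (id_blinfun + scale_op (a - s\<^sub>0) K) (S x) = x - P x"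
    "\<And>x. S ((id_blinfun + scale_op (a - s\<^sub>0) K) x) = x - P x" "\<And>x. S (P x) = 0"
    by (rule riesz_decomposition, rule that)
  then have "riesz_point K (id_blinfun + scale_op (a - s\<^sub>0) K) a s\<^sub>0 P S n"
    by unfold_locales
  then show ?thesis by (rule that)
qed

lemma resolvent_op_meromorphic:
  assumes K: "compact_op K"
  shows "meromorphic_op (\<lambda>w. resolvent_op K (w - s\<^sub>0))"
  unfolding meromorphic_op_def
proof (intro conjI allI clinear_resolvent_op)
  fix a
  obtain P S n where "riesz_point K (id_blinfun + scale_op (a - s\<^sub>0) K) a s\<^sub>0 P S n"
    using riesz_point_exists[OF K] by blast
  then interpret riesz_point K "id_blinfun + scale_op (a - s\<^sub>0) K" a s\<^sub>0 P S n .
  obtain e where e: "e > 0" "holomorphic_op_on regular_part (ball a e)"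
    "\<And>w. w \<in> ball a e - {a} \<Longrightarrow> resolvent_op K (w - s\<^sub>0) = laurent_sum a Apow n w + regular_part w"
    by (rule laurent_expansion, rule that)
  obtain g where g: "holomorphic_op_on g (ball a e)"
    "\<And>w. w \<in> ball a e - {a} \<Longrightarrow> laurent_sum a Apow n w + regular_part w = scale_op (1 / (w - a) ^ n) (g w)"
    by (rule laurent_meromorphic_form[OF e(2), where c = Apow and n = n], rule that)
  show "\<exists>n e g. e > 0 \<and> holomorphic_op_on g (ball a e) \<and>
      (\<forall>s\<in>ball a e - {a}. resolvent_op K (s - s\<^sub>0) = scale_op (1 / (s - a) ^ n) (g s))"
  proof (intro exI conjI ballI)
    fix w assume w: "w \<in> ball a e - {a}"
    show "resolvent_op K (w - s\<^sub>0) = scale_op (1 / (w - a) ^ n) (g w)"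
      by (rule trans[OF e(3)[OF w] g(2)[OF w]])
  qed (rule e g)+
qed

section \<open>The sandwiched resolvent\<close>

lemma csubspace_linear_operator:
  assumes "linear_operator G" shows "csubspace G"
  using assms by (auto simp: linear_operator_def csubspace_def scaleC_prod_def)

lemma adjI: "(\<And>x v. (x, v) \<in> G \<Longrightarrow> cinner y v = cinner w x) \<Longrightarrow> (y, w) \<in> adj G"
  unfolding adj_def by blast

lemma adjD: "(y, w) \<in> adj G \<Longrightarrow> (x, v) \<in> G \<Longrightarrow> cinner y v = cinner w x"
  unfolding adj_def by blast

lemma csubspace_Domain_adj: "csubspace (Domain (adj G))"
proof (rule csubspaceI)
  show "0 \<in> Domain (adj G)" by (rule DomainI[of _ 0], rule adjI) simp
next
  fix x y assume "x \<in> Domain (adj G)" "y \<in> Domain (adj G)"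
  then obtain v w where vw: "(x, v) \<in> adj G" "(y, w) \<in> adj G" by blast
  have "(x + y, v + w) \<in> adj G"
    by (rule adjI) (simp add: cinner_add_left adjD[OF vw(1)] adjD[OF vw(2)])
  then show "x + y \<in> Domain (adj G)" by blast
next
  fix c x assume "x \<in> Domain (adj G)"
  then obtain v where v: "(x, v) \<in> adj G" by blast
  have "(c *\<^sub>C x, c *\<^sub>C v) \<in> adj G" by (rule adjI) (simp add: adjD[OF v])
  then show "c *\<^sub>C x \<in> Domain (adj G)" by blast
qed

text \<open>
  A vector \<open>y\<close> orthogonal to the domain of the adjoint satisfies \<open>(0, y) \<in> G\<close>: the component
  of \<open>(0, y)\<close> orthogonal to the graph is, up to a rotation, an element of the adjoint graph.
\<close>

lemma densely_defined_adj:
  fixes G :: "('a::complex_hilbert \<times> 'b::complex_hilbert) set"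
  assumes lin: "linear_operator G" and cl: "closed G"
  shows "closure (Domain (adj G)) = UNIV"
proof (rule dense_if_orthogonal_trivial[OF csubspace_Domain_adj])
  fix y assume y: "\<And>v. v \<in> Domain (adj G) \<Longrightarrow> cinner v y = 0"
  note sub = csubspace_linear_operator[OF lin]
  obtain m where m: "m \<in> G" "\<And>u. u \<in> G \<Longrightarrow> cinner u ((0, y) - m) = 0"
    using orthogonal_projection[OF sub cl] by blast
  obtain m1 m2 where m12: "m = (m1, m2)" by (cases m)
  define q where "q = y - m2"
  have orth: "cinner v q = cinner x m1" if "(x, v) \<in> G" for x v
    using m(2)[OF that] by (simp add: cinner_prod_def m12 q_def)
  have "(q, m1) \<in> adj G"
  proof (rule adjI)
    fix x v assume "(x, v) \<in> G"
    from orth[OF this] show "cinner q v = cinner m1 x"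
      using cinner_commute[of q v] cinner_commute[of m1 x] by simp
  qed
  then have "cinner q y = 0" using y by blast
  then have "cinner y q = 0" using cinner_commute[of y q] by simp
  moreover have "cinner m2 q = cinner m1 m1" using orth m(1) m12 by simp
  moreover have "cinner q q = cinner y q - cinner m2 q"
    by (subst (1) q_def) (rule cinner_diff_left)
  ultimately have "cinner q q = - cinner m1 m1" by simp
  then have "complex_of_real ((norm q)\<^sup>2) = complex_of_real (- (norm m1)\<^sup>2)"
    unfolding cinner_self by simp
  then have "(norm q)\<^sup>2 = - (norm m1)\<^sup>2" by (simp only: of_real_eq_iff)
  then have "(norm q)\<^sup>2 = 0" "(norm m1)\<^sup>2 = 0"
    using zero_le_power2[of "norm q"] zero_le_power2[of "norm m1"] by linarith+
  then have "m = (0, y)" by (simp add: q_def m12)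
  then have "(0, y) \<in> G" using m(1) by simp
  moreover have "(0, 0) \<in> G" using csubspaceD(1)[OF sub] by (simp add: zero_prod_def)
  ultimately show "y = 0" using lin by (auto simp: linear_operator_def dest: single_valuedD)
qed

lemma closed_dense_UNIV: "closure S = UNIV \<Longrightarrow> closed C \<Longrightarrow> S \<subseteq> C \<Longrightarrow> x \<in> C"
  by (metis UNIV_I closure_minimal subsetD)

lemma blinfun_eq_on_dense:
  fixes A B :: "'a::real_normed_vector \<Rightarrow>\<^sub>L 'b::real_normed_vector"
  assumes "closure S = UNIV" "\<And>x. x \<in> S \<Longrightarrow> blinfun_apply A x = B x"
  shows "A = B"
proof (rule blinfun_eqI)
  fix x
  have "closed {x. A x = B x}" by (intro closed_Collect_eq continuous_intros)
  then show "A x = B x" using closed_dense_UNIV[OF assms(1), of "{x. A x = B x}" x] assms(2) by blast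
qed

lemma continuous_on_cinner:
  "continuous_on S f \<Longrightarrow> continuous_on S g \<Longrightarrow> continuous_on S (\<lambda>x. cinner (f x) (g x))"
  by (rule bounded_bilinear.continuous_on[OF bounded_bilinear_cinner])

lemma self_adjoint_symmetric:
  assumes "self_adjoint H" "(x, v) \<in> H" "(y, w) \<in> H"
  shows "cinner y v = cinner w x"
proof -
  have "(y, w) \<in> adj H" using assms by (simp add: self_adjoint_def)
  then show ?thesis using assms(2) by (rule adjD)
qed

locale sandwiched_resolvent =
  fixes F :: "('h::complex_hilbert \<times> 'k::complex_hilbert) set" and H :: "('h \<times> 'h) set"
  assumes F_linear: "linear_operator F" and F_closed: "closed F"
    and H_self_adjoint: "self_adjoint H" and Domain_H: "Domain H \<subseteq> Domain F"
    and resolvent_total: "\<And>z w. Im z \<noteq> 0 \<Longrightarrow> \<exists>g. (w, g) \<in> resolvent H z"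
    and compact_extension_exists: "\<And>z. Im z \<noteq> 0 \<Longrightarrow> \<exists>T. compact_extension (sandwich F H z) T"
begin

lemma resolvent_witness:
  assumes "Im z \<noteq> 0"
  obtains g h k where "(g, h) \<in> H" "w = h - z *\<^sub>C g" "(g, k) \<in> F"
proof -
  obtain g where "(w, g) \<in> resolvent H z" using resolvent_total[OF assms] by blast
  then obtain h where gh: "(g, h) \<in> H" "w = h - z *\<^sub>C g" by (auto simp: resolvent_def)
  moreover obtain k where "(g, k) \<in> F" using gh(1) Domain_H by blast
  ultimately show ?thesis using that by blast
qed

lemma sandwichI: "(x, h - z *\<^sub>C g) \<in> adj F \<Longrightarrow> (g, h) \<in> H \<Longrightarrow> (g, k) \<in> F \<Longrightarrow> (x, k) \<in> sandwich F H z"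
  unfolding sandwich_def resolvent_def by blast

text \<open>The sandwiched operator is defined on the whole dense domain of the adjoint of
  \<open>F\<close>, because the resolvent is total and its values lie in the domain of
  \<open>F\<close>. So a bounded extension is unique.\<close>

lemma Tz_compact_extension:
  assumes z: "Im z \<noteq> 0" shows "compact_extension (sandwich F H z) (Tz F H z)"
  unfolding Tz_def
proof (rule theI')
  obtain T where T: "compact_extension (sandwich F H z) T" using compact_extension_exists[OF z] by blast
  have "T' = T" if T': "compact_extension (sandwich F H z) T'" for T'
  proof (rule blinfun_eq_on_dense[OF densely_defined_adj[OF F_linear F_closed]])
    fix x assume "x \<in> Domain (adj F)"
    then obtain w where xw: "(x, w) \<in> adj F" by blast
    obtain g h k where g: "(g, h) \<in> H" "w = h - z *\<^sub>C g" "(g, k) \<in> F"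
      using resolvent_witness[OF z] by blast
    have "(x, k) \<in> sandwich F H z" using sandwichI[OF _ g(1,3)] xw g(2) by simp
    then show "T' x = T x" using T T' by (auto simp: compact_extension_def graph_of_def)
  qed
  with T show "\<exists>!T. compact_extension (sandwich F H z) T" by blast
qed

lemma Tz_compact: "Im z \<noteq> 0 \<Longrightarrow> compact_op (Tz F H z)"
  using Tz_compact_extension by (simp add: compact_extension_def)

lemma Tz_apply:
  assumes "Im z \<noteq> 0" "(x, h - z *\<^sub>C g) \<in> adj F" "(g, h) \<in> H" "(g, k) \<in> F"
  shows "Tz F H z x = k"
  using Tz_compact_extension[OF assms(1)] sandwichI[OF assms(2-4)]
  by (auto simp: compact_extension_def graph_of_def)

text \<open>For vectors in the domain of the adjoint of \<open>F\<close>, both sides reduce to inner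
  products with resolvent vectors, and the symmetry of \<open>H\<close> exchanges \<open>z\<close>
  with its conjugate. Density and continuity extend this in one argument at a time.\<close>

lemma Tz_adjoint:
  assumes z: "Im z \<noteq> 0"
  shows "cinner (Tz F H (cnj z) y) x = cinner y (Tz F H z x)"
proof -
  note dense = densely_defined_adj[OF F_linear F_closed]
  have z': "Im (cnj z) \<noteq> 0" using z by simp
  have core: "cinner (Tz F H (cnj z) y) x = cinner y (Tz F H z x)"
    if x: "x \<in> Domain (adj F)" and y: "y \<in> Domain (adj F)" for x y
  proof -
    obtain w where xw: "(x, w) \<in> adj F" using x by blast
    obtain w' where yw: "(y, w') \<in> adj F" using y by blast
    obtain g h k where g: "(g, h) \<in> H" "w = h - z *\<^sub>C g" "(g, k) \<in> F"
      using resolvent_witness[OF z] by blast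
    obtain g' h' k' where g': "(g', h') \<in> H" "w' = h' - cnj z *\<^sub>C g'" "(g', k') \<in> F"
      using resolvent_witness[OF z'] by blast
    have T: "Tz F H z x = k" "Tz F H (cnj z) y = k'"
      using Tz_apply[OF z _ g(1,3)] Tz_apply[OF z' _ g'(1,3)] xw yw g g' by auto
    have "cinner y k = cinner w' g" by (rule adjD[OF yw g(3)])
    also have "\<dots> = cinner h' g - z * cinner g' g" by (simp add: g' cinner_linear_simps)
    also have "cinner h' g = cinner g' h" using self_adjoint_symmetric[OF H_self_adjoint g(1) g'(1)] by simp
    also have "cinner g' h - z * cinner g' g = cinner g' w" by (simp add: g cinner_linear_simps)
    also have "\<dots> = cnj (cinner w g')" by (rule cinner_commute)
    also have "cinner w g' = cinner x k'" by (rule adjD[OF xw g'(3), symmetric])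
    also have "cnj (cinner x k') = cinner k' x" by (rule cinner_commute[symmetric])
    finally show ?thesis by (simp add: T)
  qed
  have *: "cinner (Tz F H (cnj z) y) x = cinner y (Tz F H z x)" if y: "y \<in> Domain (adj F)" for x y
  proof -
    have "closed {x. cinner (Tz F H (cnj z) y) x = cinner y (Tz F H z x)}"
      by (intro closed_Collect_eq continuous_on_cinner continuous_intros)
    then show ?thesis
      using closed_dense_UNIV[OF dense, of "{x. cinner (Tz F H (cnj z) y) x = cinner y (Tz F H z x)}" x] core y
      by blast
  qed
  have "closed {y. cinner (Tz F H (cnj z) y) x = cinner y (Tz F H z x)}"
    by (intro closed_Collect_eq continuous_on_cinner continuous_intros)
  then show ?thesis
    using closed_dense_UNIV[OF dense, of "{y. cinner (Tz F H (cnj z) y) x = cinner y (Tz F H z x)}" y] *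
    by blast
qed

text \<open>On the domain of the adjoint of \<open>F\<close> the form equals
  \<open>cinner h g - cnj z * cinner g g\<close> for the resolvent vector \<open>g\<close>. The
  first term is real, so the imaginary part is \<open>Im z\<close> times the square of
  \<open>norm g\<close>.\<close>

lemma Im_Tz_nonneg:
  assumes z: "Im z > 0"
  shows "0 \<le> Im (cinner x (Tz F H z x))"
proof -
  have z0: "Im z \<noteq> 0" using z by simp
  have "0 \<le> Im (cinner x (Tz F H z x))" if x: "x \<in> Domain (adj F)" for x
  proof -
    obtain w where xw: "(x, w) \<in> adj F" using x by blast
    obtain g h k where g: "(g, h) \<in> H" "w = h - z *\<^sub>C g" "(g, k) \<in> F"
      using resolvent_witness[OF z0] by blast
    have "Tz F H z x = k" using Tz_apply[OF z0 _ g(1,3)] xw g by auto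
    moreover have "cinner x k = cinner w g" by (rule adjD[OF xw g(3)])
    moreover have "cinner w g = cinner h g - cnj z * cinner g g" by (simp add: g cinner_linear_simps)
    moreover have "Im (cinner h g) = 0"
    proof -
      have "cinner h g = cinner g h" using self_adjoint_symmetric[OF H_self_adjoint g(1) g(1)] by simp
      then show ?thesis using cinner_commute[of h g] by (metis Im_complex_of_real Reals_cnj_iff complex_is_Real_iff)
    qed
    ultimately show ?thesis using z by (simp add: cinner_self)
  qed
  moreover have "closed {x. 0 \<le> Im (cinner x (Tz F H z x))}"
    by (intro closed_Collect_le continuous_on_cinner continuous_intros)
  ultimately show ?thesis
    using closed_dense_UNIV[OF densely_defined_adj[OF F_linear F_closed], of "{x. 0 \<le> Im (cinner x (Tz F H z x))}" x]
    by blast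
qed

end

section \<open>The line of operators and the second resolvent identity\<close>

locale resonance_line =
  fixes F :: "('h::complex_hilbert \<times> 'k::complex_hilbert) set"
    and J :: "'k \<Rightarrow>\<^sub>L 'k"
    and H\<^sub>0 V :: "('h \<times> 'h) set"
    and H :: "real \<Rightarrow> ('h \<times> 'h) set"
    and lam :: real
  assumes F_lin: "linear_operator F" and F_cl: "closed F"
    and J_self_adjoint: "selfadjoint_op J"
    and V_eq: "V = FJF F J"
    and H_eq: "H = line H\<^sub>0 V" and H_self_adjoint: "\<And>r. self_adjoint (H r)"
    and H_Domain: "\<And>r. Domain (H r) \<subseteq> Domain F"
    and V_rel_compact: "\<And>r. relatively_compact V (H r)"
    and T_compact: "\<And>r z. Im z \<noteq> 0 \<Longrightarrow> \<exists>T. compact_extension (sandwich F (H r) z) T"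
begin

sublocale sandwiched_resolvent F "H r" for r
proof
  show "\<exists>g. (w, g) \<in> resolvent (H r) z" if z: "Im z \<noteq> 0" for z w
  proof -
    \<comment> \<open>The composition with \<open>V\<close> is the graph of a bounded operator and
      has full domain, hence so does the resolvent.\<close>
    obtain T where "resolvent (H r) z O V = graph_of T"
      using V_rel_compact[of r] z unfolding relatively_compact_def by blast
    moreover have "(w, T w) \<in> graph_of T" for T :: "'h \<Rightarrow>\<^sub>L 'h" by (auto simp: graph_of_def)
    ultimately show ?thesis by blast
  qed
qed (use F_lin F_cl H_self_adjoint H_Domain T_compact in auto)

text \<open>The resolvent vector \<open>g\<close> of \<open>H r\<close> is corrected by
  \<open>r - s\<close> times the resolvent of \<open>H s\<close> applied to \<open>v\<close>, the
  value of \<open>V\<close> at \<open>g\<close>. By the factorisation of \<open>V\<close>, this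
  \<open>v\<close> is the image of \<open>J f\<close> under the adjoint of \<open>F\<close>, which
  brings in the middle factor \<open>J\<close>.\<close>

lemma Tz_identity:
  assumes z: "Im z \<noteq> 0"
  shows "Tz F (H s) z x = Tz F (H r) z x + (r - s) *\<^sub>R Tz F (H s) z (J (Tz F (H r) z x))"
proof -
  have "Tz F (H s) z = Tz F (H r) z + (r - s) *\<^sub>R (Tz F (H s) z o\<^sub>L J o\<^sub>L Tz F (H r) z)"
  proof (rule blinfun_eq_on_dense[OF densely_defined_adj[OF F_lin F_cl]])
    fix x assume "x \<in> Domain (adj F)"
    then obtain w where xw: "(x, w) \<in> adj F" by blast
    obtain g h k where g: "(g, h) \<in> H r" "w = h - z *\<^sub>C g" "(g, k) \<in> F"
      using resolvent_witness[OF z] by blast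
    obtain y v where yv: "(g, y) \<in> H\<^sub>0" "(g, v) \<in> V" "h = y + r *\<^sub>R v"
      using g(1) by (auto simp: H_eq line_def)
    obtain f where f: "(g, f) \<in> F" "(J f, v) \<in> adj F"
      using yv(2) by (auto simp: V_eq FJF_def graph_of_def)
    have "k = f" using g(3) f(1) F_lin by (auto simp: linear_operator_def dest: single_valuedD)
    have Tr: "Tz F (H r) z x = f"
      using Tz_apply[OF z _ g(1,3)] xw g \<open>k = f\<close> by auto
    have gs: "(g, y + s *\<^sub>R v) \<in> H s" using yv by (auto simp: H_eq line_def)
    obtain g' h' k' where g': "(g', h') \<in> H s" "v = h' - z *\<^sub>C g'" "(g', k') \<in> F"
      using resolvent_witness[OF z] by blast
    have Ts: "Tz F (H s) z (J f) = k'"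
      using Tz_apply[OF z _ g'(1,3)] f(2) g'(2) by auto
    have Hs: "csubspace (H s)" and Fs: "csubspace F"
      using H_self_adjoint F_lin by (auto simp: self_adjoint_def csubspace_linear_operator)
    have "(g, y + s *\<^sub>R v) + (r - s) *\<^sub>R (g', h') \<in> H s"
      using gs g'(1) Hs by (intro csubspaceD) auto
    then have "(g + (r - s) *\<^sub>R g', y + s *\<^sub>R v + (r - s) *\<^sub>R h') \<in> H s" by simp
    moreover have "(g, f) + (r - s) *\<^sub>R (g', k') \<in> F"
      using f(1) g'(3) Fs by (intro csubspaceD) auto
    then have "(g + (r - s) *\<^sub>R g', f + (r - s) *\<^sub>R k') \<in> F" by simp
    moreover have "w = (y + s *\<^sub>R v + (r - s) *\<^sub>R h') - z *\<^sub>C (g + (r - s) *\<^sub>R g')"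
    proof -
      have "(r - s) *\<^sub>R v = (r - s) *\<^sub>R h' - z *\<^sub>C (r - s) *\<^sub>R g'"
        by (simp add: g'(2) scaleR_diff_right scaleC_scaleR)
      then show ?thesis by (simp add: g(2) yv(3) cvec.scale_right_distrib scaleR_left_diff_distrib algebra_simps)
    qed
    ultimately have "Tz F (H s) z x = f + (r - s) *\<^sub>R k'"
      using xw by (intro Tz_apply[OF z]) auto
    then show "Tz F (H s) z x = (Tz F (H r) z + (r - s) *\<^sub>R (Tz F (H s) z o\<^sub>L J o\<^sub>L Tz F (H r) z)) x"
      by (simp add: blinfun.bilinear_simps Tr Ts)
  qed
  then have "Tz F (H s) z x = (Tz F (H r) z + (r - s) *\<^sub>R (Tz F (H s) z o\<^sub>L J o\<^sub>L Tz F (H r) z)) x"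
    by simp
  then show ?thesis by (simp add: blinfun.bilinear_simps)
qed

subsection \<open>Boundary values\<close>

lemma T_bd_tendsto:
  assumes "nonresonant F H lam s"
  shows "((\<lambda>y. Tz F (H s) (approach \<sigma> lam y)) \<longlongrightarrow> T_bd F (H s) \<sigma> lam) (at_right 0)"
proof -
  obtain L where L: "((\<lambda>y. Tz F (H s) (approach \<sigma> lam y)) \<longlongrightarrow> L) (at_right 0)"
    using assms unfolding nonresonant_def Lambda_def by blast
  then have "T_bd F (H s) \<sigma> lam = L" unfolding T_bd_def by (intro tendsto_Lim) simp_all
  with L show ?thesis by simp
qed

lemma eventually_approach: "\<forall>\<^sub>F y in at_right 0. Im (approach \<sigma> lam y) \<noteq> 0"
  using eventually_at_right_less[of "0::real"]
  by eventually_elim (cases \<sigma>, auto simp: approach_def)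

lemma J_clinear: "clinear_op J" and J_symmetric: "cinner (J x) y = cinner x (J y)"
  using J_self_adjoint by (auto simp: selfadjoint_op_def)

lemma T_bd_compact:
  assumes "nonresonant F H lam s" shows "compact_op (T_bd F (H s) \<sigma> lam)"
proof (rule compact_op_limit[OF T_bd_tendsto[OF assms]])
  show "\<forall>\<^sub>F y in at_right 0. compact_op (Tz F (H s) (approach \<sigma> lam y))"
    using eventually_approach by eventually_elim (rule Tz_compact)
qed simp

lemma T_bd_adjoint:
  assumes "nonresonant F H lam s"
  shows "cinner (T_bd F (H s) Lower lam y) x = cinner y (T_bd F (H s) Upper lam x)"
proof (rule tendsto_unique[of "at_right (0::real)"])
  show "((\<lambda>t. cinner (Tz F (H s) (approach Lower lam t) y) x) \<longlongrightarrow> cinner (T_bd F (H s) Lower lam y) x) (at_right 0)"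
    by (intro tendsto_cinner blinfun.tendsto T_bd_tendsto assms tendsto_const)
  have "((\<lambda>t. cinner y (Tz F (H s) (approach Upper lam t) x)) \<longlongrightarrow> cinner y (T_bd F (H s) Upper lam x)) (at_right 0)"
    by (intro tendsto_cinner blinfun.tendsto T_bd_tendsto assms tendsto_const)
  then show "((\<lambda>t. cinner (Tz F (H s) (approach Lower lam t) y) x) \<longlongrightarrow> cinner y (T_bd F (H s) Upper lam x)) (at_right 0)"
  proof (rule Lim_transform_eventually)
    show "\<forall>\<^sub>F t in at_right 0. cinner y (Tz F (H s) (approach Upper lam t) x)
        = cinner (Tz F (H s) (approach Lower lam t) y) x"
      using eventually_approach[of Upper]
    proof eventually_elim
      case (elim t)
      have "approach Lower lam t = cnj (approach Upper lam t)" by (simp add: approach_def complex_eq_iff)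
      then show ?case using Tz_adjoint[OF elim] by simp
    qed
  qed
qed simp

lemma T_bd_positive:
  assumes "nonresonant F H lam s"
  shows "0 \<le> Im (cinner x (T_bd F (H s) Upper lam x))"
proof (rule tendsto_lowerbound)
  show "((\<lambda>t. Im (cinner x (Tz F (H s) (approach Upper lam t) x))) \<longlongrightarrow> Im (cinner x (T_bd F (H s) Upper lam x))) (at_right 0)"
    by (intro tendsto_Im tendsto_cinner blinfun.tendsto T_bd_tendsto assms tendsto_const)
  show "\<forall>\<^sub>F t in at_right 0. 0 \<le> Im (cinner x (Tz F (H s) (approach Upper lam t) x))"
    using eventually_at_right_less[of "0::real"]
    by eventually_elim (rule Im_Tz_nonneg, simp add: approach_def)
qed simp

lemma T_bd_identity:
  assumes s: "nonresonant F H lam s" and r: "nonresonant F H lam r"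
  shows "T_bd F (H s) \<sigma> lam x = T_bd F (H r) \<sigma> lam x
    + (r - s) *\<^sub>R T_bd F (H s) \<sigma> lam (J (T_bd F (H r) \<sigma> lam x))"
proof (rule tendsto_unique[of "at_right (0::real)"])
  show "((\<lambda>t. Tz F (H s) (approach \<sigma> lam t) x) \<longlongrightarrow> T_bd F (H s) \<sigma> lam x) (at_right 0)"
    by (intro blinfun.tendsto T_bd_tendsto s tendsto_const)
  have "((\<lambda>t. Tz F (H r) (approach \<sigma> lam t) x + (r - s) *\<^sub>R Tz F (H s) (approach \<sigma> lam t) (J (Tz F (H r) (approach \<sigma> lam t) x)))
    \<longlongrightarrow> T_bd F (H r) \<sigma> lam x + (r - s) *\<^sub>R T_bd F (H s) \<sigma> lam (J (T_bd F (H r) \<sigma> lam x))) (at_right 0)"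
    by (intro tendsto_intros blinfun.tendsto T_bd_tendsto s r)
  then show "((\<lambda>t. Tz F (H s) (approach \<sigma> lam t) x)
    \<longlongrightarrow> T_bd F (H r) \<sigma> lam x + (r - s) *\<^sub>R T_bd F (H s) \<sigma> lam (J (T_bd F (H r) \<sigma> lam x))) (at_right 0)"
    by (rule Lim_transform_eventually)
      (use eventually_approach in eventually_elim, rule Tz_identity[symmetric])
qed simp

lemma A_bd_compact: "nonresonant F H lam s \<Longrightarrow> compact_op (A_bd F J H \<sigma> lam s)"
  unfolding A_bd_def by (intro compact_op_comp_right T_bd_compact J_clinear)

text \<open>With \<open>K\<close> the operator at \<open>r\<close>, the resolvent identity taken in
  both orders of \<open>s\<close> and \<open>r\<close> and composed with \<open>J\<close> gives the
  two defining equations of K (1 + (s - r) K)^-1.\<close>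

lemma A_bd_is_resolvent_op:
  assumes s: "nonresonant F H lam s" and r: "nonresonant F H lam r"
  shows "is_resolvent_op (A_bd F J H \<sigma> lam r) (of_real s - of_real r) (A_bd F J H \<sigma> lam s)"
proof -
  have c: "(of_real s - of_real r) *\<^sub>C x = (s - r) *\<^sub>R x" for x :: 'k
    by (simp flip: scaleC_of_real)
  have cl: "clinear_op (A_bd F J H \<sigma> lam s)" by (rule compact_op_clinear[OF A_bd_compact[OF s]])
  show ?thesis
    unfolding is_resolvent_op_def c
  proof (intro conjI allI cl)
    fix x
    show "A_bd F J H \<sigma> lam s (x + (s - r) *\<^sub>R A_bd F J H \<sigma> lam r x) = A_bd F J H \<sigma> lam r x"
    proof -
      have "(r - s) *\<^sub>R v = - ((s - r) *\<^sub>R v)" for v :: 'k by (simp flip: scaleR_minus_left)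
      then show ?thesis
        using T_bd_identity[OF s r, of \<sigma> "J x"] by (simp add: A_bd_def blinfun.add_right blinfun.scaleR_right)
    qed
    show "A_bd F J H \<sigma> lam s x + (s - r) *\<^sub>R A_bd F J H \<sigma> lam r (A_bd F J H \<sigma> lam s x) = A_bd F J H \<sigma> lam r x"
      using T_bd_identity[OF r s, of \<sigma> "J x"] by (simp add: A_bd_def)
  qed
qed

text \<open>
  If \<open>1 + (r - s) A(s)\<close> is invertible on both sides, the resolvent identity can be solved for
  \<open>T\<^sub>z(H\<^sub>r)\<close> uniformly up to the real axis.
\<close>

lemma nonresonant_if_injective:
  assumes s: "nonresonant F H lam s"
    and inj: "\<And>\<sigma> x. x + (of_real r - of_real s) *\<^sub>C A_bd F J H \<sigma> lam s x = 0 \<Longrightarrow> x = 0"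
  shows "nonresonant F H lam r"
proof -
  have "\<exists>L. ((\<lambda>y. Tz F (H r) (approach \<sigma> lam y)) \<longlongrightarrow> L) (at_right 0)" for \<sigma>
  proof -
    define T where "T = T_bd F (H s) \<sigma> lam"
    define Ty where "Ty y = Tz F (H s) (approach \<sigma> lam y)" for y
    define X where "X y = Tz F (H r) (approach \<sigma> lam y)" for y
    define M where "M = id_blinfun + (r - s) *\<^sub>R (T o\<^sub>L J)"
    have c: "(of_real r - of_real s) *\<^sub>C x = (r - s) *\<^sub>R x" for x :: 'k
      by (simp flip: scaleC_of_real)
    have M: "M x = x + (r - s) *\<^sub>R T (J x)" for x by (simp add: M_def blinfun.bilinear_simps)
    interpret compact_perturbation "A_bd F J H \<sigma> lam s" M "of_real r - of_real s"
    proof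
      show "compact_op (A_bd F J H \<sigma> lam s)" by (rule A_bd_compact[OF s])
      show "M x = x + (of_real r - of_real s) *\<^sub>C A_bd F J H \<sigma> lam s x" for x
        by (simp add: M c A_bd_def T_def)
    qed
    obtain B :: "'k \<Rightarrow>\<^sub>L 'k" where B: "\<And>x. B (M x) = x"
      using fredholm_alternative inj[of _ \<sigma>] by (metis T_apply)
    have Ty_lim: "(Ty \<longlongrightarrow> T) (at_right 0)" unfolding Ty_def T_def by (rule T_bd_tendsto[OF s])
    \<comment> \<open>Solving for \<open>X\<close> leaves an error \<open>E y\<close> times
      \<open>X y\<close>. Since \<open>E\<close> tends to 0, \<open>X\<close> is first seen to be
      bounded; then the error vanishes in the limit and \<open>X\<close> converges to
      \<open>B o\<^sub>L T\<close>.\<close>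
    define E where "E y = (r - s) *\<^sub>R (B o\<^sub>L ((Ty y - T) o\<^sub>L J))" for y
    have X_eq: "\<forall>\<^sub>F y in at_right 0. X y = (B o\<^sub>L Ty y) - (E y o\<^sub>L X y)"
      using eventually_approach[of \<sigma>]
    proof eventually_elim
      case (elim y)
      show ?case
      proof (rule blinfun_eqI)
        fix x
        have "M (X y x) = Ty y x - (r - s) *\<^sub>R (Ty y - T) (J (X y x))"
          using Tz_identity[OF elim, of s x r] unfolding M X_def[symmetric] Ty_def[symmetric]
          by (simp add: blinfun.diff_left scaleR_diff_right)
        then have "B (M (X y x)) = B (Ty y x) - (r - s) *\<^sub>R B ((Ty y - T) (J (X y x)))"
          by (simp add: blinfun.diff_right blinfun.scaleR_right)
        then show "X y x = ((B o\<^sub>L Ty y) - (E y o\<^sub>L X y)) x"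
          by (simp add: B E_def blinfun.diff_left blinfun.scaleR_left)
      qed
    qed
    have BT: "((\<lambda>y. B o\<^sub>L Ty y) \<longlongrightarrow> B o\<^sub>L T) (at_right 0)"
      by (intro bounded_bilinear.tendsto[OF bounded_bilinear_blinfun_compose] tendsto_const Ty_lim)
    have "(E \<longlongrightarrow> (r - s) *\<^sub>R (B o\<^sub>L ((T - T) o\<^sub>L J))) (at_right 0)"
      unfolding E_def
      by (intro tendsto_intros bounded_bilinear.tendsto[OF bounded_bilinear_blinfun_compose] Ty_lim)
    moreover have "(r - s) *\<^sub>R (B o\<^sub>L ((T - T) o\<^sub>L J)) = 0"
      by (rule blinfun_eqI) (simp add: blinfun.bilinear_simps)
    ultimately have E_lim: "(E \<longlongrightarrow> 0) (at_right 0)" by simp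
    have "\<forall>\<^sub>F y in at_right 0. norm (B o\<^sub>L Ty y) < norm (B o\<^sub>L T) + 1"
      by (rule order_tendstoD(2)[OF tendsto_norm[OF BT]]) simp
    moreover have "\<forall>\<^sub>F y in at_right 0. norm (E y) < 1 / 2"
      by (rule order_tendstoD(2)[OF tendsto_norm[OF E_lim]]) simp
    ultimately have X_bd: "\<forall>\<^sub>F y in at_right 0. norm (X y) \<le> 2 * (norm (B o\<^sub>L T) + 1)"
      using X_eq
    proof eventually_elim
      case (elim y)
      have "norm (X y) \<le> norm (B o\<^sub>L Ty y) + norm (E y o\<^sub>L X y)"
        using norm_triangle_ineq4[of "B o\<^sub>L Ty y" "E y o\<^sub>L X y"] elim(3) by simp
      also have "norm (E y o\<^sub>L X y) \<le> 1 / 2 * norm (X y)"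
        using elim(2) by (intro order_trans[OF norm_blinfun_compose] mult_right_mono) auto
      finally show ?case using elim(1) by simp
    qed
    have "((\<lambda>y. E y o\<^sub>L X y) \<longlongrightarrow> 0) (at_right 0)"
    proof (rule Lim_null_comparison)
      show "\<forall>\<^sub>F y in at_right 0. norm (E y o\<^sub>L X y) \<le> norm (E y) * (2 * (norm (B o\<^sub>L T) + 1))"
        using X_bd by eventually_elim (intro order_trans[OF norm_blinfun_compose] mult_left_mono, auto)
      show "((\<lambda>y. norm (E y) * (2 * (norm (B o\<^sub>L T) + 1))) \<longlongrightarrow> 0) (at_right 0)"
        by (intro tendsto_mult_left_zero tendsto_norm_zero E_lim)
    qed
    then have "((\<lambda>y. (B o\<^sub>L Ty y) - (E y o\<^sub>L X y)) \<longlongrightarrow> (B o\<^sub>L T) - 0) (at_right 0)"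
      by (intro tendsto_diff BT)
    then have "(X \<longlongrightarrow> (B o\<^sub>L T) - 0) (at_right 0)"
      by (rule Lim_transform_eventually) (use X_eq in eventually_elim, simp)
    then show ?thesis unfolding X_def by blast
  qed
  then show ?thesis by (simp add: nonresonant_def Lambda_def)
qed

end

section \<open>Resonance vectors\<close>

lemma laurent_sum_extend:
  assumes "\<And>j. n \<le> j \<Longrightarrow> c j = 0" "n \<le> m"
  shows "laurent_sum a c m w = laurent_sum a c n w"
  unfolding laurent_sum_def
  by (rule sum.mono_neutral_right) (use assms in auto)

lemma laurent_sum_apply: "laurent_sum a c n w x = (\<Sum>j<n. (1 / (w - a) ^ Suc j) *\<^sub>C c j x)"
  by (simp add: laurent_sum_def blinfun.sum_left scale_op_apply)

text \<open>In the inductive step, multiplication by \<open>t ^ Suc n\<close> makes the sum tend to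
  its top coefficient \<open>c n\<close> as \<open>t\<close> decreases to 0, while boundedness
  forces the limit 0; the lower coefficients follow by induction.\<close>

lemma bounded_principal_part_eq_0:
  fixes c :: "nat \<Rightarrow> complex"
  assumes e: "e > 0"
    and bd: "\<And>t::real. 0 < t \<Longrightarrow> t < e \<Longrightarrow> cmod (\<Sum>j<n. 1 / of_real t ^ Suc j * c j) \<le> M"
  shows "j < n \<Longrightarrow> c j = 0"
  using bd
proof (induction n)
  case (Suc n)
  have lim1: "((\<lambda>t. \<Sum>j<Suc n. of_real t ^ (n - j) * c j) \<longlongrightarrow> (\<Sum>j<Suc n. of_real 0 ^ (n - j) * c j)) (at_right (0::real))"
    by (intro tendsto_intros)
  have "(\<Sum>j<n. (0::complex) ^ (n - j) * c j) = 0" by (rule sum.neutral) auto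
  then have val: "(\<Sum>j<Suc n. complex_of_real 0 ^ (n - j) * c j) = c n" by simp
  have "((\<lambda>t. \<Sum>j<Suc n. of_real t ^ (n - j) * c j) \<longlongrightarrow> 0) (at_right (0::real))"
  proof (rule Lim_null_comparison)
    have "\<forall>\<^sub>F t in at_right 0. t \<in> {0<..<e}" by (rule eventually_at_right_real[OF e])
    then show "\<forall>\<^sub>F t in at_right 0. cmod (\<Sum>j<Suc n. of_real t ^ (n - j) * c j) \<le> t ^ Suc n * M"
    proof eventually_elim
      case (elim t)
      have "(\<Sum>j<Suc n. of_real t ^ (n - j) * c j) = of_real t ^ Suc n * (\<Sum>j<Suc n. 1 / of_real t ^ Suc j * c j)"
        unfolding sum_distrib_left
      proof (rule sum.cong)
        fix j assume "j \<in> {..<Suc n}"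
        then have "of_real t ^ Suc n = (of_real t ^ (n - j) * of_real t ^ Suc j :: complex)"
          by (simp flip: power_add power_Suc)
        then show "of_real t ^ (n - j) * c j = of_real t ^ Suc n * (1 / of_real t ^ Suc j * c j)"
          using elim by simp
      qed simp
      then have "cmod (\<Sum>j<Suc n. of_real t ^ (n - j) * c j)
          = t ^ Suc n * cmod (\<Sum>j<Suc n. 1 / of_real t ^ Suc j * c j)"
        using elim by (simp add: norm_mult norm_power del: sum.lessThan_Suc power_Suc)
      also have "\<dots> \<le> t ^ Suc n * M" using elim Suc.prems(2)[of t] by (intro mult_left_mono) auto
      finally show ?case .
    qed
    have "((\<lambda>t. t ^ Suc n * M) \<longlongrightarrow> 0 ^ Suc n * M) (at_right (0::real))" by (intro tendsto_intros)
    then show "((\<lambda>t. t ^ Suc n * M) \<longlongrightarrow> 0) (at_right (0::real))" by simp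
  qed
  then have cn: "c n = 0" using tendsto_unique[OF _ lim1] unfolding val by simp
  show ?case
  proof (cases "j = n")
    case False
    then have "j < n" using Suc.prems(1) by simp
    then show ?thesis by (rule Suc.IH) (use Suc.prems(2) cn in simp)
  qed (simp add: cn)
qed simp

locale resonance = resonance_line F J H\<^sub>0 V H lam
  for F :: "('h::complex_hilbert \<times> 'k::complex_hilbert) set" and J :: "'k \<Rightarrow>\<^sub>L 'k"
    and H\<^sub>0 V :: "('h \<times> 'h) set" and H :: "real \<Rightarrow> ('h \<times> 'h) set" and lam :: real +
  fixes r\<^sub>0 :: real
  assumes lam: "lam \<in> Lambda_line F H" and resonant: "\<not> nonresonant F H lam r\<^sub>0"
begin

abbreviation Z where "Z \<equiv> nonresonant F H lam"
abbreviation A where "A \<equiv> A_bd F J H"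

text \<open>The operator form of \<open>A_res_pow\<close>, to which norms and linear functionals on
  operators apply.\<close>

definition R :: "side \<Rightarrow> nat \<Rightarrow> 'k \<Rightarrow>\<^sub>L 'k" where
  "R \<sigma> j = ((o\<^sub>L) (A_res F J H \<sigma> lam r\<^sub>0) ^^ j) (P_res F J H \<sigma> lam r\<^sub>0)"

lemma nonresonant_exists: "\<exists>s. Z s"
  using lam by (auto simp: Lambda_line_def nonresonant_def)

lemma A_clinear: "Z s \<Longrightarrow> clinear_op (A \<sigma> lam s)"
  by (rule compact_op_clinear[OF A_bd_compact])

text \<open>The resolvent family based at one non-resonant \<open>s\<^sub>0\<close> is an admissible
  extension, so the choice defining \<open>A_mer\<close> has a witness.\<close>

lemma A_mer: "meromorphic_op (A_mer F J H \<sigma> lam)" "Z s \<Longrightarrow> A_mer F J H \<sigma> lam (of_real s) = A \<sigma> lam s"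
proof -
  obtain s\<^sub>0 where s0: "Z s\<^sub>0" using nonresonant_exists by blast
  let ?P = "\<lambda>f. meromorphic_op f \<and> (\<forall>s. Z s \<longrightarrow> f (of_real s) = A \<sigma> lam s)"
  have "?P (\<lambda>w. resolvent_op (A \<sigma> lam s\<^sub>0) (w - of_real s\<^sub>0))"
    using resolvent_op_meromorphic[OF A_bd_compact[OF s0]]
      resolvent_op_eq[OF A_clinear[OF s0] A_bd_is_resolvent_op[OF _ s0]] by auto
  then have "?P (A_mer F J H \<sigma> lam)" unfolding A_mer_def by (rule someI[where P = ?P])
  then show "meromorphic_op (A_mer F J H \<sigma> lam)" "Z s \<Longrightarrow> A_mer F J H \<sigma> lam (of_real s) = A \<sigma> lam s"
    by blast+
qed

lemma riesz_point_at:
  assumes "Z s"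
  obtains T P S n where "riesz_point (A \<sigma> lam s) T (of_real r\<^sub>0) (of_real s) P S n"
  using riesz_point_exists[OF A_bd_compact[OF assms]] by metis

text \<open>The Laurent disc of each side contains no other singular parameter, so 1 + (t - s) A(s)
  is injective on both sides for real \<open>t\<close> in the smaller disc, \<open>r\<^sub>0\<close>
  excepted. This supplies the real values from which the identity theorem starts.\<close>

lemma punctured_nonresonant:
  obtains e where "e > 0" "\<And>t. t \<noteq> r\<^sub>0 \<Longrightarrow> \<bar>t - r\<^sub>0\<bar> < e \<Longrightarrow> Z t"
proof -
  obtain s where s: "Z s" using nonresonant_exists by blast
  have "\<exists>e>0. \<forall>t x. t \<noteq> r\<^sub>0 \<longrightarrow> \<bar>t - r\<^sub>0\<bar> < e \<longrightarrow> x + (of_real t - of_real s) *\<^sub>C A \<sigma> lam s x = 0 \<longrightarrow> x = 0" for \<sigma>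
  proof -
    obtain T P S n where "riesz_point (A \<sigma> lam s) T (of_real r\<^sub>0) (of_real s) P S n"
      by (rule riesz_point_at[OF s])
    then interpret rp: riesz_point "A \<sigma> lam s" T "of_real r\<^sub>0" "of_real s" P S n .
    obtain e where e: "e > 0"
      "\<And>w. w \<in> ball (of_real r\<^sub>0) e - {of_real r\<^sub>0} \<Longrightarrow>
        is_resolvent_op (A \<sigma> lam s) (w - of_real s) (resolvent_op (A \<sigma> lam s) (w - of_real s))"
      by (rule rp.laurent_expansion, rule that)
    show ?thesis
    proof (intro exI[of _ e] conjI allI impI e(1))
      fix t x assume t: "t \<noteq> r\<^sub>0" "\<bar>t - r\<^sub>0\<bar> < e" and x: "x + (of_real t - of_real s) *\<^sub>C A \<sigma> lam s x = 0"
      have "complex_of_real t \<in> ball (of_real r\<^sub>0) e - {of_real r\<^sub>0}"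
        using t by (simp add: dist_of_real dist_real_def abs_minus_commute)
      note B = e(2)[OF this]
      have "A \<sigma> lam s x = 0" using is_resolvent_opD(2)[OF B, of x] x by (simp add: blinfun.zero_right)
      then show "x = 0" using x by simp
    qed
  qed
  then obtain e where e: "\<And>\<sigma>. e \<sigma> > 0" "\<And>\<sigma> t x. t \<noteq> r\<^sub>0 \<Longrightarrow> \<bar>t - r\<^sub>0\<bar> < e \<sigma> \<Longrightarrow>
      x + (of_real t - of_real s) *\<^sub>C A \<sigma> lam s x = 0 \<Longrightarrow> x = 0" by metis
  define e' where "e' = min (e Upper) (e Lower)"
  have le: "e' \<le> e \<sigma>" for \<sigma> by (cases \<sigma>) (simp_all add: e'_def)
  show ?thesis
  proof (rule that)
    show "e' > 0" using e(1) by (simp add: e'_def)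
    fix t assume t: "t \<noteq> r\<^sub>0" "\<bar>t - r\<^sub>0\<bar> < e'"
    show "Z t"
    proof (rule nonresonant_if_injective[OF s])
      fix \<sigma> x assume "x + (complex_of_real t - of_real s) *\<^sub>C A \<sigma> lam s x = 0"
      then show "x = 0" using e(2)[of t \<sigma> x] t le[of \<sigma>] by simp
    qed
  qed
qed

text \<open>Identifies the coefficients defined by contour integrals with the algebraic ones: the
  expansion holds at real points near \<open>r\<^sub>0\<close>, extends to a complex punctured disc,
  and its residues are then read off.\<close>

lemma R_eq_Apow:
  assumes s: "Z s" and rp: "riesz_point (A \<sigma> lam s) T (of_real r\<^sub>0) (of_real s) P S n"
  shows "R \<sigma> = riesz_point.Apow T (of_real r\<^sub>0) (of_real s) P n"
    and "A_res_pow F J H \<sigma> lam r\<^sub>0 j = blinfun_apply (R \<sigma> j)"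
proof -
  interpret rp: riesz_point "A \<sigma> lam s" T "of_real r\<^sub>0" "of_real s" P S n by (rule rp)
  let ?a = "complex_of_real r\<^sub>0"
  obtain e M where e: "e > 0" "holomorphic_op_on rp.regular_part (ball ?a e)"
    "\<And>w. w \<in> ball ?a e - {?a} \<Longrightarrow> resolvent_op (A \<sigma> lam s) (w - of_real s) = laurent_sum ?a rp.Apow n w + rp.regular_part w"
    by (rule rp.laurent_expansion, rule that)
  obtain g where g: "holomorphic_op_on g (ball ?a e)"
    "\<And>w. w \<in> ball ?a e - {?a} \<Longrightarrow> laurent_sum ?a rp.Apow n w + rp.regular_part w = scale_op (1 / (w - ?a) ^ n) (g w)"
    by (rule laurent_meromorphic_form[OF e(2), where c = rp.Apow and n = n], rule that)
  obtain e1 where e1: "e1 > 0" "\<And>t. t \<noteq> r\<^sub>0 \<Longrightarrow> \<bar>t - r\<^sub>0\<bar> < e1 \<Longrightarrow> Z t"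
    by (rule punctured_nonresonant, rule that)
  define e2 where "e2 = min e e1"
  have e2: "e2 > 0" "e2 \<le> e" "e2 \<le> e1" using e(1) e1(1) by (auto simp: e2_def)
  have real: "A_mer F J H \<sigma> lam (of_real t) = scale_op (1 / (of_real t - ?a) ^ n) (g (of_real t))"
    if t: "t \<noteq> r\<^sub>0" "\<bar>t - r\<^sub>0\<bar> < e2" for t
  proof -
    have Zt: "Z t" using t e2 e1(2) by simp
    have w: "complex_of_real t \<in> ball ?a e - {?a}"
      using t e2 by (simp add: dist_of_real dist_real_def abs_minus_commute)
    have "A_mer F J H \<sigma> lam (of_real t) = A \<sigma> lam t" by (rule A_mer(2)[OF Zt])
    also have "\<dots> = resolvent_op (A \<sigma> lam s) (of_real t - of_real s)"
      by (rule resolvent_op_eq[OF A_clinear[OF s] A_bd_is_resolvent_op[OF Zt s], symmetric])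
    finally show ?thesis unfolding e(3)[OF w] g(2)[OF w] .
  qed
  obtain e3 where e3: "e3 > 0" "e3 \<le> e2"
    "\<And>w. w \<in> ball ?a e3 - {?a} \<Longrightarrow> A_mer F J H \<sigma> lam w = scale_op (1 / (w - ?a) ^ n) (g w)"
    by (rule meromorphic_op_identity[OF A_mer(1) e2(1) holomorphic_op_on_subset[OF g(1)] real])
      (use e2 in auto)
  have hol: "holomorphic_op_on rp.regular_part (ball ?a e3)"
    by (rule holomorphic_op_on_subset[OF e(2)]) (use e2 e3 in auto)
  \<comment> \<open>The two extra terms are zero, since \<open>rp.Apow\<close> vanishes from index
    \<open>n\<close> on; they put the sum into the shape that both residue computations expect, even
    for \<open>n = 0\<close>.\<close>
  have exp: "A_mer F J H \<sigma> lam w = laurent_sum ?a rp.Apow (Suc (Suc n)) w + rp.regular_part w"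
    if w: "w \<in> ball ?a e3 - {?a}" for w
  proof -
    have "w \<in> ball ?a e - {?a}" using w e2 e3 by auto
    then show ?thesis using e3(3)[OF w] g(2)[of w]
        laurent_sum_extend[of n rp.Apow "Suc (Suc n)"] rp.Apow_eq_0 by simp
  qed
  have P: "P_res F J H \<sigma> lam r\<^sub>0 = P"
    unfolding P_res_def using residue_op_laurent[OF e3(1) hol exp] by simp
  have "A_res F J H \<sigma> lam r\<^sub>0 = rp.Apow 1"
    unfolding A_res_def using residue_op_laurent_1[OF e3(1) hol exp] by simp
  also have "rp.Apow 1 = rp.A" by (rule blinfun_eqI) (simp add: rp.AP)
  finally have A: "A_res F J H \<sigma> lam r\<^sub>0 = rp.A" .
  show R: "R \<sigma> = rp.Apow" by (rule ext) (simp add: R_def rp.Apow_def A P)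
  show "A_res_pow F J H \<sigma> lam r\<^sub>0 j = blinfun_apply (R \<sigma> j)"
  proof (rule ext)
    fix x
    show "A_res_pow F J H \<sigma> lam r\<^sub>0 j x = R \<sigma> j x"
      by (cases j) (simp_all add: A_res_pow_def P A R rp.Apow_apply funpow_swap1 rp.AP
          del: rp.Apow_simps funpow.simps, simp_all add: funpow_Suc_right rp.AP del: funpow.simps)
  qed
qed

lemma A_res_pow_eq: "A_res_pow F J H \<sigma> lam r\<^sub>0 j = blinfun_apply (R \<sigma> j)"
proof -
  obtain s where s: "Z s" using nonresonant_exists by blast
  obtain T P S n where "riesz_point (A \<sigma> lam s) T (of_real r\<^sub>0) (of_real s) P S n"
    by (rule riesz_point_at[OF s])
  then show ?thesis by (rule R_eq_Apow(2)[OF s])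
qed

text \<open>Collects the algebra in terms free of the base point. In the kernel equivalence the
  right-hand side does not mention \<open>s\<close>, so the condition selects the same vectors for
  every non-resonant \<open>s\<close>.\<close>

lemma R_structure:
  assumes s: "Z s"
  shows "clinear_op (R \<sigma> j)" "R \<sigma> i (R \<sigma> j u) = R \<sigma> (i + j) u" "\<exists>n. \<forall>j\<ge>n. R \<sigma> j = 0"
    and "((\<lambda>v. v + (r\<^sub>0 - s) *\<^sub>R A \<sigma> lam s v) ^^ k) u = 0 \<longleftrightarrow> R \<sigma> 0 u = u \<and> R \<sigma> k u = 0"
    and "\<forall>j\<ge>n. R \<sigma> j = 0 \<Longrightarrow> R \<sigma> 0 u = u \<Longrightarrow> A \<sigma> lam s u = laurent_sum (of_real r\<^sub>0) (R \<sigma>) n (of_real s) u"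
proof -
  obtain T P S m where rp: "riesz_point (A \<sigma> lam s) T (of_real r\<^sub>0) (of_real s) P S m"
    by (rule riesz_point_at[OF s])
  then interpret rp: riesz_point "A \<sigma> lam s" T "of_real r\<^sub>0" "of_real s" P S m .
  have R: "R \<sigma> = rp.Apow" by (rule R_eq_Apow(1)[OF s rp])
  show "clinear_op (R \<sigma> j)" unfolding R by (rule rp.Apow_clinear)
  have "(blinfun_apply rp.A ^^ i) (rp.Apow j u) = rp.Apow (i + j) u"
    by (simp add: rp.Apow_apply funpow_add)
  then show "R \<sigma> i (R \<sigma> j u) = R \<sigma> (i + j) u"
    unfolding R rp.Apow_apply[of i "rp.Apow j u"] rp.P_Apow .
  show "\<exists>n. \<forall>j\<ge>n. R \<sigma> j = 0" unfolding R using rp.Apow_eq_0 by blast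
  have "(\<lambda>v. v + (r\<^sub>0 - s) *\<^sub>R A \<sigma> lam s v) = blinfun_apply T"
    by (rule ext) (simp add: rp.T_apply flip: scaleC_of_real)
  then show "((\<lambda>v. v + (r\<^sub>0 - s) *\<^sub>R A \<sigma> lam s v) ^^ k) u = 0 \<longleftrightarrow> R \<sigma> 0 u = u \<and> R \<sigma> k u = 0"
    unfolding R using rp.T_funpow_eq_0_iff_Apow by simp
  assume n: "\<forall>j\<ge>n. R \<sigma> j = 0" and u: "R \<sigma> 0 u = u"
  have "s \<noteq> r\<^sub>0" using s resonant by auto
  then have "A \<sigma> lam s (P u) = laurent_sum (of_real r\<^sub>0) (R \<sigma>) m (of_real s) u"
    unfolding R using rp.resolvent_on_P[OF A_bd_is_resolvent_op[OF s s]] by simp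
  also have "\<dots> = laurent_sum (of_real r\<^sub>0) (R \<sigma>) n (of_real s) u"
    using laurent_sum_extend[of n "R \<sigma>" "max m n"] laurent_sum_extend[of m "R \<sigma>" "max m n"] n rp.Apow_eq_0
    by (simp add: R)
  finally show "A \<sigma> lam s u = laurent_sum (of_real r\<^sub>0) (R \<sigma>) n (of_real s) u" using u by (simp add: R)
qed

lemma R_clinear: "clinear_op (R \<sigma> j)" and R_R: "R \<sigma> i (R \<sigma> j u) = R \<sigma> (i + j) u"
  using R_structure(1,2) nonresonant_exists by blast+

lemma R_nilpotent:
  obtains n where "\<And>\<sigma> j. n \<le> j \<Longrightarrow> R \<sigma> j = 0"
proof -
  obtain s where s: "Z s" using nonresonant_exists by blast
  obtain m1 where m1: "\<forall>j\<ge>m1. R Upper j = 0" using R_structure(3)[OF s] by blast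
  obtain m2 where m2: "\<forall>j\<ge>m2. R Lower j = 0" using R_structure(3)[OF s] by blast
  show ?thesis
  proof (rule that)
    show "R \<sigma> j = 0" if "max m1 m2 \<le> j" for \<sigma> j using that m1 m2 by (cases \<sigma>) auto
  qed
qed

lemma A_principal_part:
  assumes n: "\<And>j. n \<le> j \<Longrightarrow> R \<sigma> j = 0"
  obtains e M where "e > 0" "\<And>t. t \<noteq> r\<^sub>0 \<Longrightarrow> \<bar>t - r\<^sub>0\<bar> < e \<Longrightarrow> Z t"
    "\<And>t. t \<noteq> r\<^sub>0 \<Longrightarrow> \<bar>t - r\<^sub>0\<bar> < e \<Longrightarrow>
      norm (A \<sigma> lam t - laurent_sum (of_real r\<^sub>0) (R \<sigma>) n (of_real t)) \<le> M"
proof -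
  obtain s where s: "Z s" using nonresonant_exists by blast
  obtain T P S m where rp: "riesz_point (A \<sigma> lam s) T (of_real r\<^sub>0) (of_real s) P S m"
    by (rule riesz_point_at[OF s])
  then interpret rp: riesz_point "A \<sigma> lam s" T "of_real r\<^sub>0" "of_real s" P S m .
  have R: "R \<sigma> = rp.Apow" by (rule R_eq_Apow(1)[OF s rp])
  let ?a = "complex_of_real r\<^sub>0"
  obtain e M where e: "e > 0" "\<And>w. w \<in> ball ?a e \<Longrightarrow> norm (rp.regular_part w) \<le> M"
    "\<And>w. w \<in> ball ?a e - {?a} \<Longrightarrow> resolvent_op (A \<sigma> lam s) (w - of_real s) = laurent_sum ?a rp.Apow m w + rp.regular_part w"
    by (rule rp.laurent_expansion, rule that)
  obtain e1 where e1: "e1 > 0" "\<And>t. t \<noteq> r\<^sub>0 \<Longrightarrow> \<bar>t - r\<^sub>0\<bar> < e1 \<Longrightarrow> Z t"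
    by (rule punctured_nonresonant, rule that)
  show ?thesis
  proof (rule that[of "min e e1" M])
    show "min e e1 > 0" using e e1 by simp
    fix t assume t: "t \<noteq> r\<^sub>0" "\<bar>t - r\<^sub>0\<bar> < min e e1"
    show Zt: "Z t" using t e1(2) by simp
    have w: "complex_of_real t \<in> ball ?a e - {?a}"
      using t by (simp add: dist_of_real dist_real_def abs_minus_commute)
    have "A \<sigma> lam t = laurent_sum ?a (R \<sigma>) m (of_real t) + rp.regular_part (of_real t)"
      using e(3)[OF w] resolvent_op_eq[OF A_clinear[OF s] A_bd_is_resolvent_op[OF Zt s]] by (simp add: R)
    moreover have "laurent_sum ?a (R \<sigma>) m (of_real t) = laurent_sum ?a (R \<sigma>) n (of_real t)"
      using laurent_sum_extend[of n "R \<sigma>" "max m n"] laurent_sum_extend[of m "R \<sigma>" "max m n"] n rp.Apow_eq_0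
      by (simp add: R)
    ultimately show "norm (A \<sigma> lam t - laurent_sum ?a (R \<sigma>) n (of_real t)) \<le> M"
      using e(2)[of "of_real t"] w by simp
  qed
qed

text \<open>
  Every linear identity between matrix elements of \<open>A(t)\<close> for real \<open>t\<close> near \<open>r\<^sub>0\<close> passes
  to the coefficients of the principal parts.
\<close>

lemma principal_part_transfer:
  fixes f g :: "('k \<Rightarrow>\<^sub>L 'k) \<Rightarrow> complex"
  assumes f: "bounded_linear f" "\<And>c T. f (scale_op c T) = c * f T"
    and g: "bounded_linear g" "\<And>c T. g (scale_op (of_real c) T) = of_real c * g T"
    and eq: "\<And>t. Z t \<Longrightarrow> f (A \<sigma> lam t) = g (A \<tau> lam t)"
  shows "f (R \<sigma> j) = g (R \<tau> j)"
proof -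
  obtain n where n: "\<And>\<sigma> j. n \<le> j \<Longrightarrow> R \<sigma> j = 0" using R_nilpotent by blast
  obtain e1 M1 where 1: "e1 > 0" "\<And>t. t \<noteq> r\<^sub>0 \<Longrightarrow> \<bar>t - r\<^sub>0\<bar> < e1 \<Longrightarrow> Z t"
    "\<And>t. t \<noteq> r\<^sub>0 \<Longrightarrow> \<bar>t - r\<^sub>0\<bar> < e1 \<Longrightarrow>
      norm (A \<sigma> lam t - laurent_sum (of_real r\<^sub>0) (R \<sigma>) n (of_real t)) \<le> M1"
    by (rule A_principal_part[where \<sigma> = \<sigma> and n = n, OF n], assumption, rule that)
  obtain e2 M2 where 2: "e2 > 0"
    "\<And>t. t \<noteq> r\<^sub>0 \<Longrightarrow> \<bar>t - r\<^sub>0\<bar> < e2 \<Longrightarrow>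
      norm (A \<tau> lam t - laurent_sum (of_real r\<^sub>0) (R \<tau>) n (of_real t)) \<le> M2"
    by (rule A_principal_part[where \<sigma> = \<tau> and n = n, OF n], assumption, rule that)
  obtain Cf where Cf: "\<And>T. norm (f T) \<le> norm T * Cf" "Cf \<ge> 0"
    using bounded_linear.nonneg_bounded[OF f(1)] by blast
  obtain Cg where Cg: "\<And>T. norm (g T) \<le> norm T * Cg" "Cg \<ge> 0"
    using bounded_linear.nonneg_bounded[OF g(1)] by blast
  have "f (R \<sigma> j) - g (R \<tau> j) = 0" if "j < n" for j
  proof (rule bounded_principal_part_eq_0[where e = "min e1 e2" and n = n and j = j
        and c = "\<lambda>j. f (R \<sigma> j) - g (R \<tau> j)" and M = "M1 * Cf + M2 * Cg"])
    show "min e1 e2 > 0" using 1 2 by simp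
    fix t :: real assume t: "0 < t" "t < min e1 e2"
    let ?t = "r\<^sub>0 + t"
    let ?L = "\<lambda>\<sigma>. laurent_sum (of_real r\<^sub>0) (R \<sigma>) n (of_real ?t)"
    have Lf: "f (?L \<sigma>) = (\<Sum>j<n. 1 / of_real t ^ Suc j * f (R \<sigma> j))"
      by (simp add: laurent_sum_def linear_sum[OF bounded_linear.linear[OF f(1)]] f(2))
    \<comment> \<open>Only real scalars pass through \<open>g\<close>, and \<open>t\<close> is real;
      this leaves room for functionals that are conjugate-linear.\<close>
    have g': "g (scale_op (1 / complex_of_real t ^ Suc j) T) = 1 / of_real t ^ Suc j * g T" for j T
      using g(2)[of "1 / t ^ Suc j" T] by simp
    have Lg: "g (?L \<tau>) = (\<Sum>j<n. 1 / of_real t ^ Suc j * g (R \<tau> j))"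
      by (simp add: laurent_sum_def linear_sum[OF bounded_linear.linear[OF g(1)]] g' del: power_Suc)
    have "norm (A \<sigma> lam ?t - ?L \<sigma>) \<le> M1" using 1(3)[of ?t] t by simp
    then have a: "norm (f (A \<sigma> lam ?t - ?L \<sigma>)) \<le> M1 * Cf"
      using Cf by (meson mult_right_mono order_trans)
    have "norm (A \<tau> lam ?t - ?L \<tau>) \<le> M2" using 2(2)[of ?t] t by simp
    then have b: "norm (g (A \<tau> lam ?t - ?L \<tau>)) \<le> M2 * Cg"
      using Cg by (meson mult_right_mono order_trans)
    have "Z ?t" using 1(2)[of ?t] t by simp
    then have "f (?L \<sigma>) - g (?L \<tau>) = g (A \<tau> lam ?t - ?L \<tau>) - f (A \<sigma> lam ?t - ?L \<sigma>)"
      by (simp add: linear_diff[OF bounded_linear.linear] f(1) g(1) eq)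
    then have "norm (f (?L \<sigma>) - g (?L \<tau>)) \<le> M1 * Cf + M2 * Cg"
      using a b norm_triangle_ineq4[of "g (A \<tau> lam ?t - ?L \<tau>)" "f (A \<sigma> lam ?t - ?L \<sigma>)"] by simp
    then show "cmod (\<Sum>j<n. 1 / of_real t ^ Suc j * (f (R \<sigma> j) - g (R \<tau> j))) \<le> M1 * Cf + M2 * Cg"
      unfolding Lf Lg by (simp only: right_diff_distrib sum_subtractf)
  qed (rule that)
  moreover have "f (R \<sigma> j) - g (R \<tau> j) = 0" if "j \<ge> n"
    using n[OF that] linear_0[OF bounded_linear.linear[OF f(1)]] linear_0[OF bounded_linear.linear[OF g(1)]]
    by simp
  ultimately show ?thesis by (cases "j < n") auto
qed

lemma Upsilon_k_iff: "u \<in> Upsilon_k F J H \<sigma> lam r\<^sub>0 k \<longleftrightarrow> R \<sigma> 0 u = u \<and> R \<sigma> k u = 0"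
  unfolding Upsilon_k_def mem_Collect_eq using R_structure(4) nonresonant_exists by blast

lemma Upsilon_iff: "u \<in> Upsilon F J H \<sigma> lam r\<^sub>0 \<longleftrightarrow> R \<sigma> 0 u = u"
proof -
  obtain n where "\<And>\<sigma> j. n \<le> j \<Longrightarrow> R \<sigma> j = 0" using R_nilpotent by blast
  then have "R \<sigma> n u = 0" by simp
  then show ?thesis unfolding Upsilon_def using Upsilon_k_iff by blast
qed

section \<open>Duality between the two boundary values\<close>

lemma JA_adjoint:
  assumes "Z t" shows "cinner x (J (A Upper lam t y)) = cnj (cinner y (J (A Lower lam t x)))"
proof -
  have "cinner x (J (A Upper lam t y)) = cinner (J x) (T_bd F (H t) Upper lam (J y))"
    unfolding J_symmetric by (simp add: A_bd_def)
  also have "\<dots> = cinner (T_bd F (H t) Lower lam (J x)) (J y)" by (rule T_bd_adjoint[OF assms, symmetric])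
  also have "\<dots> = cinner (J (A Lower lam t x)) y" unfolding J_symmetric by (simp add: A_bd_def)
  also have "\<dots> = cnj (cinner y (J (A Lower lam t x)))" by (rule cinner_commute)
  finally show ?thesis .
qed

text \<open>Conjugation does not affect the powers of \<open>t - r\<^sub>0\<close> at real
  \<open>t\<close>, so the duality of the boundary operators descends to their Laurent
  coefficients.\<close>

lemma JR_adjoint: "cinner x (J (R Upper j y)) = cnj (cinner y (J (R Lower j x)))"
proof (rule principal_part_transfer[where f = "\<lambda>T. cinner x (J (T y))" and g = "\<lambda>T. cnj (cinner y (J (T x)))"])
  show lin: "bounded_linear (\<lambda>T :: 'k \<Rightarrow>\<^sub>L 'k. cinner x (J (T y)))" for x y
    using bounded_linear_compose[OF bounded_linear_cinner_right
        bounded_linear_compose[OF blinfun.bounded_linear_right blinfun.bounded_linear_left]] .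
  show "bounded_linear (\<lambda>T :: 'k \<Rightarrow>\<^sub>L 'k. cnj (cinner y (J (T x))))"
    by (rule bounded_linear_compose[OF bounded_linear_cnj lin])
qed (simp_all add: scale_op_apply clinear_opD[OF J_clinear] JA_adjoint)

lemma R_eq_if_A_eq:
  assumes "\<And>t. Z t \<Longrightarrow> A Upper lam t u = A Lower lam t u"
  shows "R Upper j u = R Lower j u"
proof (rule cinner_ext)
  fix z
  show "cinner z (R Upper j u) = cinner z (R Lower j u)"
    by (rule principal_part_transfer[where f = "\<lambda>T. cinner z (T u)" and g = "\<lambda>T. cinner z (T u)"])
      (simp_all add: bounded_linear_matrix_element scale_op_apply assms)
qed

lemma A_eq_if_R_eq:
  assumes R: "\<And>j. R Upper j u = R Lower j u" and u: "R Upper 0 u = u" and t: "Z t"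
  shows "A Upper lam t u = A Lower lam t u"
proof -
  obtain n where n: "\<And>\<sigma> j. n \<le> j \<Longrightarrow> R \<sigma> j = 0" using R_nilpotent by blast
  have "A \<sigma> lam t u = (\<Sum>j<n. (1 / (of_real t - of_real r\<^sub>0) ^ Suc j) *\<^sub>C R \<sigma> j u)" if "R \<sigma> 0 u = u" for \<sigma>
    using R_structure(5)[where n = n and \<sigma> = \<sigma> and u = u, OF t] n that by (simp add: laurent_sum_apply)
  then show ?thesis using u R by simp
qed

text \<open>If \<open>J u\<close> is zero then so is A(s) u, and 1 + (r0 - s) A(s) fixes
  \<open>u\<close>; but some power of this operator annihilates every resonance vector.\<close>

lemma J_injective_on_Upsilon:
  assumes u: "R \<sigma> 0 u = u" and J: "J u = 0" shows "u = 0"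
proof -
  obtain s where s: "Z s" using nonresonant_exists by blast
  obtain n where n: "\<And>\<sigma> j. n \<le> j \<Longrightarrow> R \<sigma> j = 0" using R_nilpotent by blast
  have "A \<sigma> lam s u = 0" by (simp add: A_bd_def J blinfun.zero_right)
  then have "((\<lambda>v. v + (r\<^sub>0 - s) *\<^sub>R A \<sigma> lam s v) ^^ k) u = u" for k by (induction k) simp_all
  moreover have "((\<lambda>v. v + (r\<^sub>0 - s) *\<^sub>R A \<sigma> lam s v) ^^ n) u = 0"
    using R_structure(4)[OF s] u n by simp
  ultimately show ?thesis by metis
qed

text \<open>Vanishing on one side makes all matrix elements of J R on the other side vanish by
  duality, and \<open>J\<close> can be cancelled on resonance vectors. Hence the poles have equal
  order.\<close>

lemma R_zero_iff: "R Upper j = 0 \<longleftrightarrow> R Lower j = 0"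
proof -
  have zero: "R \<sigma> j = 0" if "\<And>x y. cinner y (J (R \<sigma> j x)) = 0" for \<sigma>
  proof (rule blinfun_eqI)
    fix x
    have "J (R \<sigma> j x) = 0" by (rule cinner_ext) (simp add: that)
    then have "R \<sigma> j x = 0" by (rule J_injective_on_Upsilon[of \<sigma>, rotated]) (simp add: R_R)
    then show "R \<sigma> j x = blinfun_apply 0 x" by simp
  qed
  have "cinner y (J (R Lower j x)) = cnj (cinner x (J (R Upper j y)))" for x y
    by (simp add: JR_adjoint)
  then show ?thesis using zero[of Upper] zero[of Lower] JR_adjoint[of _ j] by (auto simp: blinfun.zero_right)
qed

lemma res_order: "R \<sigma> (res_order F J H Upper lam r\<^sub>0) = 0" "res_order F J H Upper lam r\<^sub>0 > 0"
proof -
  let ?d = "res_order F J H Upper lam r\<^sub>0"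
  obtain n where n: "\<And>\<sigma> j. n \<le> j \<Longrightarrow> R \<sigma> j = 0" using R_nilpotent by blast
  have "Upsilon_k F J H Upper lam r\<^sub>0 n = Upsilon F J H Upper lam r\<^sub>0"
    by (auto simp: Upsilon_k_iff Upsilon_iff n)
  then have d: "Upsilon_k F J H Upper lam r\<^sub>0 ?d = Upsilon F J H Upper lam r\<^sub>0"
    unfolding res_order_def by (rule LeastI)
  have zero: "R Upper ?d = 0"
  proof (rule blinfun_eqI)
    fix x
    have "R Upper 0 x \<in> Upsilon F J H Upper lam r\<^sub>0" by (simp add: Upsilon_iff R_R)
    then have "R Upper ?d (R Upper 0 x) = 0" unfolding d[symmetric] Upsilon_k_iff by blast
    then show "R Upper ?d x = blinfun_apply 0 x" by (simp add: R_R)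
  qed
  then show "R \<sigma> ?d = 0" using R_zero_iff by (cases \<sigma>) auto
  show "?d > 0"
  proof (rule ccontr)
    \<comment> \<open>With order zero both projections would vanish, 1 + (r0 - s) A(s) would be
      injective on both sides, and \<open>r\<^sub>0\<close> would be non-resonant.\<close>
    assume "\<not> ?d > 0"
    then have R0: "R \<tau> 0 = 0" for \<tau> using zero R_zero_iff by (cases \<tau>) auto
    obtain s where s: "Z s" using nonresonant_exists by blast
    have "Z r\<^sub>0"
    proof (rule nonresonant_if_injective[OF s])
      fix \<tau> x assume "x + (complex_of_real r\<^sub>0 - of_real s) *\<^sub>C A \<tau> lam s x = 0"
      then have "((\<lambda>v. v + (r\<^sub>0 - s) *\<^sub>R A \<tau> lam s v) ^^ 1) x = 0" by (simp flip: scaleC_of_real)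
      then show "x = 0" using R_structure(4)[where \<sigma> = \<tau> and k = 1 and u = x, OF s] R0[of \<tau>] by simp
    qed
    then show False using resonant by simp
  qed
qed

lemma R_eq_0: "res_order F J H Upper lam r\<^sub>0 \<le> j \<Longrightarrow> R \<sigma> j u = 0"
  using R_R[of \<sigma> "j - res_order F J H Upper lam r\<^sub>0" "res_order F J H Upper lam r\<^sub>0" u] res_order(1)[of \<sigma>]
  by (simp add: blinfun.zero_right)

lemma Im_op_T:
  assumes "Z s"
  shows "Im_op (T_bd F (H s) Upper lam) x
    = (1 / (2 * \<i>)) *\<^sub>C (T_bd F (H s) Upper lam x - T_bd F (H s) Lower lam x)"
proof -
  have "adjoint_op (T_bd F (H s) Upper lam) = T_bd F (H s) Lower lam"
    by (rule adjoint_op_eqI) (rule T_bd_adjoint[OF assms])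
  then show ?thesis by (simp add: Im_op_def scale_op_apply blinfun.diff_left)
qed

lemma cinner_T_Lower:
  "Z s \<Longrightarrow> cinner x (T_bd F (H s) Lower lam x) = cnj (cinner x (T_bd F (H s) Upper lam x))"
  using T_bd_adjoint[of s x x] cinner_commute[of x "T_bd F (H s) Lower lam x"] by simp

lemma cinner_Im_op:
  assumes "Z s"
  shows "cinner x (Im_op (T_bd F (H s) Upper lam) x) = of_real (Im (cinner x (T_bd F (H s) Upper lam x)))"
  by (simp add: Im_op_T[OF assms] cinner_diff_right cinner_T_Lower[OF assms] complex_eq_iff)

lemma Im_op_positive:
  assumes "Z s" shows "positive_op (Im_op (T_bd F (H s) Upper lam))"
  unfolding positive_op_def
proof (intro conjI allI)
  show "clinear_op (Im_op (T_bd F (H s) Upper lam))"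
    unfolding clinear_op_def Im_op_T[OF assms]
    by (simp add: clinear_opD[OF compact_op_clinear[OF T_bd_compact[OF assms]]] scaleC_scaleC mult.commute
        flip: cvec.scale_right_diff_distrib)
qed (simp_all add: cinner_Im_op assms T_bd_positive)

lemma sqrt_Im_op_iff:
  assumes "Z s"
  shows "sqrt_op (Im_op (T_bd F (H s) Upper lam)) (J u) = 0 \<longleftrightarrow> A Upper lam s u = A Lower lam s u"
  unfolding sqrt_op_apply_eq_zero_iff[OF Im_op_positive[OF assms]] Im_op_T[OF assms]
  by (simp add: A_bd_def)

text \<open>The lower quadratic form is the conjugate of the upper one, so the hypothesis on either
  side makes the form of the positive operator Im T_+ vanish at \<open>J u\<close>; positivity then
  gives that this operator annihilates \<open>J u\<close>.\<close>

lemma A_eq_if_Im_eq_0: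
  assumes s: "Z s" and Im: "Im (cinner (J u) (A \<sigma> lam s u)) = 0"
  shows "A Upper lam s u = A Lower lam s u"
proof -
  have "Im (cinner (J u) (T_bd F (H s) Upper lam (J u))) = 0"
    using Im cinner_T_Lower[OF s, of "J u"] by (cases \<sigma>) (simp_all add: A_bd_def)
  then have "Im_op (T_bd F (H s) Upper lam) (J u) = 0"
    by (intro positive_op_eq_zero[OF Im_op_positive[OF s]]) (simp add: cinner_Im_op[OF s])
  then show ?thesis by (simp add: Im_op_T[OF s] A_bd_def)
qed

text \<open>The condition behind all nine descriptions. It is symmetric in the two sides: the
  equality at \<open>j = 0\<close> makes \<open>u\<close> fixed by \<open>R Lower 0\<close> as
  well.\<close>

definition UI :: "'k set" where
  "UI = {u. R Upper 0 u = u \<and> (\<forall>j. R Upper j u = R Lower j u)}"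

lemma UI_fixed: "u \<in> UI \<Longrightarrow> R \<sigma> 0 u = u"
  by (cases \<sigma>) (auto simp: UI_def)

lemma UI_R_eq: "u \<in> UI \<Longrightarrow> R \<sigma> j u = R \<tau> j u"
  by (cases \<sigma>; cases \<tau>) (auto simp: UI_def)

lemma UI_iff_A_eq: "u \<in> UI \<longleftrightarrow> R \<sigma> 0 u = u \<and> (\<forall>s. Z s \<longrightarrow> A Upper lam s u = A Lower lam s u)"
proof
  assume u: "u \<in> UI"
  have "A Upper lam s u = A Lower lam s u" if "Z s" for s
    by (rule A_eq_if_R_eq[OF UI_R_eq[OF u] UI_fixed[OF u] that])
  then show "R \<sigma> 0 u = u \<and> (\<forall>s. Z s \<longrightarrow> A Upper lam s u = A Lower lam s u)"
    using UI_fixed[OF u] by blast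
next
  assume u: "R \<sigma> 0 u = u \<and> (\<forall>s. Z s \<longrightarrow> A Upper lam s u = A Lower lam s u)"
  then have "R Upper j u = R Lower j u" for j using R_eq_if_A_eq by blast
  then show "u \<in> UI" using u by (cases \<sigma>) (auto simp: UI_def)
qed

text \<open>For \<open>u\<close> in \<open>UI\<close> the inner coefficient can be switched to the
  side of the outer one, after which products just add indices.\<close>

lemma UI_R_invariant: "u \<in> UI \<Longrightarrow> R \<sigma> i u \<in> UI"
proof -
  assume u: "u \<in> UI"
  have "R \<tau> j (R \<sigma> i u) = R Upper (j + i) u" for \<tau> j
    using UI_R_eq[OF u, of \<sigma> i \<tau>] UI_R_eq[OF u, of \<tau> "j + i" Upper] by (simp add: R_R)
  then show "R \<sigma> i u \<in> UI" using UI_R_eq[OF u, of \<sigma> i Upper] by (simp add: UI_def)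
qed

lemma csubspace_UI: "csubspace UI"
  by (rule csubspaceI) (auto simp: UI_def blinfun.add_right blinfun.zero_right clinear_opD[OF R_clinear])

lemma UI_iff_order:
  "u \<in> UI \<longleftrightarrow> (R Upper 0 u = u \<or> R Lower 0 u = u) \<and>
    (\<forall>j < res_order F J H Upper lam r\<^sub>0. R Upper j u = R Lower j u)"
proof
  assume u: "(R Upper 0 u = u \<or> R Lower 0 u = u) \<and>
    (\<forall>j < res_order F J H Upper lam r\<^sub>0. R Upper j u = R Lower j u)"
  then have "R Upper j u = R Lower j u" for j
    using R_eq_0 by (cases "j < res_order F J H Upper lam r\<^sub>0") auto
  then show "u \<in> UI" using u by (auto simp: UI_def)
qed (auto simp: UI_def)

text \<open>
  The span of the \<open>R \<sigma> j u\<close> is invariant under \<open>1 + (s - t) A(t)\<close>, so there the two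
  resolvent families, agreeing at \<open>s\<close>, agree everywhere.
\<close>

lemma A_eq_from_one_point:
  assumes s: "Z s" and t: "Z t" and u: "R \<sigma> 0 u = u"
    and eq: "\<And>j. A \<sigma> lam s (R \<sigma> j u) = A \<tau> lam s (R \<sigma> j u)"
  shows "A \<sigma> lam t u = A \<tau> lam t u"
proof -
  obtain n where n: "\<And>\<sigma> j. n \<le> j \<Longrightarrow> R \<sigma> j = 0" using R_nilpotent by blast
  let ?c = "complex_of_real t - of_real s"
  \<comment> \<open>Preimage of \<open>u\<close> under 1 + (t - s) A(s) on the side
    \<open>\<sigma>\<close>. The Laurent sum of A(t) u makes it a combination of the vectors
    \<open>R \<sigma> j u\<close>, on which the two operators at \<open>s\<close> agree.\<close>
  define v where "v = u - ?c *\<^sub>C A \<sigma> lam t u"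
  have Av: "A \<rho> lam s v = A \<rho> lam s (R \<sigma> 0 u)
      - ?c *\<^sub>C (\<Sum>j<n. (1 / (of_real t - of_real r\<^sub>0) ^ Suc j) *\<^sub>C A \<rho> lam s (R \<sigma> j u))" for \<rho>
    using R_structure(5)[where n = n and \<sigma> = \<sigma> and u = u, OF t] n u
    by (simp add: v_def laurent_sum_apply blinfun.diff_right blinfun.sum_right clinear_opD[OF A_clinear[OF s]]
        del: power_Suc)
  have same: "A \<tau> lam s v = A \<sigma> lam s v" unfolding Av by (simp only: eq)
  have uv: "u = v + ?c *\<^sub>C A \<sigma> lam s v" "A \<sigma> lam s v = A \<sigma> lam t u"
    unfolding v_def
    using is_resolvent_op_surj[OF A_clinear[OF s, of \<sigma>] A_bd_is_resolvent_op[OF t s, of \<sigma>], of u] by blast+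
  have "A \<tau> lam t u = A \<tau> lam t (v + ?c *\<^sub>C A \<tau> lam s v)" using uv(1) same by simp
  also have "\<dots> = A \<tau> lam s v" by (rule is_resolvent_opD(2)[OF A_bd_is_resolvent_op[OF t s]])
  finally show ?thesis using same uv(2) by simp
qed

lemma UI_iff_one_point:
  "u \<in> UI \<longleftrightarrow> R \<sigma> 0 u = u \<and> (\<exists>s. Z s \<and> (\<forall>j. (A Upper lam s - A Lower lam s) (R \<sigma> j u) = 0))"
proof
  assume u: "u \<in> UI"
  obtain s where s: "Z s" using nonresonant_exists by blast
  have "A Upper lam s (R \<sigma> j u) = A Lower lam s (R \<sigma> j u)" for j
    using UI_R_invariant[OF u] s UI_iff_A_eq[of "R \<sigma> j u" Upper] by blast
  then show "R \<sigma> 0 u = u \<and> (\<exists>s. Z s \<and> (\<forall>j. (A Upper lam s - A Lower lam s) (R \<sigma> j u) = 0))"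
    using s UI_fixed[OF u] by (auto simp: blinfun.diff_left)
next
  assume "R \<sigma> 0 u = u \<and> (\<exists>s. Z s \<and> (\<forall>j. (A Upper lam s - A Lower lam s) (R \<sigma> j u) = 0))"
  then obtain s where u: "R \<sigma> 0 u = u" and s: "Z s"
    and eq: "\<And>j. A Upper lam s (R \<sigma> j u) = A Lower lam s (R \<sigma> j u)" by (auto simp: blinfun.diff_left)
  have "A Upper lam t u = A Lower lam t u" if t: "Z t" for t
  proof (cases \<sigma>)
    case Upper
    then show ?thesis using A_eq_from_one_point[OF s t u, of Lower] eq by simp
  next
    case Lower
    then show ?thesis using A_eq_from_one_point[OF s t u, of Upper] eq by simp
  qed
  then show "u \<in> UI" using UI_iff_A_eq u by blast
qed

text \<open>When both sides agree at \<open>u\<close>, duality equates each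
  \<open>cinner u (J (R \<sigma> j u))\<close> with its own conjugate. Conversely, these numbers are
  the Laurent coefficients of \<open>cinner (J u) (A \<sigma> lam s u)\<close>, so their reality
  makes this form real at every non-resonant \<open>s\<close>.\<close>

lemma UI_iff_coeff:
  "u \<in> UI \<longleftrightarrow> R \<sigma> 0 u = u \<and> (\<forall>k. u \<in> Upsilon_k F J H \<sigma> lam r\<^sub>0 k \<longrightarrow>
    (\<forall>j\<in>{2..k}. coeff_c F J H \<sigma> lam r\<^sub>0 u j = 0))"
proof
  assume u: "u \<in> UI"
  have "Im (cinner u (J (R \<sigma> j u))) = 0" for j
  proof -
    have "cinner u (J (R Upper j u)) = cnj (cinner u (J (R Upper j u)))"
      using JR_adjoint[of u j u] UI_R_eq[OF u, of Lower j Upper] by simp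
    then have "Im (cinner u (J (R Upper j u))) = 0" by (metis cnj.simps(2) equation_minus_iff neg_equal_zero)
    then show ?thesis using UI_R_eq[OF u, of \<sigma> j Upper] by simp
  qed
  then show "R \<sigma> 0 u = u \<and> (\<forall>k. u \<in> Upsilon_k F J H \<sigma> lam r\<^sub>0 k \<longrightarrow>
      (\<forall>j\<in>{2..k}. coeff_c F J H \<sigma> lam r\<^sub>0 u j = 0))"
    using UI_fixed[OF u] by (simp add: coeff_c_def A_res_pow_eq)
next
  assume "R \<sigma> 0 u = u \<and> (\<forall>k. u \<in> Upsilon_k F J H \<sigma> lam r\<^sub>0 k \<longrightarrow>
      (\<forall>j\<in>{2..k}. coeff_c F J H \<sigma> lam r\<^sub>0 u j = 0))"
  then have u: "R \<sigma> 0 u = u"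
    and c: "\<And>k j. u \<in> Upsilon_k F J H \<sigma> lam r\<^sub>0 k \<Longrightarrow> 2 \<le> j \<Longrightarrow> j \<le> k \<Longrightarrow> coeff_c F J H \<sigma> lam r\<^sub>0 u j = 0"
    by auto
  obtain n where n: "\<And>\<sigma> j. n \<le> j \<Longrightarrow> R \<sigma> j = 0" using R_nilpotent by blast
  \<comment> \<open>The pairing at index 0 is not among the coefficients, which start at 2 and are
    shifted by one; it is \<open>cinner u (J u)\<close>, real because \<open>J\<close> is
    self-adjoint.\<close>
  have real: "Im (cinner u (J (R \<sigma> j u))) = 0" for j
  proof (cases "j = 0")
    case True
    have "cinner u (J u) = cnj (cinner u (J u))"
      using J_symmetric[of u u] cinner_commute[of u "J u"] by simp
    then show ?thesis using True u by (metis cnj.simps(2) equation_minus_iff neg_equal_zero)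
  next
    case False
    have "u \<in> Upsilon_k F J H \<sigma> lam r\<^sub>0 (max n (Suc j))" by (simp add: Upsilon_k_iff u n)
    then have "coeff_c F J H \<sigma> lam r\<^sub>0 u (Suc j) = 0" by (rule c) (use False in auto)
    then show ?thesis by (simp add: coeff_c_def A_res_pow_eq)
  qed
  have "A Upper lam s u = A Lower lam s u" if s: "Z s" for s
  proof (rule A_eq_if_Im_eq_0[OF s, where \<sigma> = \<sigma>])
    have "cinner (J u) (A \<sigma> lam s u) = cinner u (J (A \<sigma> lam s u))" by (rule J_symmetric)
    also have "\<dots> = (\<Sum>j<n. of_real (1 / (s - r\<^sub>0) ^ Suc j) * cinner u (J (R \<sigma> j u)))"
      using R_structure(5)[where n = n and \<sigma> = \<sigma> and u = u, OF s] n u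
      by (simp add: laurent_sum_apply blinfun.sum_right clinear_opD[OF J_clinear]
          linear_sum[OF bounded_linear.linear[OF bounded_linear_cinner_right]] del: power_Suc)
    finally have "cinner (J u) (A \<sigma> lam s u)
      = (\<Sum>j<n. of_real (1 / (s - r\<^sub>0) ^ Suc j) * cinner u (J (R \<sigma> j u)))" .
    moreover have "Im (of_real a * z) = a * Im z" for a z by simp
    ultimately show "Im (cinner (J u) (A \<sigma> lam s u)) = 0"
      by (simp only: Im_sum real mult_zero_right sum.neutral_const)
  qed
  then show "u \<in> UI" using UI_iff_A_eq u by blast
qed

end

theorem theorem1p30:
  fixes F :: "('h::complex_hilbert \<times> 'k::complex_hilbert) set"
    and J :: "'k \<Rightarrow>\<^sub>L 'k"
    and H0 V :: "('h \<times> 'h) set"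
    and H :: "real \<Rightarrow> ('h \<times> 'h) set"
    and D :: "'h set"
    and lam r\<^sub>0 :: real
  assumes sep: "separable_space (euclidean :: 'h topology)" "separable_space (euclidean :: 'k topology)"
    and F_op: "linear_operator F" "closed F" "densely_defined F"
    and F_ker: "trivial_kernel F" "trivial_cokernel F"
    and J: "selfadjoint_op J"
    and V: "V = FJF F J" "self_adjoint V"
    and H0: "self_adjoint H0"
    and H: "H = line H0 V" "\<And>r. self_adjoint (H r)"
    and D: "\<And>r. Domain (H r) = D" "closure D = UNIV" "D \<subseteq> Domain F \<inter> Domain V"
    and V_rel_compact: "\<And>r. relatively_compact V (H r)"
    and T_compact: "\<And>r z. Im z \<noteq> 0 \<Longrightarrow> \<exists>T. compact_extension (sandwich F (H r) z) T"
    and Lambda_full: "\<And>r. - Lambda F (H r) \<in> null_sets lebesgue"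
    and lam: "lam \<in> Lambda_line F H"
    and r0: "resonance_point F H lam r\<^sub>0"
  shows
    "\<exists>\<Upsilon>I :: 'k set.
      (\<forall>u.
        (u \<in> \<Upsilon>I \<longleftrightarrow> u \<in> Upsilon F J H Upper lam r\<^sub>0 \<and>
           (\<forall>s. nonresonant F H lam s \<longrightarrow> sqrt_op (Im_op (T_bd F (H s) Upper lam)) (J u) = 0)) \<and>
        (u \<in> \<Upsilon>I \<longleftrightarrow> u \<in> Upsilon F J H Lower lam r\<^sub>0 \<and>
           (\<forall>s. nonresonant F H lam s \<longrightarrow> sqrt_op (Im_op (T_bd F (H s) Upper lam)) (J u) = 0)) \<and>
        (u \<in> \<Upsilon>I \<longleftrightarrow> u \<in> Upsilon F J H Upper lam r\<^sub>0 \<and>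
           (\<forall>s. nonresonant F H lam s \<longrightarrow> A_bd F J H Upper lam s u = A_bd F J H Lower lam s u)) \<and>
        (u \<in> \<Upsilon>I \<longleftrightarrow> u \<in> Upsilon F J H Lower lam r\<^sub>0 \<and>
           (\<forall>s. nonresonant F H lam s \<longrightarrow> A_bd F J H Upper lam s u = A_bd F J H Lower lam s u)) \<and>
        (u \<in> \<Upsilon>I \<longleftrightarrow> (u \<in> Upsilon F J H Upper lam r\<^sub>0 \<or> u \<in> Upsilon F J H Lower lam r\<^sub>0) \<and>
           (\<forall>j < res_order F J H Upper lam r\<^sub>0.
              A_res_pow F J H Upper lam r\<^sub>0 j u = A_res_pow F J H Lower lam r\<^sub>0 j u)) \<and>
        (u \<in> \<Upsilon>I \<longleftrightarrow> u \<in> Upsilon F J H Upper lam r\<^sub>0 \<and>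
           (\<exists>s. nonresonant F H lam s \<and>
             (\<forall>j. (A_bd F J H Upper lam s - A_bd F J H Lower lam s) (A_res_pow F J H Upper lam r\<^sub>0 j u) = 0))) \<and>
        (u \<in> \<Upsilon>I \<longleftrightarrow> u \<in> Upsilon F J H Lower lam r\<^sub>0 \<and>
           (\<exists>s. nonresonant F H lam s \<and>
             (\<forall>j. (A_bd F J H Upper lam s - A_bd F J H Lower lam s) (A_res_pow F J H Lower lam r\<^sub>0 j u) = 0))) \<and>
        (u \<in> \<Upsilon>I \<longleftrightarrow> u \<in> Upsilon F J H Upper lam r\<^sub>0 \<and>
           (\<forall>k. u \<in> Upsilon_k F J H Upper lam r\<^sub>0 k \<longrightarrow>
             (\<forall>j\<in>{2..k}. coeff_c F J H Upper lam r\<^sub>0 u j = 0))) \<and>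
        (u \<in> \<Upsilon>I \<longleftrightarrow> u \<in> Upsilon F J H Lower lam r\<^sub>0 \<and>
           (\<forall>k. u \<in> Upsilon_k F J H Lower lam r\<^sub>0 k \<longrightarrow>
             (\<forall>j\<in>{2..k}. coeff_c F J H Lower lam r\<^sub>0 u j = 0)))) \<and>
      csubspace \<Upsilon>I \<and>
      \<Upsilon>I \<subseteq> Upsilon F J H Upper lam r\<^sub>0 \<inter> Upsilon F J H Lower lam r\<^sub>0 \<and>
      (\<forall>j. \<forall>u\<in>\<Upsilon>I. A_res_pow F J H Upper lam r\<^sub>0 j u \<in> \<Upsilon>I \<and> A_res_pow F J H Lower lam r\<^sub>0 j u \<in> \<Upsilon>I)"
proof -
  interpret resonance F J H0 V H lam r\<^sub>0
  proof
    show "Domain (H r) \<subseteq> Domain F" for r using D by auto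
    show "\<not> nonresonant F H lam r\<^sub>0" using r0 by (simp add: resonance_point_def)
  qed (use F_op J V H V_rel_compact T_compact lam in auto)
  show ?thesis
    unfolding Upsilon_iff A_res_pow_eq
  proof (intro exI[of _ UI] conjI allI ballI)
    fix u
    show "u \<in> UI \<longleftrightarrow> R Upper 0 u = u \<and>
        (\<forall>s. nonresonant F H lam s \<longrightarrow> sqrt_op (Im_op (T_bd F (H s) Upper lam)) (J u) = 0)"
      using UI_iff_A_eq[of u Upper] sqrt_Im_op_iff by simp
    show "u \<in> UI \<longleftrightarrow> R Lower 0 u = u \<and>
        (\<forall>s. nonresonant F H lam s \<longrightarrow> sqrt_op (Im_op (T_bd F (H s) Upper lam)) (J u) = 0)"
      using UI_iff_A_eq[of u Lower] sqrt_Im_op_iff by simp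
    show "u \<in> UI \<Longrightarrow> R Upper j u \<in> UI" for j by (rule UI_R_invariant)
    show "u \<in> UI \<Longrightarrow> R Lower j u \<in> UI" for j by (rule UI_R_invariant)
  next
    show "UI \<subseteq> Upsilon F J H Upper lam r\<^sub>0 \<inter> Upsilon F J H Lower lam r\<^sub>0"
      using UI_fixed by (auto simp: Upsilon_iff)
  qed (rule UI_iff_A_eq UI_iff_order UI_iff_one_point UI_iff_coeff csubspace_UI)+
qed

end
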